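(* Let $N \ge 2$, let $\Omega \subset \mathbb{R}^N$ be a bounded domain, and let $R = \sup_{x \in \Omega} |x|$. Assume that there exists a point $x_0 \in \partial\Omega \cap \partial B_R$ satisfying an interior sphere condition. Then $$C_N(\Omega) = \left( \frac{N-1}{N} \right)^N$$ and the infimum $C_N(\Omega)$ is not attained by any $u \in W^{1,N}_0(\Omega)$, $u \not\equiv 0$.
   Context: A domain is a nonempty connected open set. $B_R$ denotes the open ball in $\mathbb{R}^N$ with center $0$ and radius $R$. For a bounded domain $\Omega \subset \mathbb{R}^N$ with $R = \sup_{x \in \Omega}|x|$, define $$C_N(\Omega) = \inf_{u \in W^{1,N}_0(\Omega),\ u \not\equiv 0} \frac{\int_\Omega |\nabla u|^N\,dx}{\int_\Omega \frac{|u(x)|^N}{|x|^N \left( \log \frac{R}{|x|} \right)^N}\,dx}.$$ The infimum is said to be attained if some $u \in W^{1,N}_0(\Omega)$, $u \not\equiv 0$, realizes equality in the quotient. It is not assumed that $0 \in \Omega$. A point $x_0 \in \partial\Omega \cap \partial B_R$ satisfies an interior sphere condition if there is an open ball $B \subset \Omega$ such that $x_0 \in \partial B$. *)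

theory Defs
  imports "HOL-Analysis.Analysis"
begin

definition partial_deriv :: "'a::euclidean_space \<Rightarrow> ('a \<Rightarrow> real) \<Rightarrow> 'a \<Rightarrow> real" where
  "partial_deriv b f x = frechet_derivative f (at x) b"

primrec C_k :: "nat \<Rightarrow> ('a::euclidean_space \<Rightarrow> real) \<Rightarrow> bool" where
  "C_k 0 f \<longleftrightarrow> continuous_on UNIV f"
| "C_k (Suc k) f \<longleftrightarrow>
     (\<forall>x. f differentiable (at x)) \<and> (\<forall>b\<in>Basis. C_k k (partial_deriv b f))"

definition smooth :: "('a::euclidean_space \<Rightarrow> real) \<Rightarrow> bool" where
  "smooth f \<longleftrightarrow> (\<forall>k. C_k k f)"

text \<open>The space of smooth functions with compact support in \<open>\<Omega>\<close>; its elements are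
  functions on the whole space that vanish outside \<open>\<Omega>\<close>.\<close>

definition test_functions :: "'a::euclidean_space set \<Rightarrow> ('a \<Rightarrow> real) set" where
  "test_functions \<Omega> =
     {\<phi>. smooth \<phi> \<and> compact (closure {x. \<phi> x \<noteq> 0}) \<and> closure {x. \<phi> x \<noteq> 0} \<subseteq> \<Omega>}"

text \<open>Lebesgue and Sobolev spaces consist of functions rather than of classes modulo equality
  almost everywhere; values outside \<open>\<Omega>\<close> are irrelevant.\<close>

definition Lp :: "nat \<Rightarrow> 'a::euclidean_space set \<Rightarrow> ('a \<Rightarrow> 'b::euclidean_space) set" where
  "Lp p \<Omega> = {f. f \<in> borel_measurable (lebesgue_on \<Omega>) \<and>
                 integrable (lebesgue_on \<Omega>) (\<lambda>x. norm (f x) ^ p)}"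

definition locally_integrable ::
    "'a::euclidean_space set \<Rightarrow> ('a \<Rightarrow> 'b::euclidean_space) \<Rightarrow> bool" where
  "locally_integrable \<Omega> f \<longleftrightarrow>
     (\<forall>K. compact K \<and> K \<subseteq> \<Omega> \<longrightarrow> f absolutely_integrable_on K)"

definition has_weak_gradient ::
    "'a::euclidean_space set \<Rightarrow> ('a \<Rightarrow> real) \<Rightarrow> ('a \<Rightarrow> 'a) \<Rightarrow> bool" where
  "has_weak_gradient \<Omega> u g \<longleftrightarrow>
     locally_integrable \<Omega> u \<and> locally_integrable \<Omega> g \<and>
     (\<forall>\<phi>\<in>test_functions \<Omega>. \<forall>b\<in>Basis.
        (LINT x|lebesgue_on \<Omega>. u x * partial_deriv b \<phi> x) =
        - (LINT x|lebesgue_on \<Omega>. (g x \<bullet> b) * \<phi> x))"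

text \<open>For open \<open>\<Omega>\<close>, a weak gradient is unique up to a null set, so the choice below does not
  affect any integral over \<open>\<Omega>\<close>.\<close>

definition weak_gradient ::
    "'a::euclidean_space set \<Rightarrow> ('a \<Rightarrow> real) \<Rightarrow> 'a \<Rightarrow> 'a" where
  "weak_gradient \<Omega> u = (SOME g. has_weak_gradient \<Omega> u g)"

definition W1 :: "nat \<Rightarrow> 'a::euclidean_space set \<Rightarrow> ('a \<Rightarrow> real) set" where
  "W1 p \<Omega> = {u. u \<in> Lp p \<Omega> \<and> (\<exists>g. has_weak_gradient \<Omega> u g \<and> g \<in> Lp p \<Omega>)}"

definition W1_norm :: "nat \<Rightarrow> 'a::euclidean_space set \<Rightarrow> ('a \<Rightarrow> real) \<Rightarrow> real" where
  "W1_norm p \<Omega> u =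
     root p ((LINT x|lebesgue_on \<Omega>. \<bar>u x\<bar> ^ p) +
             (LINT x|lebesgue_on \<Omega>. norm (weak_gradient \<Omega> u x) ^ p))"

text \<open>The closure of the test functions in the Sobolev norm.\<close>

definition W1_0 :: "nat \<Rightarrow> 'a::euclidean_space set \<Rightarrow> ('a \<Rightarrow> real) set" where
  "W1_0 p \<Omega> = {u \<in> W1 p \<Omega>. \<exists>\<phi>. (\<forall>n::nat. \<phi> n \<in> test_functions \<Omega>) \<and>
                  (\<lambda>n. W1_norm p \<Omega> (\<lambda>x. u x - \<phi> n x)) \<longlonglongrightarrow> 0}"

definition W1_0_nonzero :: "nat \<Rightarrow> 'a::euclidean_space set \<Rightarrow> ('a \<Rightarrow> real) set" where
  "W1_0_nonzero p \<Omega> = {u \<in> W1_0 p \<Omega>. \<not> (AE x in lebesgue_on \<Omega>. u x = 0)}"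

definition outer_radius :: "'a::euclidean_space set \<Rightarrow> real" where
  "outer_radius \<Omega> = (SUP x\<in>\<Omega>. norm x)"

text \<open>For bounded open \<open>\<Omega>\<close> every point satisfies \<open>norm x < outer_radius \<Omega>\<close>, so
  the weight is positive except at the origin, where the division convention yields the value
  \<open>0\<close>. The integrals are taken in the extended nonnegative reals, so that a divergent integral
  is infinite.\<close>

definition hardy_quotient :: "'a::euclidean_space set \<Rightarrow> ('a \<Rightarrow> real) \<Rightarrow> ennreal" where
  "hardy_quotient \<Omega> u =
     (\<integral>\<^sup>+x. ennreal (norm (weak_gradient \<Omega> u x) ^ DIM('a)) \<partial>lebesgue_on \<Omega>) /
     (\<integral>\<^sup>+x. ennreal (\<bar>u x\<bar> ^ DIM('a) /
              (norm x ^ DIM('a) * ln (outer_radius \<Omega> / norm x) ^ DIM('a))) \<partial>lebesgue_on \<Omega>)"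

definition hardy_const :: "'a::euclidean_space set \<Rightarrow> ennreal" where
  "hardy_const \<Omega> = (INF u\<in>W1_0_nonzero DIM('a) \<Omega>. hardy_quotient \<Omega> u)"

definition hardy_attained :: "'a::euclidean_space set \<Rightarrow> bool" where
  "hardy_attained \<Omega> \<longleftrightarrow>
     (\<exists>u\<in>W1_0_nonzero DIM('a) \<Omega>. hardy_quotient \<Omega> u = hardy_const \<Omega>)"

definition interior_sphere_condition :: "'a::euclidean_space set \<Rightarrow> 'a \<Rightarrow> bool" where
  "interior_sphere_condition \<Omega> x0 \<longleftrightarrow>
     (\<exists>c r. r > 0 \<and> ball c r \<subseteq> \<Omega> \<and> x0 \<in> frontier (ball c r))"

end

theory Submission
  imports Defs "HOL-Real_Asymp.Real_Asymp"
begin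

text \<open>Notation: \<open>N\<close> is the dimension, \<open>a = (N-1)/N\<close> (this is \<open>hardy_ratio N\<close>),
\<open>t = ln (R/|x|)\<close>, and \<open>w = |x|^-N t^-N\<close> is the weight in the denominator.

\<^emph>\<open>Lower bound.\<close> For a function \<open>y \<ge> 0\<close> of \<open>t\<close> that vanishes for large \<open>t\<close>, the
field \<open>F = x |x|^-N y(t)^(N-1)\<close> has divergence \<open>-|x|^-N (y^(N-1))'(t)\<close>. Testing it against
\<open>|\<phi>|^N\<close> and applying Young's inequality to \<open>N |\<phi>|^(N-1) |grad \<phi>| |F|\<close> gives
(\<open>riccati_hardy_test\<close>)

  \<open>(N-1) \<integral> |x|^-N (y^(N-2) (-y') - y^N) |\<phi>|^N \<le> \<integral> |grad \<phi>|^N\<close>.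

With \<open>y = (a/t) z\<close> and \<open>z\<close> constant, the bracket is \<open>a^(N-1) t^-N (z^(N-1) - a z^N)\<close>, which is
largest at \<open>z = 1\<close>; this is Hardy's inequality with the constant \<open>a^N\<close>.

\<^emph>\<open>Non-attainment.\<close> The maximum at \<open>z = 1\<close> is a stationary point, so moving to
\<open>z = 1 + \<epsilon>/(1+t)\<close> costs only \<open>O(\<epsilon>\<^sup>2)\<close>, whereas the derivative of \<open>z\<close> contributes the
positive term \<open>\<epsilon> t/(1+t)\<^sup>2\<close> of first order. For fixed \<open>\<epsilon>\<close> the resulting inequality
survives the passage from test functions to their closure by Fatou's lemma
(\<open>hardy_gain_W1_0\<close>). Equality in Hardy's inequality for \<open>u\<close> then forces
\<open>\<epsilon> \<integral> t/(1+t)\<^sup>2 w |u|^N \<le> C \<epsilon>\<^sup>2 \<integral> w |u|^N\<close> (up to a constant factor) for all small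
\<open>\<epsilon>\<close>; dividing by \<open>\<epsilon>\<close> and letting \<open>\<epsilon> \<rightarrow> 0\<close> yields \<open>u = 0\<close> (\<open>hardy_inequality_strict\<close>).

\<^emph>\<open>Upper bound.\<close> The \<open>N\<close>-energy is invariant under scaling in dimension \<open>N\<close>. Blowing up at
\<open>x0\<close> turns the interior ball into a half-space \<open>s > 0\<close> and \<open>w\<close> into \<open>s^-N\<close>, where \<open>s\<close> is
the distance to the boundary. Hence a Hardy inequality on \<open>\<Omega>\<close> with constant \<open>C\<close> is inherited by
the half-space (\<open>half_space_hardy_transfer\<close>). There \<open>C > a^N\<close> is refuted by the functions
\<open>\<psi>(y) s^a exp(-\<beta>/s)\<close> with a fixed bump \<open>\<psi>\<close>: as \<open>\<beta> \<rightarrow> 0\<close>, their energy exceeds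
\<open>a^N\<close> times the weighted integral by at most a bounded amount and a small multiple of that integral,
and the weighted integral is unbounded (\<open>half_space_hardy_constant\<close>).

Integrals of divergences are computed from translation invariance of Lebesgue measure, and all bump
functions are built from \<open>s powr \<alpha> * exp (-\<beta>/s)\<close>, a family that is closed under
differentiation up to linear combinations.\<close>

section \<open>Smooth functions\<close>

lemma partial_deriv_eq:
  "(f has_derivative f') (at x) \<Longrightarrow> partial_deriv b f x = f' b"
  unfolding partial_deriv_def using frechet_derivative_at by metis

lemma C_k_Suc_imp: "C_k (Suc k) f \<Longrightarrow> C_k k f"
proof (induction k arbitrary: f)
  case 0
  then show ?case
    by (simp add: continuous_on_eq_continuous_at differentiable_imp_continuous_within)
next
  case (Suc k)
  then show ?case by (metis C_k.simps(2))
qed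

text \<open>Reduces membership in \<open>C_k (Suc k)\<close> to the usual derivative calculus: any derivative found by
the rules for \<open>has_derivative\<close> may be used to check the next order.\<close>

lemma C_k_SucI:
  assumes "\<And>x. (f has_derivative f' x) (at x)" and "\<And>b. b \<in> Basis \<Longrightarrow> C_k k (\<lambda>x. f' x b)"
  shows "C_k (Suc k) f"
proof -
  have "partial_deriv b f = (\<lambda>x. f' x b)" for b
    using partial_deriv_eq[OF assms(1)] by auto
  then show ?thesis
    using assms by (auto intro: differentiableI)
qed

lemma C_k_SucD:
  assumes "C_k (Suc k) f"
  shows "(f has_derivative frechet_derivative f (at x)) (at x)"
    and "b \<in> Basis \<Longrightarrow> C_k k (\<lambda>x. frechet_derivative f (at x) b)"
  using assms by (auto simp: frechet_derivative_works partial_deriv_def[abs_def])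

lemma C_k_const: "C_k k (\<lambda>x::'a::euclidean_space. c)"
proof (induction k arbitrary: c)
  case (Suc k)
  show ?case by (rule C_k_SucI[OF has_derivative_const]) (rule Suc)
qed simp

lemma C_k_add: "C_k k f \<Longrightarrow> C_k k g \<Longrightarrow> C_k k (\<lambda>x::'a::euclidean_space. f x + g x)"
proof (induction k arbitrary: f g)
  case (Suc k)
  show ?case
    by (rule C_k_SucI[OF has_derivative_add[OF C_k_SucD(1) C_k_SucD(1), OF Suc.prems]])
       (intro Suc.IH C_k_SucD(2)[OF Suc.prems(1)] C_k_SucD(2)[OF Suc.prems(2)])
qed (auto intro: continuous_intros)

lemma C_k_mult: "C_k k f \<Longrightarrow> C_k k g \<Longrightarrow> C_k k (\<lambda>x::'a::euclidean_space. f x * g x)"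
proof (induction k arbitrary: f g)
  case (Suc k)
  show ?case
    by (rule C_k_SucI[OF has_derivative_mult[OF C_k_SucD(1) C_k_SucD(1), OF Suc.prems]])
       (intro C_k_add Suc.IH C_k_SucD(2)[OF Suc.prems(1)] C_k_SucD(2)[OF Suc.prems(2)]
         C_k_Suc_imp[OF Suc.prems(1)] C_k_Suc_imp[OF Suc.prems(2)])
qed (auto intro: continuous_intros)

lemma C_k_compose:
  fixes h :: "real \<Rightarrow> real" and f :: "'a::euclidean_space \<Rightarrow> real"
  shows "C_k k h \<Longrightarrow> C_k k f \<Longrightarrow> C_k k (\<lambda>x. h (f x))"
proof (induction k arbitrary: h)
  case (Suc k)
  let ?h' = "\<lambda>s. frechet_derivative h (at s) 1"
  have "frechet_derivative h (at s) d = d * ?h' s" for s d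
    using linear_scale[OF has_derivative_linear[OF C_k_SucD(1)[OF Suc.prems(1)]], of s d 1] by simp
  then have "(h has_derivative (\<lambda>d. d * ?h' s)) (at s)" for s
    by (intro has_derivative_eq_rhs[OF C_k_SucD(1)[OF Suc.prems(1)]] ext)
  from has_derivative_compose[OF C_k_SucD(1)[OF Suc.prems(2)] this]
  show ?case
  proof (rule C_k_SucI)
    fix b :: 'a assume b: "b \<in> Basis"
    show "C_k k (\<lambda>x. frechet_derivative f (at x) b * ?h' (f x))"
      by (rule C_k_mult[OF C_k_SucD(2)[OF Suc.prems(2) b]
            Suc.IH[OF C_k_SucD(2)[OF Suc.prems(1)] C_k_Suc_imp[OF Suc.prems(2)]]]) simp
  qed
qed (auto intro: continuous_on_compose2)

lemma C_k_affine: "C_k k f \<Longrightarrow> C_k k (\<lambda>x::'a::euclidean_space. f (c *\<^sub>R x + p))"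
proof (induction k arbitrary: f)
  case (Suc k)
  have "((\<lambda>x. c *\<^sub>R x + p) has_derivative (\<lambda>v. c *\<^sub>R v)) (at x)" for x :: 'a
    by (auto intro!: derivative_eq_intros)
  from has_derivative_compose[OF this C_k_SucD(1)[OF Suc.prems]]
  have "((\<lambda>x. f (c *\<^sub>R x + p)) has_derivative
      (\<lambda>v. c * frechet_derivative f (at (c *\<^sub>R x + p)) v)) (at x)" for x
    using linear_scale[OF has_derivative_linear[OF C_k_SucD(1)[OF Suc.prems]]] by simp
  then show ?case
    by (rule C_k_SucI) (intro C_k_mult C_k_const Suc.IH C_k_SucD(2)[OF Suc.prems])
next
  case 0
  then show ?case by (auto intro!: continuous_intros elim!: continuous_on_compose2)
qed

lemma C_k_inner: "C_k k (\<lambda>x::'a::euclidean_space. x \<bullet> v)"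
proof (cases k)
  case (Suc j)
  have "((\<lambda>x::'a. x \<bullet> v) has_derivative (\<lambda>h. h \<bullet> v)) (at x)" for x
    by (auto intro!: derivative_eq_intros)
  then show ?thesis
    unfolding Suc by (rule C_k_SucI) (rule C_k_const)
qed (auto intro!: continuous_intros)

lemma C_k_sum: "finite A \<Longrightarrow> (\<And>i. i \<in> A \<Longrightarrow> C_k k (f i)) \<Longrightarrow> C_k k (\<lambda>x::'a::euclidean_space. \<Sum>i\<in>A. f i x)"
  by (induction A rule: finite_induct) (auto intro: C_k_add C_k_const)

lemma C_k_prod: "finite A \<Longrightarrow> (\<And>i. i \<in> A \<Longrightarrow> C_k k (f i)) \<Longrightarrow> C_k k (\<lambda>x::'a::euclidean_space. \<Prod>i\<in>A. f i x)"
  by (induction A rule: finite_induct) (auto intro: C_k_mult C_k_const)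

lemma C_k_norm_square: "C_k k (\<lambda>x::'a::euclidean_space. (norm x)\<^sup>2)"
proof -
  have "(\<lambda>x::'a. (norm x)\<^sup>2) = (\<lambda>x. \<Sum>b\<in>Basis. (x \<bullet> b) * (x \<bullet> b))"
    by (rule ext) (metis power2_norm_eq_inner euclidean_inner)
  then show ?thesis by (simp add: C_k_sum C_k_mult C_k_inner)
qed

text \<open>The exponent \<open>\<alpha>\<close> makes the family stable under differentiation, which gives smoothness
at \<open>0\<close> by induction. Exponent \<open>0\<close> supplies cutoffs, exponent \<open>a\<close> the nearly optimal
functions for Hardy's inequality.\<close>

definition flat :: "real \<Rightarrow> real \<Rightarrow> real \<Rightarrow> real" where
  "flat \<alpha> \<beta> s = (if s > 0 then s powr \<alpha> * exp (- (\<beta> / s)) else 0)"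

lemma flat_nonneg: "0 \<le> flat \<alpha> \<beta> s"
  by (simp add: flat_def)

lemma flat_nonpos: "s \<le> 0 \<Longrightarrow> flat \<alpha> \<beta> s = 0"
  by (simp add: flat_def)

lemma flat_tendsto_0:
  assumes "\<beta> > 0" shows "((\<lambda>s. s powr \<alpha> * exp (- (\<beta> / s))) \<longlongrightarrow> (0::real)) (at_right 0)"
  using assms by real_asymp

lemma has_derivative_flat:
  assumes "\<beta> > 0"
  shows "(flat \<alpha> \<beta> has_real_derivative \<alpha> * flat (\<alpha> - 1) \<beta> s + \<beta> * flat (\<alpha> - 2) \<beta> s) (at s)"
proof -
  consider "s > 0" | "s < 0" | "s = 0" by linarith
  then show ?thesis
  proof cases
    case 1
    have "((\<lambda>s. s powr \<alpha> * exp (- (\<beta> / s))) has_real_derivative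
        s powr \<alpha> * (exp (- (\<beta> / s)) * (\<beta> / s\<^sup>2)) + \<alpha> * s powr (\<alpha> - 1) * exp (- (\<beta> / s))) (at s)"
      using 1 by (auto intro!: derivative_eq_intros simp: power2_eq_square)
    also have "s powr \<alpha> * (exp (- (\<beta> / s)) * (\<beta> / s\<^sup>2)) + \<alpha> * s powr (\<alpha> - 1) * exp (- (\<beta> / s))
        = \<alpha> * flat (\<alpha> - 1) \<beta> s + \<beta> * flat (\<alpha> - 2) \<beta> s"
    proof -
      have "s powr (\<alpha> - 2) = s powr \<alpha> / s\<^sup>2"
        using 1 by (simp add: powr_diff)
      then show ?thesis using 1 by (simp add: flat_def)
    qed
    finally have "((\<lambda>s. s powr \<alpha> * exp (- (\<beta> / s))) has_real_derivative
        \<alpha> * flat (\<alpha> - 1) \<beta> s + \<beta> * flat (\<alpha> - 2) \<beta> s) (at s)" .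
    moreover have "\<forall>\<^sub>F s in nhds s. s powr \<alpha> * exp (- (\<beta> / s)) = flat \<alpha> \<beta> s"
      using 1 by (intro eventually_mono[OF eventually_nhds_in_open[of "{0<..}" s]]) (auto simp: flat_def)
    ultimately show ?thesis by (rule DERIV_cong_ev[OF refl _ refl, THEN iffD1, rotated])
  next
    case 2
    have "\<forall>\<^sub>F s in nhds s. 0 = flat \<alpha> \<beta> s"
      using 2 by (intro eventually_mono[OF eventually_nhds_in_open[of "{..<0}" s]]) (auto simp: flat_nonpos)
    moreover have "((\<lambda>s. 0) has_real_derivative \<alpha> * flat (\<alpha> - 1) \<beta> s + \<beta> * flat (\<alpha> - 2) \<beta> s) (at s)"
      using 2 by (simp add: flat_nonpos)
    ultimately show ?thesis by (rule DERIV_cong_ev[OF refl _ refl, THEN iffD1])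
  next
    case 3
    have "((\<lambda>h. flat \<alpha> \<beta> h / h) \<longlongrightarrow> 0) (at 0)"
    proof (rule filterlim_split_at)
      show "((\<lambda>h. flat \<alpha> \<beta> h / h) \<longlongrightarrow> 0) (at_left 0)"
        by (rule tendsto_eventually) (simp add: eventually_at_filter flat_nonpos)
      show "((\<lambda>h. flat \<alpha> \<beta> h / h) \<longlongrightarrow> 0) (at_right 0)"
      proof (rule Lim_transform_eventually[OF flat_tendsto_0[OF assms, of "\<alpha> - 1"]])
        show "\<forall>\<^sub>F s in at_right 0. s powr (\<alpha> - 1) * exp (- (\<beta> / s)) = flat \<alpha> \<beta> s / s"
          using eventually_at_right_less[of 0] by eventually_elim (simp add: flat_def powr_diff)
      qed
    qed
    then show ?thesis unfolding 3 DERIV_def by (simp add: flat_nonpos)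
  qed
qed

lemma C_k_flat:
  assumes "\<beta> > 0" shows "C_k k (flat \<alpha> \<beta>)"
proof (induction k arbitrary: \<alpha>)
  case 0
  show ?case
    unfolding C_k.simps
    by (intro continuous_at_imp_continuous_on ballI DERIV_isCont[OF has_derivative_flat[OF assms]])
next
  case (Suc k)
  have "(flat \<alpha> \<beta> has_derivative
      (\<lambda>v. v * (\<alpha> * flat (\<alpha> - 1) \<beta> s + \<beta> * flat (\<alpha> - 2) \<beta> s))) (at s)" for s
    by (rule has_derivative_eq_rhs[OF has_derivative_flat[OF assms, unfolded has_field_derivative_def]])
       (simp add: fun_eq_iff)
  then show ?case
    by (rule C_k_SucI) (intro C_k_mult C_k_add C_k_const Suc.IH)
qed

section \<open>Integrals of derivatives of compactly supported functions\<close>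

definition grad :: "('a::euclidean_space \<Rightarrow> real) \<Rightarrow> 'a \<Rightarrow> 'a" where
  "grad f x = (\<Sum>b\<in>Basis. partial_deriv b f x *\<^sub>R b)"

lemma grad_inner_Basis: "b \<in> Basis \<Longrightarrow> grad f x \<bullet> b = partial_deriv b f x"
  by (simp add: grad_def inner_sum_left_Basis)

lemma has_derivative_grad:
  assumes "(f has_derivative f') (at x)"
  shows "f' v = grad f x \<bullet> v" "(f has_derivative (\<lambda>v. grad f x \<bullet> v)) (at x)"
proof -
  have "f' v = grad f x \<bullet> v" for v
  proof -
    have "f' v = f' (\<Sum>b\<in>Basis. (v \<bullet> b) *\<^sub>R b)"
      by (simp add: euclidean_representation)
    also have "\<dots> = (\<Sum>b\<in>Basis. (v \<bullet> b) * f' b)"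
      using has_derivative_linear[OF assms] by (simp add: linear_sum linear_scale)
    also have "\<dots> = grad f x \<bullet> v"
      using partial_deriv_eq[OF assms]
      by (simp add: grad_def inner_sum_left inner_commute[of v] mult.commute)
    finally show ?thesis .
  qed
  then show "f' v = grad f x \<bullet> v" "(f has_derivative (\<lambda>v. grad f x \<bullet> v)) (at x)"
    using assms by (auto intro: has_derivative_eq_rhs)
qed

lemma C_k_grad:
  assumes "C_k (Suc k) f"
  shows "(f has_derivative (\<lambda>v. grad f x \<bullet> v)) (at x)"
    and "C_k k (\<lambda>x. grad f x \<bullet> v)"
proof -
  show "(f has_derivative (\<lambda>v. grad f x \<bullet> v)) (at x)" for x
    using has_derivative_grad(2)[OF C_k_SucD(1)[OF assms]] .
  have "grad f x \<bullet> v = (\<Sum>b\<in>Basis. partial_deriv b f x * (b \<bullet> v))" for x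
    by (simp add: grad_def inner_sum_left)
  then show "C_k k (\<lambda>x. grad f x \<bullet> v)"
    using assms by (auto intro!: C_k_sum C_k_mult C_k_const)
qed

lemma continuous_grad:
  assumes "C_k (Suc 0) f"
  shows "continuous_on A (grad f)"
proof -
  have "continuous_on UNIV (\<lambda>x. grad f x \<bullet> b)" for b
    using C_k_grad(2)[OF assms] by simp
  then have "continuous_on UNIV (grad f)"
    by (subst continuous_on_componentwise) auto
  then show ?thesis by (rule continuous_on_subset) auto
qed

lemma integrable_compact_support:
  fixes f :: "'a::euclidean_space \<Rightarrow> real"
  assumes "continuous_on UNIV f" "\<And>x. B < norm x \<Longrightarrow> f x = 0"
  shows "integrable lborel f"
proof -
  have "integrable lborel (\<lambda>x. indicator (cball 0 B) x *\<^sub>R f x)"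
    by (intro borel_integrable_compact continuous_on_subset[OF assms(1)]) auto
  moreover have "(\<lambda>x. indicator (cball 0 B) x *\<^sub>R f x) = f"
    by (rule ext) (use assms(2) in \<open>auto simp: indicator_def\<close>)
  ultimately show ?thesis by simp
qed

lemma has_derivative_zero_outside:
  fixes h :: "'a::euclidean_space \<Rightarrow> real"
  assumes "(h has_derivative h') (at x)" "\<And>x. x \<in> S \<Longrightarrow> h x = 0" "open S" "x \<in> S"
  shows "h' v = 0"
proof -
  have "((\<lambda>x. 0) has_derivative h') (at x)"
    by (rule has_derivative_transform_within_open[OF assms(1,3,4)]) (simp add: assms(2))
  then have "h' = (\<lambda>v. 0)"
    using has_derivative_unique has_derivative_const by blast
  then show ?thesis by simp
qed

lemma open_norm_greater: "open {x::'a::euclidean_space. B < norm x}"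
  by (intro open_Collect_less continuous_intros)

lemma integral_lborel_translation:
  fixes f :: "'a::euclidean_space \<Rightarrow> real"
  assumes [measurable]: "f \<in> borel_measurable borel"
  shows "integral\<^sup>L lborel (\<lambda>x. f (v + x)) = integral\<^sup>L lborel f"
proof -
  have "integral\<^sup>L (distr lborel borel ((+) v)) f = integral\<^sup>L lborel (\<lambda>x. f (v + x))"
    by (rule integral_distr) auto
  then show ?thesis by (simp add: lborel_distr_plus)
qed

lemma integrable_lborel_translation:
  fixes f :: "'a::euclidean_space \<Rightarrow> real"
  assumes "integrable lborel f"
  shows "integrable lborel (\<lambda>x. f (v + x))"
proof -
  have "integrable (distr lborel borel ((+) v)) f"
    using assms by (simp add: lborel_distr_plus)
  then show ?thesis by (rule integrable_distr[rotated]) simp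
qed

text \<open>The integral of a difference quotient of \<open>h\<close> in direction \<open>v\<close> is zero by translation
invariance. The quotients are bounded by the mean value theorem and supported in a fixed ball, so
dominated convergence gives the claim.\<close>

lemma integral_derivative_compact_support:
  fixes h :: "'a::euclidean_space \<Rightarrow> real"
  assumes der: "\<And>x. (h has_derivative h' x) (at x)"
    and cont: "continuous_on UNIV (\<lambda>x. h' x v)"
    and supp: "\<And>x. B < norm x \<Longrightarrow> h x = 0"
  shows "integrable lborel (\<lambda>x. h' x v)" "integral\<^sup>L lborel (\<lambda>x. h' x v) = 0"
proof -
  have supp': "h' x v = 0" if "B < norm x" for x
    using has_derivative_zero_outside[OF der _ open_norm_greater[of B]] supp that by blast
  show "integrable lborel (\<lambda>x. h' x v)"
    by (rule integrable_compact_support[OF cont supp'])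
  have cont_h: "continuous_on UNIV h"
    using der by (meson continuous_at_imp_continuous_on has_derivative_continuous)
  have int_h: "integrable lborel h"
    by (rule integrable_compact_support[OF cont_h supp])
  obtain M where M: "\<And>x. \<bar>h' x v\<bar> \<le> M" "0 \<le> M"
  proof -
    have "compact ((\<lambda>x. h' x v) ` cball 0 B)"
      by (intro compact_continuous_image continuous_on_subset[OF cont]) auto
    then have "bounded ((\<lambda>x. h' x v) ` cball 0 B)" by (rule compact_imp_bounded)
    then obtain M where M: "\<forall>y\<in>(\<lambda>x. h' x v) ` cball 0 B. \<bar>y\<bar> \<le> M"
      unfolding bounded_real by blast
    have "\<bar>h' x v\<bar> \<le> max M 0" for x
    proof (cases "norm x \<le> B")
      case True
      then have "\<bar>h' x v\<bar> \<le> M" using M by simp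
      then show ?thesis by simp
    qed (simp add: supp')
    then show ?thesis using that[of "max M 0"] by simp
  qed
  define \<tau> where "\<tau> = (\<lambda>k. inverse (real (Suc k)))"
  have \<tau>: "0 < \<tau> k" "\<tau> k \<le> 1" for k
    by (auto simp: \<tau>_def field_simps)
  have line: "((\<lambda>s. h (s *\<^sub>R v + x)) has_real_derivative h' (s *\<^sub>R v + x) v) (at s)" for s x
  proof -
    have "((\<lambda>s. s *\<^sub>R v + x) has_derivative (\<lambda>d. d *\<^sub>R v)) (at s)"
      by (auto intro!: derivative_eq_intros)
    from has_derivative_compose[OF this der]
    show ?thesis
      using linear_scale[OF has_derivative_linear[OF der]] by (simp add: has_field_derivative_def mult_commute_abs)
  qed
  define q where "q = (\<lambda>k x. (h (\<tau> k *\<^sub>R v + x) - h x) / \<tau> k)"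
  have "(\<lambda>k. integral\<^sup>L lborel (q k)) \<longlonglongrightarrow> integral\<^sup>L lborel (\<lambda>x. h' x v)"
  proof (rule integral_dominated_convergence)
    show "integrable lborel (\<lambda>x. indicator (cball 0 (B + norm v)) x *\<^sub>R M)"
      by (intro borel_integrable_compact) auto
    show "AE x in lborel. (\<lambda>k. q k x) \<longlonglongrightarrow> h' x v"
    proof (rule AE_I2)
      fix x
      have "((\<lambda>s. (h (s *\<^sub>R v + x) - h x) / s) \<longlongrightarrow> h' x v) (at 0)"
        using line[of x 0] by (simp add: DERIV_def)
      moreover have "filterlim \<tau> (at 0) sequentially"
        unfolding \<tau>_def by (intro filterlim_atI LIMSEQ_inverse_real_of_nat) auto
      ultimately show "(\<lambda>k. q k x) \<longlonglongrightarrow> h' x v"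
        unfolding q_def by (rule filterlim_compose)
    qed
    show "AE x in lborel. norm (q k x) \<le> indicator (cball 0 (B + norm v)) x *\<^sub>R M" for k
    proof (rule AE_I2)
      fix x
      \<comment> \<open>The steps have length at most \<open>norm v\<close>, so outside the enlarged ball both values of \<open>h\<close> vanish.\<close>
      show "norm (q k x) \<le> indicator (cball 0 (B + norm v)) x *\<^sub>R M"
      proof (cases "norm x \<le> B + norm v")
        case True
        obtain z where "h (\<tau> k *\<^sub>R v + x) - h (0 *\<^sub>R v + x) = (\<tau> k - 0) * h' (z *\<^sub>R v + x) v"
          using MVT2[OF \<tau>(1)[of k], of "\<lambda>s. h (s *\<^sub>R v + x)" "\<lambda>s. h' (s *\<^sub>R v + x) v"] line by blast
        then have "q k x = h' (z *\<^sub>R v + x) v"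
          using \<tau>(1)[of k] by (simp add: q_def)
        then show ?thesis using M True by (simp add: indicator_def)
      next
        case False
        have "norm x \<le> norm (\<tau> k *\<^sub>R v + x) + norm (\<tau> k *\<^sub>R v)"
          by (metis add.commute add_diff_cancel_left' norm_triangle_ineq4)
        moreover have "norm (\<tau> k *\<^sub>R v) \<le> norm v"
          using \<tau>[of k] by (simp add: mult_left_le_one_le)
        ultimately have "h (\<tau> k *\<^sub>R v + x) = 0" "h x = 0"
          using False supp norm_ge_zero[of v] by (smt (verit))+
        then show ?thesis using M by (simp add: q_def)
      qed
    qed
    have [measurable]: "h \<in> borel_measurable borel"
      using cont_h by (rule borel_measurable_continuous_onI)
    show "q k \<in> borel_measurable lborel" for k
      unfolding q_def by measurable
    show "(\<lambda>x. h' x v) \<in> borel_measurable lborel"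
      using borel_measurable_continuous_onI[OF cont] by simp
  qed
  moreover have "integral\<^sup>L lborel (q k) = 0" for k
  proof -
    have "integral\<^sup>L lborel (q k)
        = (integral\<^sup>L lborel (\<lambda>x. h (\<tau> k *\<^sub>R v + x)) - integral\<^sup>L lborel h) / \<tau> k"
      unfolding q_def using integrable_lborel_translation[OF int_h] int_h by simp
    then show ?thesis
      using integral_lborel_translation[of h] borel_measurable_continuous_onI[OF cont_h] by simp
  qed
  ultimately show "integral\<^sup>L lborel (\<lambda>x. h' x v) = 0"
    by (simp add: LIMSEQ_const_iff)
qed

text \<open>The integrand is the divergence of the field \<open>h(x) x\<close>.\<close>

lemma integral_divergence_radial_field:
  fixes h :: "'a::euclidean_space \<Rightarrow> real"
  assumes der: "\<And>x. (h has_derivative h' x) (at x)"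
    and cont: "\<And>v. continuous_on UNIV (\<lambda>x. h' x v)"
    and supp: "\<And>x. B < norm x \<Longrightarrow> h x = 0"
  shows "integrable lborel (\<lambda>x. DIM('a) * h x + h' x x)"
    and "integral\<^sup>L lborel (\<lambda>x. DIM('a) * h x + h' x x) = 0"
proof -
  have D: "((\<lambda>x. h x * (x \<bullet> b)) has_derivative (\<lambda>v. h x * (v \<bullet> b) + h' x v * (x \<bullet> b))) (at x)" for x b
    by (intro has_derivative_mult der) (auto intro!: derivative_eq_intros)
  have cont_h: "continuous_on UNIV h"
    using der by (meson continuous_at_imp_continuous_on has_derivative_continuous)
  have C: "continuous_on UNIV (\<lambda>x. h x * (v \<bullet> b) + h' x v * (x \<bullet> b))" for v b
    by (intro continuous_intros cont cont_h)
  have S: "B < norm x \<Longrightarrow> h x * (x \<bullet> b) = 0" for x b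
    by (simp add: supp)
  note I = integral_derivative_compact_support[OF D C S]
  have eq: "DIM('a) * h x + h' x x = (\<Sum>b\<in>Basis. h x * (b \<bullet> b) + h' x b * (x \<bullet> b))" for x
  proof -
    have "h' x x = h' x (\<Sum>b\<in>Basis. (x \<bullet> b) *\<^sub>R b)"
      by (simp add: euclidean_representation)
    also have "\<dots> = (\<Sum>b\<in>Basis. h' x b * (x \<bullet> b))"
      using has_derivative_linear[OF der] by (simp add: linear_sum linear_scale mult.commute)
    finally show ?thesis by (simp add: sum.distrib inner_same_Basis)
  qed
  show "integrable lborel (\<lambda>x. DIM('a) * h x + h' x x)"
    unfolding eq by (intro Bochner_Integration.integrable_sum I)
  show "integral\<^sup>L lborel (\<lambda>x. DIM('a) * h x + h' x x) = 0"
    unfolding eq by (simp only: Bochner_Integration.integral_sum[OF I(1)] I(2) sum.neutral_const)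
qed

lemma test_functionsD:
  assumes "\<phi> \<in> test_functions \<Omega>"
  shows "C_k k \<phi>" and "continuous_on UNIV \<phi>" and "compact (closure {x. \<phi> x \<noteq> 0})"
    and "closure {x. \<phi> x \<noteq> 0} \<subseteq> \<Omega>"
    and "x \<notin> closure {x. \<phi> x \<noteq> 0} \<Longrightarrow> \<phi> x = 0"
    and "x \<notin> closure {x. \<phi> x \<noteq> 0} \<Longrightarrow> grad \<phi> x = 0"
    and "(\<phi> has_derivative (\<lambda>v. grad \<phi> x \<bullet> v)) (at x)"
    and "continuous_on A (grad \<phi>)"
proof -
  have C: "C_k k \<phi>" for k using assms by (auto simp: test_functions_def smooth_def)
  show "C_k k \<phi>" by (rule C)
  show "continuous_on UNIV \<phi>" using C[of 0] by simp
  show "compact (closure {x. \<phi> x \<noteq> 0})" "closure {x. \<phi> x \<noteq> 0} \<subseteq> \<Omega>"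
    using assms unfolding test_functions_def by simp_all
  show zero: "\<phi> x = 0" if "x \<notin> closure {x. \<phi> x \<noteq> 0}" for x
    using that closure_subset[of "{x. \<phi> x \<noteq> 0}"] by auto
  show "(\<phi> has_derivative (\<lambda>v. grad \<phi> x \<bullet> v)) (at x)"
    by (rule C_k_grad(1)[OF C[of "Suc 0"]])
  show "continuous_on A (grad \<phi>)"
    by (rule continuous_grad[OF C[of "Suc 0"]])
  show "grad \<phi> x = 0" if x: "x \<notin> closure {x. \<phi> x \<noteq> 0}"
  proof -
    have "grad \<phi> x \<bullet> v = 0" for v
      by (rule has_derivative_zero_outside[OF C_k_grad(1)[OF C[of "Suc 0"]], of "- closure {x. \<phi> x \<noteq> 0}"])
         (use zero x open_Compl[OF closed_closure[of "{x. \<phi> x \<noteq> 0}"]] in blast)+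
    from this[of "grad \<phi> x"] show ?thesis by simp
  qed
qed

lemma test_functions_bounded_support:
  assumes "\<phi> \<in> test_functions \<Omega>"
  obtains B where "\<And>x. B < norm x \<Longrightarrow> \<phi> x = 0" "\<And>x. B < norm x \<Longrightarrow> grad \<phi> x = 0"
proof -
  obtain B where B: "\<forall>x\<in>closure {x. \<phi> x \<noteq> 0}. norm x \<le> B"
    using compact_imp_bounded[OF test_functionsD(3)[OF assms]] unfolding bounded_iff by blast
  have "x \<notin> closure {x. \<phi> x \<noteq> 0}" if "B < norm x" for x
    using B that by (meson linorder_not_le)
  then show ?thesis
    using that test_functionsD(5,6)[OF assms] by blast
qed

section \<open>Uniqueness of weak gradients\<close>

lemma integrable_lebesgue_on_iff:
  fixes f :: "'a::euclidean_space \<Rightarrow> 'b::euclidean_space"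
  assumes "open \<Omega>" "f \<in> borel_measurable borel" "\<And>x. x \<notin> \<Omega> \<Longrightarrow> f x = 0"
  shows "integrable (lebesgue_on \<Omega>) f \<longleftrightarrow> integrable lborel f"
    and "integral\<^sup>L (lebesgue_on \<Omega>) f = integral\<^sup>L lborel f"
proof -
  have "(\<lambda>x. indicator \<Omega> x *\<^sub>R f x) = f"
    using assms(3) by (auto simp: indicator_def)
  then show "integrable (lebesgue_on \<Omega>) f \<longleftrightarrow> integrable lborel f"
    and "integral\<^sup>L (lebesgue_on \<Omega>) f = integral\<^sup>L lborel f"
    using assms(1,2)
    by (simp_all add: integrable_restrict_space integral_restrict_space integrable_completion integral_completion)
qed

lemma locally_integrable_continuous:
  fixes f :: "'a::euclidean_space \<Rightarrow> 'b::euclidean_space"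
  assumes "continuous_on UNIV f"
  shows "locally_integrable \<Omega> f"
  unfolding locally_integrable_def set_integrable_def
proof (intro allI impI, elim conjE)
  fix K :: "'a set" assume "compact K"
  then have "integrable lborel (\<lambda>x. indicator K x *\<^sub>R f x)"
    by (intro borel_integrable_compact continuous_on_subset[OF assms]) auto
  then show "integrable lebesgue (\<lambda>x. indicator K x *\<^sub>R f x)"
    using integrable_completion borel_measurable_integrable by blast
qed

lemma integrable_locally_integrable_mult:
  fixes f :: "'a::euclidean_space \<Rightarrow> real"
  assumes "locally_integrable \<Omega> f" "open \<Omega>" "continuous_on UNIV \<psi>" "compact K" "K \<subseteq> \<Omega>"
    and zero: "\<And>x. x \<notin> K \<Longrightarrow> \<psi> x = (0::real)"
  shows "integrable (lebesgue_on \<Omega>) (\<lambda>x. f x * \<psi> x)"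
proof -
  have f: "integrable lebesgue (\<lambda>x. indicator K x *\<^sub>R f x)"
    using assms unfolding locally_integrable_def set_integrable_def by blast
  have "compact (\<psi> ` K)"
    by (intro compact_continuous_image continuous_on_subset[OF assms(3)] assms(4)) auto
  then have "bounded (\<psi> ` K)" by (rule compact_imp_bounded)
  then obtain M where M: "\<forall>y\<in>\<psi> ` K. \<bar>y\<bar> \<le> M"
    unfolding bounded_real by blast
  have [measurable]: "\<psi> \<in> borel_measurable lebesgue"
    using borel_measurable_continuous_onI[OF assms(3)] by (intro measurable_completion) simp
  have "integrable lebesgue (\<lambda>x. indicator K x *\<^sub>R f x * \<psi> x)"
  proof (rule Bochner_Integration.integrable_bound)
    show "integrable lebesgue (\<lambda>x. M * (indicator K x *\<^sub>R f x))"
      by (intro integrable_mult_right f)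
    show "(\<lambda>x. indicator K x *\<^sub>R f x * \<psi> x) \<in> borel_measurable lebesgue"
      using borel_measurable_integrable[OF f] by measurable
    show "AE x in lebesgue. norm (indicator K x *\<^sub>R f x * \<psi> x) \<le> norm (M * (indicator K x *\<^sub>R f x))"
    proof (rule AE_I2)
      fix x
      show "norm (indicator K x *\<^sub>R f x * \<psi> x) \<le> norm (M * (indicator K x *\<^sub>R f x))"
      proof (cases "x \<in> K")
        case True
        then have "\<bar>\<psi> x\<bar> \<le> \<bar>M\<bar>" using M by force
        then show ?thesis using True by (simp add: abs_mult mult_right_mono mult.commute)
      qed simp
    qed
  qed
  moreover have "(\<lambda>x. indicator K x *\<^sub>R f x * \<psi> x) = (\<lambda>x. indicator \<Omega> x *\<^sub>R (f x * \<psi> x))"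
    using zero assms(5) by (auto simp: fun_eq_iff indicator_def)
  ultimately show ?thesis
    using assms(2) by (simp add: integrable_restrict_space)
qed

lemma test_function_integration_by_parts:
  assumes "\<phi> \<in> test_functions \<Omega>" and \<psi>: "C_k (Suc 0) \<psi>"
  shows "integrable lborel (\<lambda>x. \<psi> x * (grad \<phi> x \<bullet> b))" "integrable lborel (\<lambda>x. (grad \<psi> x \<bullet> b) * \<phi> x)"
    and "(\<integral>x. \<psi> x * (grad \<phi> x \<bullet> b) \<partial>lborel) = - (\<integral>x. (grad \<psi> x \<bullet> b) * \<phi> x \<partial>lborel)"
proof -
  obtain B where B: "\<And>x. B < norm x \<Longrightarrow> \<phi> x = 0" "\<And>x. B < norm x \<Longrightarrow> grad \<phi> x = 0"
    using test_functions_bounded_support[OF assms(1)] by blast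
  note \<phi>D = test_functionsD[OF assms(1)]
  have \<psi>c: "continuous_on UNIV \<psi>" using C_k_Suc_imp[OF \<psi>] by simp
  have D: "((\<lambda>x. \<psi> x * \<phi> x) has_derivative (\<lambda>v. \<psi> x * (grad \<phi> x \<bullet> v) + (grad \<psi> x \<bullet> v) * \<phi> x)) (at x)" for x
    by (intro has_derivative_mult C_k_grad(1)[OF \<psi>] \<phi>D(7))
  have c1: "continuous_on UNIV (\<lambda>x. \<psi> x * (grad \<phi> x \<bullet> b))"
    by (intro continuous_intros \<psi>c \<phi>D(8))
  have c2: "continuous_on UNIV (\<lambda>x. (grad \<psi> x \<bullet> b) * \<phi> x)"
    by (intro continuous_intros \<phi>D(2) continuous_grad[OF \<psi>])
  show i1: "integrable lborel (\<lambda>x. \<psi> x * (grad \<phi> x \<bullet> b))"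
    by (rule integrable_compact_support[OF c1, of B]) (simp add: B)
  show i2: "integrable lborel (\<lambda>x. (grad \<psi> x \<bullet> b) * \<phi> x)"
    by (rule integrable_compact_support[OF c2, of B]) (simp add: B)
  have "(\<integral>x. \<psi> x * (grad \<phi> x \<bullet> b) + (grad \<psi> x \<bullet> b) * \<phi> x \<partial>lborel) = 0"
    by (rule integral_derivative_compact_support(2)[OF D, of _ B])
       (auto intro!: continuous_on_add c1 c2 simp: B)
  then show "(\<integral>x. \<psi> x * (grad \<phi> x \<bullet> b) \<partial>lborel) = - (\<integral>x. (grad \<psi> x \<bullet> b) * \<phi> x \<partial>lborel)"
    using i1 i2 by simp
qed

lemma has_weak_gradient_C1:
  assumes "open \<Omega>" and \<psi>: "C_k (Suc 0) \<psi>"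
  shows "has_weak_gradient \<Omega> \<psi> (grad \<psi>)"
  unfolding has_weak_gradient_def
proof (intro conjI ballI)
  have \<psi>c: "continuous_on UNIV \<psi>" using C_k_Suc_imp[OF \<psi>] by simp
  then show "locally_integrable \<Omega> \<psi>" by (rule locally_integrable_continuous)
  show "locally_integrable \<Omega> (grad \<psi>)"
    by (rule locally_integrable_continuous[OF continuous_grad[OF \<psi>]])
  fix \<phi> :: "'a \<Rightarrow> real" and b :: 'a
  assume \<phi>: "\<phi> \<in> test_functions \<Omega>" and b: "b \<in> Basis"
  note \<phi>D = test_functionsD[OF \<phi>]
  have out: "\<phi> x = 0" "grad \<phi> x = 0" if "x \<notin> \<Omega>" for x
    using that \<phi>D(4) \<phi>D(5,6)[of x] by blast+
  have c1: "continuous_on UNIV (\<lambda>x. \<psi> x * (grad \<phi> x \<bullet> b))"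
    by (intro continuous_intros \<psi>c \<phi>D(8))
  have c2: "continuous_on UNIV (\<lambda>x. (grad \<psi> x \<bullet> b) * \<phi> x)"
    by (intro continuous_intros \<phi>D(2) continuous_grad[OF \<psi>])
  have "(LINT x|lebesgue_on \<Omega>. \<psi> x * partial_deriv b \<phi> x) = (\<integral>x. \<psi> x * (grad \<phi> x \<bullet> b) \<partial>lborel)"
    unfolding grad_inner_Basis[OF b, symmetric]
    by (rule integrable_lebesgue_on_iff(2)[OF assms(1) borel_measurable_continuous_onI[OF c1]]) (simp add: out)
  moreover have "(LINT x|lebesgue_on \<Omega>. (grad \<psi> x \<bullet> b) * \<phi> x) = (\<integral>x. (grad \<psi> x \<bullet> b) * \<phi> x \<partial>lborel)"
    by (rule integrable_lebesgue_on_iff(2)[OF assms(1) borel_measurable_continuous_onI[OF c2]]) (simp add: out)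
  ultimately show "(LINT x|lebesgue_on \<Omega>. \<psi> x * partial_deriv b \<phi> x)
      = - (LINT x|lebesgue_on \<Omega>. (grad \<psi> x \<bullet> b) * \<phi> x)"
    using test_function_integration_by_parts(3)[OF \<phi> \<psi>] by simp
qed

text \<open>Test functions that increase to the indicator of a box: each factor tends to \<open>1\<close> where its
argument is positive and vanishes elsewhere.\<close>

definition bump_box :: "nat \<Rightarrow> 'a::euclidean_space \<Rightarrow> 'a \<Rightarrow> 'a \<Rightarrow> real" where
  "bump_box m c d x = (\<Prod>b\<in>Basis. flat 0 (inverse (real (Suc m))) (x \<bullet> b - c \<bullet> b)
                                  * flat 0 (inverse (real (Suc m))) (d \<bullet> b - x \<bullet> b))"

lemma flat_0_le_1: "0 \<le> \<beta> \<Longrightarrow> flat 0 \<beta> s \<le> 1"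
  by (simp add: flat_def)

lemma smooth_flat_affine: "0 < \<beta> \<Longrightarrow> C_k k (\<lambda>x::'a::euclidean_space. flat 0 \<beta> (\<sigma> * (x \<bullet> b) + \<tau>))"
  by (intro C_k_compose[OF C_k_flat] C_k_add C_k_mult C_k_const C_k_inner)

lemma C_k_bump_box: "C_k k (bump_box m c d)"
proof -
  have "bump_box m c d = (\<lambda>x. \<Prod>b\<in>Basis. flat 0 (inverse (real (Suc m))) (1 * (x \<bullet> b) + - (c \<bullet> b))
                                  * flat 0 (inverse (real (Suc m))) (-1 * (x \<bullet> b) + d \<bullet> b))"
    by (simp add: fun_eq_iff bump_box_def algebra_simps)
  moreover have "C_k k \<dots>"
    by (intro C_k_prod finite_Basis C_k_mult smooth_flat_affine) simp_all
  ultimately show ?thesis by simp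
qed

lemma bump_box_zero:
  assumes "x \<notin> box c d"
  shows "bump_box m c d x = 0"
proof -
  obtain b where b: "b \<in> Basis" "x \<bullet> b \<le> c \<bullet> b \<or> d \<bullet> b \<le> x \<bullet> b"
    using assms by (auto simp: mem_box not_less)
  then have "flat 0 (inverse (real (Suc m))) (x \<bullet> b - c \<bullet> b)
      * flat 0 (inverse (real (Suc m))) (d \<bullet> b - x \<bullet> b) = 0"
    by (auto simp: flat_nonpos)
  then show ?thesis
    unfolding bump_box_def using b(1) by (intro prod_zero) auto
qed

lemma bump_box_bounds: "0 \<le> bump_box m c d x" "bump_box m c d x \<le> 1"
  unfolding bump_box_def
  by (auto intro!: prod_nonneg prod_le_1 mult_nonneg_nonneg flat_nonneg mult_le_one flat_0_le_1)

lemma bump_box_tendsto: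
  fixes x :: "'a::euclidean_space"
  shows "(\<lambda>m. bump_box m c d x) \<longlonglongrightarrow> indicator (box c d) x"
proof (cases "x \<in> box c d")
  case True
  have flat: "(\<lambda>m. flat 0 (inverse (real (Suc m))) s) \<longlonglongrightarrow> 1" if "0 < s" for s :: real
  proof -
    have "(\<lambda>m. exp (- (inverse (real (Suc m)) / s))) \<longlonglongrightarrow> exp (- (0 / s))"
      using that by (intro tendsto_intros LIMSEQ_inverse_real_of_nat) simp
    then show ?thesis using that by (simp add: flat_def)
  qed
  have "(\<lambda>m. bump_box m c d x) \<longlonglongrightarrow> (\<Prod>b\<in>(Basis::'a set). 1 * 1)"
    unfolding bump_box_def by (intro tendsto_prod tendsto_mult flat) (use True in \<open>auto simp: mem_box\<close>)
  then show ?thesis using True by simp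
qed (simp add: bump_box_zero)

lemma bump_box_test_function:
  assumes "cbox c d \<subseteq> \<Omega>"
  shows "bump_box m c d \<in> test_functions \<Omega>"
proof -
  have sub: "{x. bump_box m c d x \<noteq> 0} \<subseteq> cbox c d"
    using bump_box_zero[of _ c d m] box_subset_cbox[of c d] by blast
  then have "bounded {x. bump_box m c d x \<noteq> 0}"
    using bounded_cbox bounded_subset by blast
  moreover have "closure {x. bump_box m c d x \<noteq> 0} \<subseteq> \<Omega>"
    using closure_minimal[OF sub closed_cbox] assms by simp
  ultimately show ?thesis
    by (simp add: test_functions_def smooth_def C_k_bump_box)
qed

text \<open>Testing with \<open>bump_box\<close> shows that \<open>f\<close> has integral zero over every open box inside the
given one. The boxes form an intersection-stable generator of the Borel sets, so the same holds for every
Borel set, and a density with this property vanishes almost everywhere.\<close>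

lemma AE_zero_on_box:
  fixes f :: "'a::euclidean_space \<Rightarrow> real"
  assumes "open \<Omega>" "locally_integrable \<Omega> f" "cbox c d \<subseteq> \<Omega>"
    and zero: "\<And>\<phi>. \<phi> \<in> test_functions \<Omega> \<Longrightarrow> (LINT x|lebesgue_on \<Omega>. f x * \<phi> x) = 0"
  shows "AE x in lborel. x \<in> box c d \<longrightarrow> f x = 0"
proof -
  \<comment> \<open>Localizing to the closed box makes \<open>f\<close> globally integrable; passing to a Borel
    version \<open>f'\<close> allows the induction to run over Borel sets only.\<close>
  define f1 where "f1 = (\<lambda>x. indicator (cbox c d) x *\<^sub>R f x)"
  have f1: "integrable lebesgue f1"
    using assms(2,3) compact_cbox unfolding locally_integrable_def set_integrable_def f1_def by blast
  obtain f' where f'[measurable]: "f' \<in> borel_measurable lborel" and eq: "AE x in lborel. f1 x = f' x"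
    using completion_ex_borel_measurable_real[OF borel_measurable_integrable[OF f1]] by blast
  have eq': "AE x in lebesgue. f1 x = f' x"
    by (rule AE_completion[OF eq])
  have f'_leb: "f' \<in> borel_measurable lebesgue"
    using f' by (rule measurable_completion)
  have "integrable lebesgue f'"
    using integrable_cong_AE_imp[OF f1 f'_leb] eq' by (simp add: eq_commute)
  then have int': "integrable lborel f'"
    using integrable_completion[OF f'] by simp
  have box: "(LINT x:box a b|lborel. f' x) = 0" if sub: "box a b \<subseteq> box c d" for a b
  proof (cases "box a b = {}")
    case False
    then have cb: "cbox a b \<subseteq> cbox c d"
    proof -
      have "box c d \<noteq> {}" using False sub by auto
      then show ?thesis
        using closure_mono[OF sub] closure_box[OF False] closure_box by metis
    qed
    have "(\<integral>x. f' x * bump_box m a b x \<partial>lborel) = 0" for m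
    proof -
      let ?\<phi> = "bump_box m a b"
      have \<phi>: "?\<phi> \<in> test_functions \<Omega>"
        using cb assms(3) by (intro bump_box_test_function) simp
      have m[measurable]: "?\<phi> \<in> borel_measurable lborel"
        using borel_measurable_continuous_onI[OF test_functionsD(2)[OF \<phi>]] by simp
      have m': "?\<phi> \<in> borel_measurable lebesgue"
        using m by (rule measurable_completion)
      have "0 = (LINT x|lebesgue_on \<Omega>. f x * ?\<phi> x)"
        using zero[OF \<phi>] by simp
      also have "\<dots> = (LINT x|lebesgue. indicator \<Omega> x *\<^sub>R (f x * ?\<phi> x))"
        using assms(1) by (intro integral_restrict_space) simp
      also have "(\<lambda>x. indicator \<Omega> x *\<^sub>R (f x * ?\<phi> x)) = (\<lambda>x. f1 x * ?\<phi> x)"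
      proof
        fix x
        show "indicator \<Omega> x *\<^sub>R (f x * ?\<phi> x) = f1 x * ?\<phi> x"
        proof (cases "x \<in> box a b")
          case True
          then have "x \<in> cbox c d" "x \<in> \<Omega>"
            using cb box_subset_cbox[of a b] assms(3) by blast+
          then show ?thesis by (simp add: f1_def)
        qed (simp add: bump_box_zero)
      qed
      also have "(LINT x|lebesgue. f1 x * ?\<phi> x) = (LINT x|lebesgue. f' x * ?\<phi> x)"
        using eq' by (intro integral_cong_AE borel_measurable_times m' f'_leb borel_measurable_integrable[OF f1]) auto
      also have "\<dots> = (\<integral>x. f' x * ?\<phi> x \<partial>lborel)"
        by (intro integral_completion borel_measurable_times m f')
      finally show ?thesis by simp
    qed
    moreover have "(\<lambda>m. \<integral>x. f' x * bump_box m a b x \<partial>lborel) \<longlonglongrightarrow> (\<integral>x. f' x * indicator (box a b) x \<partial>lborel)"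
    proof (rule integral_dominated_convergence[where w = "\<lambda>x. \<bar>f' x\<bar>"])
      have "bump_box m a b \<in> borel_measurable lborel" for m
        using borel_measurable_continuous_onI[of "bump_box m a b"] C_k_bump_box[of 0 m a b] by simp
      then show "(\<lambda>x. f' x * bump_box m a b x) \<in> borel_measurable lborel" for m
        by (intro borel_measurable_times f')
      show "(\<lambda>x. f' x * indicator (box a b) x) \<in> borel_measurable lborel"
        by measurable
      show "integrable lborel (\<lambda>x. \<bar>f' x\<bar>)"
        using int' by simp
      show "AE x in lborel. (\<lambda>m. f' x * bump_box m a b x) \<longlonglongrightarrow> f' x * indicator (box a b) x"
        by (intro AE_I2 tendsto_mult tendsto_const bump_box_tendsto)
      show "AE x in lborel. norm (f' x * bump_box m a b x) \<le> \<bar>f' x\<bar>" for m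
        using bump_box_bounds[of m a b] by (intro AE_I2) (simp add: abs_mult mult_left_le)
    qed
    ultimately show ?thesis
      by (simp add: LIMSEQ_const_iff set_lebesgue_integral_def mult.commute)
  qed (simp add: set_lebesgue_integral_def)
  define f2 where "f2 = (\<lambda>x. indicator (box c d) x *\<^sub>R f' x)"
  have int2: "integrable lborel f2"
    unfolding f2_def by (rule integrable_mult_indicator[OF _ int']) simp
  have set_int2: "set_integrable lborel A f2" if "A \<in> sets borel" for A
    unfolding set_integrable_def by (rule integrable_mult_indicator[OF _ int2]) (use that in simp)
  have boxes: "(LINT x:box a b|lborel. f2 x) = 0" for a b
  proof -
    obtain p q where pq: "box a b \<inter> box c d = box p q" using box_Int_box[of a b c d] by blast
    have "(LINT x:box a b|lborel. f2 x) = (LINT x:box p q|lborel. f' x)"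
      unfolding set_lebesgue_integral_def f2_def pq[symmetric]
      by (intro Bochner_Integration.integral_cong) (auto simp: indicator_def)
    moreover have "box p q \<subseteq> box c d" using pq by blast
    ultimately show ?thesis using box by simp
  qed
  have total: "(\<integral>x. f2 x \<partial>lborel) = 0"
  proof -
    have "(\<integral>x. f2 x \<partial>lborel) = (LINT x:box c d|lborel. f2 x)"
      unfolding set_lebesgue_integral_def f2_def
      by (intro Bochner_Integration.integral_cong) (auto simp: indicator_def)
    then show ?thesis using boxes by simp
  qed
  have "(LINT x:A|lborel. f2 x) = 0" if "A \<in> sets lborel" for A
  proof -
    let ?G = "range (\<lambda>(a, b). box a b :: 'a set)"
    have stable: "Int_stable ?G"
    proof (rule Int_stableI)
      fix A B assume "A \<in> ?G" "B \<in> ?G"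
      then obtain a b p q where "A = box a b" "B = box p q" by auto
      then show "A \<inter> B \<in> ?G" using box_Int_box[of a b p q] by auto
    qed
    have Pow: "?G \<subseteq> Pow UNIV" by simp
    have sets: "sigma_sets UNIV ?G = sets borel"
      unfolding borel_eq_box by (simp add: sets_measure_of)
    have "A \<in> sigma_sets UNIV ?G"
      using that sets by simp
    from stable Pow this show ?thesis
    proof (induction rule: sigma_sets_induct_disjoint)
      case (basic A)
      then show ?case using boxes by auto
    next
      case empty
      then show ?case by (simp add: set_lebesgue_integral_def)
    next
      case (compl A)
      have A: "A \<in> sets borel" using compl(1) sets by simp
      have "(LINT x:UNIV - A|lborel. f2 x) = (\<integral>x. f2 x - indicator A x *\<^sub>R f2 x \<partial>lborel)"
        unfolding set_lebesgue_integral_def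
        by (intro Bochner_Integration.integral_cong) (auto simp: indicator_def)
      also have "\<dots> = 0"
        using compl(2) total set_int2[OF A] int2
        by (simp add: set_lebesgue_integral_def set_integrable_def)
      finally show ?case .
    next
      case (union A)
      have A: "A i \<in> sets borel" for i using union(2) sets by auto
      have "(LINT x:(\<Union>i. A i)|lborel. f2 x) = (\<Sum>i. (LINT x:A i|lborel. f2 x))"
        using A union(1)
        by (intro lebesgue_integral_countable_add set_int2) (auto simp: disjoint_family_on_def)
      then show ?case using union(3) by simp
    qed
  qed
  then have "AE x in lborel. f2 x = 0"
    by (intro sigma_finite_measure.density_zero[OF lborel.sigma_finite_measure_axioms int2]) auto
  with eq show ?thesis
    by eventually_elim (use box_subset_cbox[of c d] in \<open>auto simp: f2_def f1_def indicator_def split: if_splits\<close>)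
qed

lemma fundamental_lemma_calculus_of_variations:
  fixes f :: "'a::euclidean_space \<Rightarrow> real"
  assumes "open \<Omega>" "locally_integrable \<Omega> f"
    and zero: "\<And>\<phi>. \<phi> \<in> test_functions \<Omega> \<Longrightarrow> (LINT x|lebesgue_on \<Omega>. f x * \<phi> x) = 0"
  shows "AE x in lebesgue_on \<Omega>. f x = 0"
proof -
  obtain D where D: "countable D" "D \<subseteq> Pow \<Omega>" "\<And>X. X \<in> D \<Longrightarrow> \<exists>a b. X = cbox a b" "\<Union>D = \<Omega>"
    using open_countable_Union_open_cbox[OF assms(1)] by metis
  have AE_X: "AE x in lebesgue. x \<in> X \<longrightarrow> f x = 0" if X: "X \<in> D" for X
  proof -
    obtain a b where ab: "X = cbox a b" using D(3)[OF X] by blast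
    have "AE x in lebesgue. x \<in> box a b \<longrightarrow> f x = 0"
      using AE_zero_on_box[OF assms(1,2) _ zero, of a b] D(2) X ab by (intro AE_completion) auto
    moreover have "AE x in lebesgue. x \<notin> cbox a b - box a b"
      using negligible_frontier_interval[of a b] unfolding negligible_iff_null_sets by (rule AE_not_in)
    ultimately show ?thesis
      by eventually_elim (auto simp: ab)
  qed
  have "AE x in lebesgue. \<forall>X\<in>D. x \<in> X \<longrightarrow> f x = 0"
    by (intro AE_ball_countable[OF D(1), THEN iffD2] ballI AE_X)
  then have "AE x in lebesgue. x \<in> \<Omega> \<longrightarrow> f x = 0"
    by eventually_elim (use D(4) in blast)
  then show ?thesis
    using assms(1) by (simp add: AE_restrict_space_iff)
qed


lemma locally_integrable_diff:
  assumes "locally_integrable \<Omega> f" "locally_integrable \<Omega> g"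
  shows "locally_integrable \<Omega> (\<lambda>x. f x - g x)"
  using assms unfolding locally_integrable_def by (blast intro: set_integral_diff(1))

lemma locally_integrable_inner:
  assumes "locally_integrable \<Omega> f"
  shows "locally_integrable \<Omega> (\<lambda>x. f x \<bullet> b)"
  using assms unfolding locally_integrable_def
  by (auto intro: absolutely_integrable_component)

lemma weak_gradient_integrable:
  assumes "has_weak_gradient \<Omega> u g" "open \<Omega>" "\<phi> \<in> test_functions \<Omega>" "b \<in> Basis"
  shows "integrable (lebesgue_on \<Omega>) (\<lambda>x. u x * partial_deriv b \<phi> x)"
    and "integrable (lebesgue_on \<Omega>) (\<lambda>x. (g x \<bullet> b) * \<phi> x)"
proof -
  note \<phi>D = test_functionsD[OF assms(3)]
  have "continuous_on UNIV (\<lambda>x. partial_deriv b \<phi> x)"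
    unfolding grad_inner_Basis[OF assms(4), symmetric] by (intro continuous_intros \<phi>D(8))
  moreover have "partial_deriv b \<phi> x = 0" if "x \<notin> closure {x. \<phi> x \<noteq> 0}" for x
    using \<phi>D(6)[OF that] grad_inner_Basis[OF assms(4), of \<phi> x] by simp
  ultimately show "integrable (lebesgue_on \<Omega>) (\<lambda>x. u x * partial_deriv b \<phi> x)"
    using assms(1) unfolding has_weak_gradient_def
    by (intro integrable_locally_integrable_mult[OF _ assms(2) _ \<phi>D(3,4)]) blast+
  have "locally_integrable \<Omega> g"
    using assms(1) unfolding has_weak_gradient_def by blast
  from integrable_locally_integrable_mult[OF locally_integrable_inner[OF this] assms(2) \<phi>D(2-5)]
  show "integrable (lebesgue_on \<Omega>) (\<lambda>x. (g x \<bullet> b) * \<phi> x)" .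
qed

lemma has_weak_gradient_diff:
  assumes "has_weak_gradient \<Omega> u g" "has_weak_gradient \<Omega> v h" "open \<Omega>"
  shows "has_weak_gradient \<Omega> (\<lambda>x. u x - v x) (\<lambda>x. g x - h x)"
  unfolding has_weak_gradient_def
proof (intro conjI ballI)
  show "locally_integrable \<Omega> (\<lambda>x. u x - v x)" "locally_integrable \<Omega> (\<lambda>x. g x - h x)"
    using assms unfolding has_weak_gradient_def by (blast intro: locally_integrable_diff)+
  fix \<phi> :: "'a \<Rightarrow> real" and b :: 'a
  assume \<phi>: "\<phi> \<in> test_functions \<Omega>" and b: "b \<in> Basis"
  note iu = weak_gradient_integrable[OF assms(1,3) \<phi> b] and iv = weak_gradient_integrable[OF assms(2,3) \<phi> b]
  have "(LINT x|lebesgue_on \<Omega>. (u x - v x) * partial_deriv b \<phi> x)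
      = (LINT x|lebesgue_on \<Omega>. u x * partial_deriv b \<phi> x) - (LINT x|lebesgue_on \<Omega>. v x * partial_deriv b \<phi> x)"
    using iu iv by (simp add: left_diff_distrib)
  also have "\<dots> = - ((LINT x|lebesgue_on \<Omega>. (g x \<bullet> b) * \<phi> x) - (LINT x|lebesgue_on \<Omega>. (h x \<bullet> b) * \<phi> x))"
    using assms \<phi> b unfolding has_weak_gradient_def by simp
  also have "\<dots> = - (LINT x|lebesgue_on \<Omega>. ((g x - h x) \<bullet> b) * \<phi> x)"
    using iu iv by (simp add: left_diff_distrib inner_diff_left)
  finally show "(LINT x|lebesgue_on \<Omega>. (u x - v x) * partial_deriv b \<phi> x)
      = - (LINT x|lebesgue_on \<Omega>. ((g x - h x) \<bullet> b) * \<phi> x)" .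
qed

lemma has_weak_gradient_unique:
  assumes "has_weak_gradient \<Omega> u g" "has_weak_gradient \<Omega> u h" "open \<Omega>"
  shows "AE x in lebesgue_on \<Omega>. g x = h x"
proof -
  have D: "has_weak_gradient \<Omega> (\<lambda>x. u x - u x) (\<lambda>x. g x - h x)"
    by (rule has_weak_gradient_diff[OF assms])
  have AE_b: "AE x in lebesgue_on \<Omega>. (g x - h x) \<bullet> b = 0" if b: "b \<in> Basis" for b
  proof (rule fundamental_lemma_calculus_of_variations[OF assms(3)])
    show "locally_integrable \<Omega> (\<lambda>x. (g x - h x) \<bullet> b)"
      by (rule locally_integrable_inner) (use D in \<open>unfold has_weak_gradient_def, blast\<close>)
    show "(LINT x|lebesgue_on \<Omega>. (g x - h x) \<bullet> b * \<phi> x) = 0" if "\<phi> \<in> test_functions \<Omega>" for \<phi>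
      using D that b unfolding has_weak_gradient_def by simp
  qed
  have "AE x in lebesgue_on \<Omega>. \<forall>b\<in>Basis. (g x - h x) \<bullet> b = 0"
    by (intro AE_ball_countable[THEN iffD2] ballI AE_b countable_finite finite_Basis)
  then show ?thesis
    by eventually_elim (rule euclidean_eqI, simp add: inner_diff_left)
qed

lemma weak_gradient_AE:
  assumes "has_weak_gradient \<Omega> u g" "open \<Omega>"
  shows "AE x in lebesgue_on \<Omega>. weak_gradient \<Omega> u x = g x"
  unfolding weak_gradient_def
  by (rule has_weak_gradient_unique[OF someI[of "has_weak_gradient \<Omega> u", OF assms(1)] assms])

lemma borel_measurable_lebesgue_on_AE:
  fixes f g :: "'a::euclidean_space \<Rightarrow> 'b::euclidean_space"
  assumes "f \<in> borel_measurable (lebesgue_on \<Omega>)" "AE x in lebesgue_on \<Omega>. f x = g x" "open \<Omega>"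
  shows "g \<in> borel_measurable (lebesgue_on \<Omega>)"
proof -
  have "(\<lambda>x. indicator \<Omega> x *\<^sub>R f x) \<in> borel_measurable lebesgue"
    using assms(1,3) by (simp add: borel_measurable_restrict_space_iff)
  moreover have "AE x in lebesgue. indicator \<Omega> x *\<^sub>R f x = indicator \<Omega> x *\<^sub>R g x"
  proof -
    have "AE x in lebesgue. x \<in> \<Omega> \<longrightarrow> f x = g x"
      using assms(2,3) by (simp add: AE_restrict_space_iff)
    then show ?thesis by eventually_elim (auto simp: indicator_def)
  qed
  ultimately have "(\<lambda>x. indicator \<Omega> x *\<^sub>R g x) \<in> borel_measurable lebesgue"
    by (rule borel_measurable_AE)
  then show ?thesis
    using assms(3) by (simp add: borel_measurable_restrict_space_iff)
qed

section \<open>A Riccati inequality behind Hardy's inequality\<close>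

text \<open>Young's inequality in the homogeneous form \<open>N p^(N-1) q \<le> (N-1) p^N + q^N\<close>; after division by
\<open>p^N\<close> it is Bernoulli's inequality for \<open>q/p\<close>.\<close>

lemma power_young:
  fixes p q :: real
  assumes "0 \<le> p" "0 \<le> q" "N \<ge> 2"
  shows "real N * p ^ (N - 1) * q \<le> (real N - 1) * p ^ N + q ^ N"
proof (cases "p = 0")
  case True
  then show ?thesis using assms by (simp add: power_0_left)
next
  case False
  with assms have p: "0 < p" by simp
  have "1 + real N * (q / p - 1) \<le> (1 + (q / p - 1)) ^ N"
    by (rule Bernoulli_inequality) (use p assms in simp)
  then have "p ^ N * (1 + real N * (q / p - 1)) \<le> p ^ N * (q / p) ^ N"
    using p by (intro mult_left_mono) auto
  also have "p ^ N * (q / p) ^ N = q ^ N"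
    using p by (simp add: power_divide)
  also have "p ^ N * (1 + real N * (q / p - 1)) = real N * p ^ (N - 1) * q - (real N - 1) * p ^ N"
  proof -
    have pN: "p ^ N = p * p ^ (N - 1)" using assms(3) by (simp add: power_eq_if)
    show ?thesis unfolding pN using p by (simp add: field_simps)
  qed
  finally show ?thesis by simp
qed

lemma has_derivative_abs_power:
  assumes "N \<ge> 2"
  shows "((\<lambda>s::real. \<bar>s\<bar> ^ N) has_real_derivative real N * \<bar>s\<bar> ^ (N - 2) * s) (at s)"
proof -
  have N1: "\<bar>r\<bar> ^ (N - 1) = \<bar>r\<bar> ^ (N - 2) * \<bar>r\<bar>" for r :: real
    using assms by (simp add: power_eq_if numeral_2_eq_2)
  consider "s > 0" | "s < 0" | "s = 0" by linarith
  then show ?thesis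
  proof cases
    case 1
    have D: "((\<lambda>s::real. s ^ N) has_real_derivative real N * \<bar>s\<bar> ^ (N - 2) * s) (at s)"
      using 1 N1[of s] by (auto intro!: derivative_eq_intros)
    show ?thesis
      by (rule has_field_derivative_transform_within_open[OF D, of "{0<..}"]) (use 1 in auto)
  next
    case 2
    have D: "((\<lambda>s::real. (- s) ^ N) has_real_derivative real N * \<bar>s\<bar> ^ (N - 2) * s) (at s)"
      using 2 N1[of s] by (auto intro!: derivative_eq_intros)
    show ?thesis
      by (rule has_field_derivative_transform_within_open[OF D, of "{..<0}"]) (use 2 in auto)
  next
    case 3
    have "((\<lambda>h::real. \<bar>h\<bar> ^ (N - 2) * h) \<longlongrightarrow> \<bar>0\<bar> ^ (N - 2) * 0) (at 0)"
      by (intro tendsto_intros)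
    moreover have "\<bar>h\<bar> ^ N / h = \<bar>h\<bar> ^ (N - 2) * h" if "h \<noteq> 0" for h :: real
    proof -
      have "\<bar>h\<bar> ^ N = \<bar>h\<bar> ^ (N - 2) * \<bar>h\<bar>\<^sup>2"
        using assms by (metis le_add_diff_inverse2 power_add)
      then show ?thesis using that by (simp add: power2_eq_square)
    qed
    ultimately have "((\<lambda>h::real. \<bar>h\<bar> ^ N / h) \<longlongrightarrow> 0) (at 0)"
      by (auto intro: Lim_transform_eventually simp: eventually_at_filter)
    then show ?thesis using 3 assms by (simp add: DERIV_def power_0_left)
  qed
qed

lemma has_derivative_max_square:
  "((\<lambda>s::real. (max 0 s)\<^sup>2) has_real_derivative 2 * max 0 s) (at s)"
proof -
  consider "s > 0" | "s < 0" | "s = 0" by linarith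
  then show ?thesis
  proof cases
    case 1
    have D: "((\<lambda>s::real. s\<^sup>2) has_real_derivative 2 * max 0 s) (at s)"
      using 1 by (auto intro!: derivative_eq_intros)
    show ?thesis
      by (rule has_field_derivative_transform_within_open[OF D, of "{0<..}"]) (use 1 in auto)
  next
    case 2
    have D: "((\<lambda>s::real. 0) has_real_derivative 2 * max 0 s) (at s)"
      using 2 by (auto intro!: derivative_eq_intros)
    show ?thesis
      by (rule has_field_derivative_transform_within_open[OF D, of "{..<0}"]) (use 2 in auto)
  next
    case 3
    have "((\<lambda>h::real. max 0 h) \<longlongrightarrow> max 0 0) (at 0)"
      by (intro tendsto_intros)
    moreover have "max 0 h = (max 0 h)\<^sup>2 / h" if "h \<noteq> 0" for h :: real
      using that by (simp add: max_def power2_eq_square)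
    ultimately have "((\<lambda>h::real. (max 0 h)\<^sup>2 / h) \<longlongrightarrow> 0) (at 0)"
      by (auto intro: Lim_transform_eventually simp: eventually_at_filter)
    then show ?thesis using 3 by (simp add: DERIV_def)
  qed
qed

text \<open>Vanishing of \<open>y\<close> for \<open>t \<ge> T\<close> keeps the field \<open>x |x|^-N y(t)^(N-1)\<close> away from its
singularity at the origin. The bound \<open>Q\<close> on the Riccati expression is required to be nonnegative so that the
inequality can be stated with nonnegative integrals, ready for Fatou's lemma.\<close>

lemma riccati_hardy_test:
  fixes \<phi> :: "'a::euclidean_space \<Rightarrow> real" and y y' Q :: "real \<Rightarrow> real" and R T :: real
  defines "N \<equiv> DIM('a)"
  assumes N2: "DIM('a) \<ge> 2" and \<phi>: "\<phi> \<in> test_functions \<Omega>" and \<Omega>: "\<Omega> \<subseteq> ball 0 R"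
    and y: "\<And>t. 0 < t \<Longrightarrow> (y has_real_derivative y' t) (at t)"
    and y'_cont: "continuous_on {0<..} y'"
    and y_nonneg: "\<And>t. 0 < t \<Longrightarrow> 0 \<le> y t"
    and T: "0 < T" and y_zero: "\<And>t. T \<le> t \<Longrightarrow> y t = 0"
    and Q_nonneg: "\<And>t. 0 < t \<Longrightarrow> 0 \<le> Q t"
    and Q: "\<And>t. 0 < t \<Longrightarrow> Q t \<le> (real N - 1) * (y t ^ (N - 2) * (- y' t) - y t ^ N)"
  shows "(\<integral>\<^sup>+x. ennreal (Q (ln (R / norm x)) / norm x ^ N * \<bar>\<phi> x\<bar> ^ N) \<partial>lborel)
      \<le> (\<integral>\<^sup>+x. ennreal (norm (grad \<phi> x) ^ N) \<partial>lborel)"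
proof -
  have N: "N \<ge> 2" using N2 by (simp add: N_def)
  define K where "K = closure {x. \<phi> x \<noteq> 0}"
  note \<phi>D = test_functionsD[OF \<phi>, folded K_def]
  obtain B where B: "\<And>x. B < norm x \<Longrightarrow> \<phi> x = 0" "\<And>x. B < norm x \<Longrightarrow> grad \<phi> x = 0"
    using test_functions_bounded_support[OF \<phi>] by blast
  have KR: "K \<subseteq> ball 0 R" using \<phi>D(4) \<Omega> by blast
  show ?thesis
  proof (cases "R > 0")
    case False
    then have "ball (0::'a) R = {}" by simp
    then have "\<phi> x = 0" for x using KR \<phi>D(5)[of x] by blast
    then show ?thesis using N by (simp add: power_0_left)
  next
    case R: True
    \<comment> \<open>\<open>h(x) x\<close> is the field with its factor \<open>|\<phi>|^N\<close>, and \<open>A x\<close> is the derivative of \<open>h\<close>.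
      Both vanish near the origin (on \<open>U1\<close>) and off the support of \<open>\<phi>\<close>; on \<open>U2\<close> all
      ingredients are differentiable.\<close>
    define t where "t = (\<lambda>x::'a. ln (R / norm x))"
    have t_pos: "0 < t x" if "x \<noteq> 0" "norm x < R" for x
      unfolding t_def using that by (intro ln_gt_zero) simp
    define \<gamma> where "\<gamma> = (\<lambda>x. y (t x) ^ (N - 1) / norm x ^ N)"
    define G where "G = (\<lambda>x. ((real N - 1) * y (t x) ^ (N - 2) * y' (t x) + real N * y (t x) ^ (N - 1)) / norm x ^ N)"
    define h where "h = (\<lambda>x. \<gamma> x * \<bar>\<phi> x\<bar> ^ N)"
    define A where "A = (\<lambda>x v. \<gamma> x * ((real N * \<bar>\<phi> x\<bar> ^ (N - 2) * \<phi> x) * (grad \<phi> x \<bullet> v))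
        + (- G x * ((x \<bullet> v) / (norm x)\<^sup>2)) * \<bar>\<phi> x\<bar> ^ N)"
    define U1 where "U1 = ball (0::'a) (R * exp (- T))"
    define U2 where "U2 = ball (0::'a) R - {0}"
    have cover: "x \<in> U1 \<or> x \<in> U2 \<or> x \<in> - K" for x
      using KR R by (auto simp: U1_def U2_def)
    have opens: "open U1" "open U2" "open (- K)"
      by (auto simp: U1_def U2_def K_def)
    have zero: "A x v = 0" if "\<phi> x = 0" "grad \<phi> x = 0" for x v
      using that N by (simp add: A_def)
    have U1_zero: "h x = 0" "A x v = 0" if x: "x \<in> U1" for x v
    proof -
      have "y (t x) = 0 \<and> y' (t x) = 0" if "x \<noteq> 0"
      proof -
        have "norm x < R * exp (- T)" using x by (simp add: U1_def)
        moreover have "R * exp (- T) < R" using R T by simp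
        ultimately have "norm x < R" by linarith
        then have nx: "0 < norm x" "norm x < R" "exp T < R / norm x"
          using that x R by (auto simp: U1_def exp_minus field_simps)
        have "ln (exp T) < ln (R / norm x)"
          using nx(1,3) R by (simp only: ln_less_cancel_iff exp_gt_zero divide_pos_pos)
        then have tT: "T < t x" by (simp add: t_def)
        then have "0 < t x" using T by simp
        then have "((\<lambda>s. 0) has_real_derivative y' (t x)) (at (t x))"
          by (rule has_field_derivative_transform_within_open[OF y, of _ "{T<..}"])
             (use tT y_zero in auto)
        then have "y' (t x) = 0"
          using DERIV_unique[OF _ DERIV_const[of 0]] by blast
        then show ?thesis using tT y_zero by simp
      qed
      then show "h x = 0" "A x v = 0"
        using N by (cases "x = 0"; simp add: h_def A_def \<gamma>_def G_def power_0_left)+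
    qed
    have U3_zero: "h x = 0" "A x v = 0" if "x \<in> - K" for x v
      using \<phi>D(5,6)[of x] that zero[of x v] N by (auto simp: h_def)
    have zero_nhd: "(h has_derivative (\<lambda>v. 0)) (at x)"
      if "open U" "x \<in> U" "\<And>z. z \<in> U \<Longrightarrow> h z = 0" for x U
      by (rule has_derivative_transform_within_open[OF has_derivative_const that(1,2)])
         (simp add: that(3))
    have der_t: "(t has_derivative (\<lambda>v. - ((x \<bullet> v) / (norm x)\<^sup>2))) (at x)"
      and der_\<gamma>: "(\<gamma> has_derivative (\<lambda>v. - G x * ((x \<bullet> v) / (norm x)\<^sup>2))) (at x)"
      if x: "x \<in> U2" for x
    proof -
      have nx: "x \<noteq> 0" "0 < norm x" "norm x < R" using x by (auto simp: U2_def)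
      have dn: "(norm has_derivative (\<lambda>v. (x \<bullet> v) / norm x)) (at x)"
        using has_derivative_norm[OF nx(1)] by (simp add: sgn_div_norm inner_commute divide_inverse mult.commute)
      have "((\<lambda>x. ln R - ln (norm x)) has_derivative (\<lambda>v. 0 - (x \<bullet> v) / norm x * inverse (norm x))) (at x)"
        using nx by (intro has_derivative_diff has_derivative_const has_derivative_ln dn) 
      then have "((\<lambda>x. ln R - ln (norm x)) has_derivative (\<lambda>v. - ((x \<bullet> v) / (norm x)\<^sup>2))) (at x)"
        by (simp add: power2_eq_square divide_inverse mult_ac)
      then show dt: "(t has_derivative (\<lambda>v. - ((x \<bullet> v) / (norm x)\<^sup>2))) (at x)"
        by (rule has_derivative_transform_within_open[OF _ opens(2) x])
           (use R in \<open>auto simp: t_def U2_def ln_div\<close>)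
      have tx: "0 < t x" using t_pos nx by simp
      have e: "(\<gamma> has_derivative (\<lambda>v. - (y (t x) ^ (N - 1)) *
            (inverse (norm x ^ N) * (real N * ((x \<bullet> v) / norm x) * norm x ^ (N - 1)) * inverse (norm x ^ N))
          + (real (N - 1) * (y' (t x) * - ((x \<bullet> v) / (norm x)\<^sup>2)) * y (t x) ^ (N - 1 - 1)) / norm x ^ N)) (at x)"
        unfolding \<gamma>_def
        using nx y[OF tx, unfolded has_field_derivative_def]
        by (intro has_derivative_divide has_derivative_power dn has_derivative_compose[OF dt]) auto
      show "(\<gamma> has_derivative (\<lambda>v. - G x * ((x \<bullet> v) / (norm x)\<^sup>2))) (at x)"
      proof (rule has_derivative_eq_rhs[OF e], rule ext)
        fix v
        have pN: "norm x ^ N = norm x * norm x ^ (N - 1)" using N by (simp add: power_eq_if)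
        have N': "N - 1 - 1 = N - 2" "real (N - 1) = real N - 1" using N by auto
        show "- (y (t x) ^ (N - 1)) *
            (inverse (norm x ^ N) * (real N * ((x \<bullet> v) / norm x) * norm x ^ (N - 1)) * inverse (norm x ^ N))
          + (real (N - 1) * (y' (t x) * - ((x \<bullet> v) / (norm x)\<^sup>2)) * y (t x) ^ (N - 1 - 1)) / norm x ^ N
          = - G x * ((x \<bullet> v) / (norm x)\<^sup>2)"
          unfolding G_def N' pN using nx by (simp add: field_simps power2_eq_square)
      qed
    qed
    have der: "(h has_derivative A x) (at x)" for x
    proof -
      consider "x \<in> U1" | "x \<in> U2" | "x \<in> - K" using cover by blast
      then show ?thesis
      proof cases
        case 1
        then show ?thesis
          using zero_nhd[OF opens(1) 1 U1_zero(1)] U1_zero(2)[OF 1] by (simp add: has_derivative_eq_rhs fun_eq_iff)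
      next
        case 2
        have "((\<lambda>x. \<bar>\<phi> x\<bar> ^ N) has_derivative (\<lambda>v. (real N * \<bar>\<phi> x\<bar> ^ (N - 2) * \<phi> x) * (grad \<phi> x \<bullet> v))) (at x)"
          using has_derivative_compose[OF \<phi>D(7)[of x] has_derivative_abs_power[OF N, unfolded has_field_derivative_def]] .
        from has_derivative_mult[OF der_\<gamma>[OF 2] this] show ?thesis
          unfolding h_def A_def .
      next
        case 3
        then show ?thesis
          using zero_nhd[OF opens(3) 3 U3_zero(1)] U3_zero(2)[OF 3] by (simp add: has_derivative_eq_rhs fun_eq_iff)
      qed
    qed
    have cont: "continuous_on UNIV (\<lambda>x. A x v)" for v
    proof -
      have t_cont: "continuous_on U2 t"
        using der_t by (meson continuous_at_imp_continuous_on has_derivative_continuous)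
      have t_U2: "t ` U2 \<subseteq> {0<..}"
      proof
        fix s assume "s \<in> t ` U2"
        then obtain x where x: "s = t x" "x \<in> U2" by blast
        from x(2) have "x \<noteq> 0" "norm x < R" by (auto simp: U2_def)
        then show "s \<in> {0<..}" using t_pos[of x] x(1) by simp
      qed
      have y_cont: "continuous_on {0<..} y"
        using y by (meson DERIV_isCont continuous_at_imp_continuous_on greaterThan_iff)
      note yc = continuous_on_compose2[OF y_cont t_cont t_U2] continuous_on_compose2[OF y'_cont t_cont t_U2]
      have "continuous_on U2 (\<lambda>x. A x v)"
        unfolding A_def G_def \<gamma>_def
        by (intro continuous_intros yc continuous_on_subset[OF \<phi>D(2)] \<phi>D(8)) (auto simp: U2_def)
      moreover have "continuous_on U1 (\<lambda>x. A x v)"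
        by (rule continuous_on_eq[OF continuous_on_const[of _ 0]]) (simp add: U1_zero(2))
      moreover have "continuous_on (- K) (\<lambda>x. A x v)"
        by (rule continuous_on_eq[OF continuous_on_const[of _ 0]]) (simp only: U3_zero(2))
      ultimately have "continuous_on (U1 \<union> U2 \<union> - K) (\<lambda>x. A x v)"
        by (intro continuous_on_open_Un opens open_Un)
      moreover have "U1 \<union> U2 \<union> - K = UNIV" using cover by blast
      ultimately show ?thesis by simp
    qed
    have supp: "B < norm x \<Longrightarrow> h x = 0" for x
      using B N by (simp add: h_def)
    note div = integral_divergence_radial_field[OF der cont supp, folded N_def]
    \<comment> \<open>\<open>D\<close> is the divergence of \<open>h(x) x\<close>; its integral is zero, so adding it to the energy density
      changes no integral.\<close>
    define D where "D = (\<lambda>x. real N * h x + A x x)"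
    have gint: "integrable lborel (\<lambda>x. norm (grad \<phi> x) ^ N)"
      by (rule integrable_compact_support[of _ B]) (use B N in \<open>auto intro!: continuous_intros \<phi>D(8)\<close>)
    have key: "Q (t x) / norm x ^ N * \<bar>\<phi> x\<bar> ^ N \<le> norm (grad \<phi> x) ^ N + D x" for x
    proof (cases "x \<in> K \<and> x \<noteq> 0")
      case False
      then have "x = 0 \<or> \<phi> x = 0 \<and> grad \<phi> x = 0" using \<phi>D(5,6) by blast
      then show ?thesis
        using N by (auto simp: D_def h_def A_def \<gamma>_def G_def power_0_left)
    next
      case True
      then have nx: "0 < norm x" "norm x < R" using KR by auto
      then have tx: "0 < t x" using t_pos by auto
      define Y where "Y = y (t x)"
      have Y: "0 \<le> Y" unfolding Y_def by (rule y_nonneg[OF tx])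
      have pN: "norm x ^ N = norm x * norm x ^ (N - 1)" using N by (simp add: power_eq_if)
      define S where "S = Y ^ (N - 1) / norm x ^ N * (real N * \<bar>\<phi> x\<bar> ^ (N - 2) * \<phi> x) * (grad \<phi> x \<bullet> x)"
      have "- S \<le> real N * (Y * \<bar>\<phi> x\<bar> / norm x) ^ (N - 1) * norm (grad \<phi> x)"
      proof -
        have "- S \<le> \<bar>S\<bar>" by simp
        also have "\<bar>S\<bar> = Y ^ (N - 1) / norm x ^ N * (real N * (\<bar>\<phi> x\<bar> ^ (N - 2) * \<bar>\<phi> x\<bar>)) * \<bar>grad \<phi> x \<bullet> x\<bar>"
          using Y by (simp add: S_def abs_mult power_abs)
        also have "\<bar>\<phi> x\<bar> ^ (N - 2) * \<bar>\<phi> x\<bar> = \<bar>\<phi> x\<bar> ^ (N - 1)"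
          using N by (simp add: power_eq_if numeral_2_eq_2)
        also have "Y ^ (N - 1) / norm x ^ N * (real N * \<bar>\<phi> x\<bar> ^ (N - 1)) * \<bar>grad \<phi> x \<bullet> x\<bar>
            \<le> Y ^ (N - 1) / norm x ^ N * (real N * \<bar>\<phi> x\<bar> ^ (N - 1)) * (norm (grad \<phi> x) * norm x)"
          using Y by (intro mult_left_mono Cauchy_Schwarz_ineq2) auto
        also have "\<dots> = real N * (Y * \<bar>\<phi> x\<bar> / norm x) ^ (N - 1) * norm (grad \<phi> x)"
          unfolding pN using nx by (simp add: field_simps power_mult_distrib power_divide)
        finally show ?thesis .
      qed
      also have "\<dots> \<le> (real N - 1) * (Y * \<bar>\<phi> x\<bar> / norm x) ^ N + norm (grad \<phi> x) ^ N"
        using Y by (intro power_young N) auto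
      finally have S: "- S \<le> (real N - 1) * (Y ^ N * \<bar>\<phi> x\<bar> ^ N / norm x ^ N) + norm (grad \<phi> x) ^ N"
        by (simp add: power_mult_distrib power_divide)
      have "D x = S - ((real N - 1) * Y ^ (N - 2) * y' (t x)) / norm x ^ N * \<bar>\<phi> x\<bar> ^ N"
      proof -
        have "x \<bullet> x / (norm x)\<^sup>2 = 1" using nx by (simp add: power2_norm_eq_inner)
        then show ?thesis
          by (simp add: D_def h_def A_def \<gamma>_def G_def S_def Y_def add_divide_distrib diff_divide_distrib algebra_simps)
      qed
      moreover have "Q (t x) / norm x ^ N * \<bar>\<phi> x\<bar> ^ N
          \<le> (real N - 1) * (Y ^ (N - 2) * (- y' (t x)) - Y ^ N) / norm x ^ N * \<bar>\<phi> x\<bar> ^ N"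
        unfolding Y_def by (intro mult_right_mono divide_right_mono Q tx) auto
      moreover have "(real N - 1) * (Y ^ (N - 2) * (- y' (t x)) - Y ^ N) / norm x ^ N * \<bar>\<phi> x\<bar> ^ N
          = - (((real N - 1) * Y ^ (N - 2) * y' (t x)) / norm x ^ N * \<bar>\<phi> x\<bar> ^ N)
            - (real N - 1) * (Y ^ N * \<bar>\<phi> x\<bar> ^ N / norm x ^ N)"
        using nx by (simp add: field_simps)
      ultimately show ?thesis
        using S by linarith
    qed
    have nonneg: "0 \<le> Q (t x) / norm x ^ N * \<bar>\<phi> x\<bar> ^ N" for x
    proof (cases "x \<in> K \<and> x \<noteq> 0")
      case False
      then have "x = 0 \<or> \<phi> x = 0" using \<phi>D(5) by blast
      then show ?thesis using N by (auto simp: power_0_left)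
    next
      case True
      then have "0 < t x" using t_pos KR by auto
      then show ?thesis using Q_nonneg by simp
    qed
    have "(\<integral>\<^sup>+x. ennreal (Q (t x) / norm x ^ N * \<bar>\<phi> x\<bar> ^ N) \<partial>lborel)
        \<le> (\<integral>\<^sup>+x. ennreal (norm (grad \<phi> x) ^ N + D x) \<partial>lborel)"
      by (intro nn_integral_mono ennreal_leI key)
    also have "\<dots> = ennreal (\<integral>x. norm (grad \<phi> x) ^ N + D x \<partial>lborel)"
      using nonneg key by (intro nn_integral_eq_integral AE_I2)
        (auto intro: order_trans simp: D_def gint div(1))
    also have "(\<integral>x. norm (grad \<phi> x) ^ N + D x \<partial>lborel) = (\<integral>x. norm (grad \<phi> x) ^ N \<partial>lborel)"
      using gint div by (simp add: D_def)
    also have "ennreal \<dots> = (\<integral>\<^sup>+x. ennreal (norm (grad \<phi> x) ^ N) \<partial>lborel)"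
      by (rule nn_integral_eq_integral[symmetric, OF gint]) simp
    finally show ?thesis by (simp add: t_def)
  qed
qed


lemma power_one_plus_le_linear: "\<exists>K\<ge>0. \<forall>d. 0 \<le> d \<and> d \<le> 1 \<longrightarrow> (1 + d) ^ n - 1 \<le> K * (d::real)"
proof (induction n)
  case 0
  show ?case by (intro exI[of _ 0]) auto
next
  case (Suc n)
  then obtain K where K: "K \<ge> 0" "\<And>d. 0 \<le> d \<Longrightarrow> d \<le> 1 \<Longrightarrow> (1 + d) ^ n - 1 \<le> K * (d::real)"
    by blast
  have "(1 + d) ^ Suc n - 1 \<le> (2 * K + 1) * d" if d: "0 \<le> d" "d \<le> 1" for d :: real
  proof -
    have "(1 + d) ^ Suc n - 1 = (1 + d) * ((1 + d) ^ n - 1) + d" by (simp add: algebra_simps)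
    also have "\<dots> \<le> 2 * (K * d) + d"
    proof -
      have "(1 + d) * ((1 + d) ^ n - 1) \<le> (1 + d) * (K * d)" using K(2)[OF d] d by (intro mult_left_mono) auto
      also have "\<dots> \<le> 2 * (K * d)" using K d by (intro mult_right_mono) auto
      finally show ?thesis by simp
    qed
    finally show ?thesis by (simp add: algebra_simps)
  qed
  then show ?case using K(1) by (intro exI[of _ "2 * K + 1"]) auto
qed

text \<open>The right-hand side equals \<open>1\<close> with zero derivative at \<open>d = 0\<close>: this is the stationarity of
\<open>z^n - a z^(n+1)\<close>, with \<open>a = n/(n+1)\<close>, at \<open>z = 1\<close>, scaled by \<open>n + 1\<close>.\<close>

lemma optimal_constant_quadratic_loss:
  "\<exists>C\<ge>0. \<forall>d. 0 \<le> d \<and> d \<le> 1 \<longrightarrow>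
     1 - C * d\<^sup>2 \<le> real (Suc n) * (1 + d) ^ n - real n * (1 + d) ^ Suc n"
proof (induction n)
  case 0
  show ?case by (intro exI[of _ 0]) auto
next
  case (Suc n)
  then obtain C where C: "C \<ge> 0" "\<And>d. 0 \<le> d \<Longrightarrow> d \<le> 1 \<Longrightarrow>
      1 - C * d\<^sup>2 \<le> real (Suc n) * (1 + d) ^ n - real n * (1 + d) ^ Suc n" by blast
  obtain K where K: "K \<ge> 0" "\<And>d. 0 \<le> d \<Longrightarrow> d \<le> 1 \<Longrightarrow> (1 + d) ^ Suc n - 1 \<le> K * (d::real)"
    using power_one_plus_le_linear[of "Suc n"] by blast
  have "1 - (2 * C + K) * d\<^sup>2 \<le> real (Suc (Suc n)) * (1 + d) ^ Suc n - real (Suc n) * (1 + d) ^ Suc (Suc n)"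
    if d: "0 \<le> d" "d \<le> 1" for d :: real
  proof -
    have "real (Suc (Suc n)) * (1 + d) ^ Suc n - real (Suc n) * (1 + d) ^ Suc (Suc n)
       = 1 + (1 + d) * (real (Suc n) * (1 + d) ^ n - real n * (1 + d) ^ Suc n - 1)
          - d * ((1 + d) ^ Suc n - 1)"
      by (simp add: algebra_simps)
    moreover have "d * ((1 + d) ^ Suc n - 1) \<le> d * (K * d)"
      using K(2)[OF d] d by (intro mult_left_mono) auto
    moreover have "(1 + d) * (real (Suc n) * (1 + d) ^ n - real n * (1 + d) ^ Suc n - 1) \<ge> (1 + d) * (- (C * d\<^sup>2))"
      using C(2)[OF d] d by (intro mult_left_mono) auto
    moreover have "(1 + d) * (C * d\<^sup>2) \<le> 2 * (C * d\<^sup>2)"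
      using d C by (intro mult_right_mono) auto
    ultimately show ?thesis by (simp add: algebra_simps power2_eq_square)
  qed
  then show ?case using C(1) K(1) by (intro exI[of _ "2 * C + K"]) auto
qed

definition hardy_weight :: "real \<Rightarrow> 'a::euclidean_space \<Rightarrow> real" where
  "hardy_weight R x = 1 / (norm x ^ DIM('a) * ln (R / norm x) ^ DIM('a))"

definition hardy_ratio :: "nat \<Rightarrow> real" where
  "hardy_ratio N = (real N - 1) / real N"

lemma nn_integral_le_limit:
  fixes f :: "nat \<Rightarrow> 'a \<Rightarrow> ennreal"
  assumes "\<And>k. f k \<in> borel_measurable M" "AE x in M. (\<lambda>k. f k x) \<longlonglongrightarrow> g x"
    and "\<And>k. (\<integral>\<^sup>+x. f k x \<partial>M) \<le> b k" "b \<longlonglongrightarrow> B"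
  shows "(\<integral>\<^sup>+x. g x \<partial>M) \<le> B"
proof -
  have "(\<integral>\<^sup>+x. g x \<partial>M) = (\<integral>\<^sup>+x. liminf (\<lambda>k. f k x) \<partial>M)"
    using assms(2) by (intro nn_integral_cong_AE) (auto elim!: eventually_mono simp: lim_imp_Liminf)
  also have "\<dots> \<le> liminf (\<lambda>k. \<integral>\<^sup>+x. f k x \<partial>M)"
    by (rule nn_integral_liminf[OF assms(1)])
  also have "\<dots> \<le> liminf b"
    using assms(3) by (intro Liminf_mono) auto
  also have "\<dots> = B"
    using assms(4) by (intro lim_imp_Liminf) auto
  finally show ?thesis .
qed

text \<open>For suitable \<open>C\<close> and \<open>0 \<le> \<epsilon> \<le> 1\<close>, a lower bound for \<open>z^(n-1) - t z' z^(n-2) - a z^n\<close> with \<open>a = (n-1)/n\<close> and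
\<open>z = 1 + \<epsilon>/(1+t)\<close>: a second order loss and a first order gain in \<open>\<epsilon>\<close>.\<close>

definition hardy_gain :: "real \<Rightarrow> real \<Rightarrow> real \<Rightarrow> real \<Rightarrow> real" where
  "hardy_gain C n \<epsilon> t = (1 - C * \<epsilon>\<^sup>2) / n + \<epsilon> * (t / (1 + t)\<^sup>2)"

text \<open>The factor \<open>m\<close> makes \<open>y\<close> vanish for \<open>t \<ge> 1/\<delta>\<close>; the square makes it continuously
differentiable. It is decreasing, so its derivative only helps, and since \<open>m \<le> 1\<close> the subtracted term
\<open>m^N\<close> is at most \<open>m^(N-1)\<close>. Thus it costs no more than the factor \<open>m^(N-1)\<close>, which tends
to \<open>1\<close> as \<open>\<delta> \<rightarrow> 0\<close>.\<close>

lemma hardy_gain_riccati: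
  fixes C \<epsilon> \<delta> t :: real
  assumes N: "N \<ge> 2" and C: "0 \<le> C" "\<And>d. 0 \<le> d \<Longrightarrow> d \<le> 1 \<Longrightarrow>
      1 - C * d\<^sup>2 \<le> real N * (1 + d) ^ (N - 1) - (real N - 1) * (1 + d) ^ N"
    and \<epsilon>: "0 \<le> \<epsilon>" "\<epsilon> \<le> 1" and \<delta>: "0 < \<delta>" and t: "0 < t"
  defines "a \<equiv> (real N - 1) / real N"
  defines "z \<equiv> \<lambda>t. 1 + \<epsilon> / (1 + t)" and "m \<equiv> \<lambda>t. (max 0 (1 - \<delta> * t))\<^sup>2"
  defines "z' \<equiv> \<lambda>t. - (\<epsilon> / (1 + t)\<^sup>2)" and "m' \<equiv> \<lambda>t. - (2 * \<delta> * max 0 (1 - \<delta> * t))"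
  defines "y \<equiv> \<lambda>t. a * z t * m t / t"
    and "y' \<equiv> \<lambda>t. a * ((z' t * m t + z t * m' t) / t - z t * m t / t\<^sup>2)"
  shows "(y has_real_derivative y' t) (at t)" and "0 \<le> y t"
    and "a ^ (N - 1) * m t ^ (N - 1) / t ^ N * hardy_gain C N \<epsilon> t \<le> y t ^ (N - 2) * (- y' t) - y t ^ N"
proof -
  have a: "0 < a" "a < 1" using N by (auto simp: a_def)
  have m: "0 \<le> m t" "m t \<le> 1" "m' t \<le> 0"
  proof -
    show "0 \<le> m t" by (simp add: m_def)
    have "0 \<le> \<delta> * t" using \<delta> t by simp
    then have "0 \<le> max 0 (1 - \<delta> * t)" "max 0 (1 - \<delta> * t) \<le> 1" by auto
    then show "m t \<le> 1" "m' t \<le> 0" using \<delta> by (auto simp: m_def m'_def power_le_one)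
  qed
  have z: "1 \<le> z t" using \<epsilon> t by (simp add: z_def)
  have dz: "(z has_real_derivative z' t) (at t)"
    unfolding z_def z'_def using t by (auto intro!: derivative_eq_intros simp: power2_eq_square)
  have dm: "(m has_real_derivative m' t) (at t)"
  proof -
    have "((\<lambda>t. 1 - \<delta> * t) has_real_derivative - \<delta>) (at t)" by (auto intro!: derivative_eq_intros)
    from DERIV_chain2[OF has_derivative_max_square this] show ?thesis
      unfolding m_def m'_def by (simp add: mult_ac)
  qed
  have "(y has_real_derivative a * (((z' t * m t + z t * m' t) * t - z t * m t) / (t * t))) (at t)"
    unfolding y_def using t by (auto intro!: derivative_eq_intros dz dm simp: field_simps)
  moreover have "a * (((z' t * m t + z t * m' t) * t - z t * m t) / (t * t)) = y' t"
    unfolding y'_def using t by (simp add: diff_divide_distrib power2_eq_square)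
  ultimately show "(y has_real_derivative y' t) (at t)" by simp
  show "0 \<le> y t" unfolding y_def using a m z t by simp
  obtain n where n: "N = Suc (Suc n)" using N by (metis add_2_eq_Suc le_Suc_ex)
  let ?Z = "z t" and ?M = "m t"
  have e1: "y t ^ (N - 2) * (- y' t)
     = a ^ (N - 1) / t ^ N * (?M ^ (N - 2) * ?Z ^ (N - 2) * (?M * (?Z - t * z' t) + ?Z * (- (t * m' t))))"
    unfolding y_def y'_def n using t
    by (simp add: power_mult_distrib power_divide field_simps power2_eq_square)
  have e2: "y t ^ N = a ^ (N - 1) / t ^ N * (a * ?Z ^ N * ?M ^ N)"
    unfolding y_def n by (simp add: power_mult_distrib power_divide)
  have "?M ^ (N - 1) * hardy_gain C N \<epsilon> t \<le> ?M ^ (N - 1) * (?Z ^ (N - 2) * (?Z - t * z' t) - a * ?Z ^ N)"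
  proof (rule mult_left_mono)
    define d where "d = \<epsilon> / (1 + t)"
    have d: "0 \<le> d" "d \<le> \<epsilon>" "z t = 1 + d"
      using \<epsilon> t by (auto simp: d_def z_def field_simps)
    have "1 - C * \<epsilon>\<^sup>2 \<le> 1 - C * d\<^sup>2"
      using d C(1) by (simp add: mult_left_mono power_mono)
    also have "\<dots> \<le> real N * ?Z ^ (N - 1) - (real N - 1) * ?Z ^ N"
      unfolding d(3) using C(2)[of d] d \<epsilon> by simp
    finally have "(1 - C * \<epsilon>\<^sup>2) / N \<le> (real N * ?Z ^ (N - 1) - (real N - 1) * ?Z ^ N) / N"
      by (rule divide_right_mono) simp
    also have "\<dots> = ?Z ^ (N - 2) * ?Z - a * ?Z ^ N"
      unfolding a_def n by (simp add: field_simps)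
    finally have "(1 - C * \<epsilon>\<^sup>2) / N \<le> ?Z ^ (N - 2) * ?Z - a * ?Z ^ N" .
    moreover have "1 * (\<epsilon> * (t / (1 + t)\<^sup>2)) \<le> ?Z ^ (N - 2) * (\<epsilon> * (t / (1 + t)\<^sup>2))"
      using z \<epsilon> t by (intro mult_right_mono one_le_power) auto
    ultimately show "hardy_gain C N \<epsilon> t \<le> ?Z ^ (N - 2) * (?Z - t * z' t) - a * ?Z ^ N"
      by (simp add: hardy_gain_def z'_def algebra_simps)
  qed (use m in simp)
  also have "\<dots> \<le> ?M ^ (N - 2) * ?Z ^ (N - 2) * (?M * (?Z - t * z' t) + ?Z * (- (t * m' t))) - a * ?Z ^ N * ?M ^ N"
  proof -
    have "0 \<le> ?M ^ (N - 2) * ?Z ^ (N - 2) * (?Z * (- (t * m' t)))"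
      using m z t by (intro mult_nonneg_nonneg) (auto simp: mult_nonneg_nonpos)
    moreover have "a * ?Z ^ N * ?M ^ N \<le> a * ?Z ^ N * ?M ^ (N - 1)"
      using m z a by (intro mult_left_mono power_decreasing) auto
    moreover have "?M ^ (N - 1) = ?M ^ (N - 2) * ?M" by (simp add: n)
    ultimately show ?thesis by (simp add: algebra_simps)
  qed
  finally have "a ^ (N - 1) / t ^ N * (?M ^ (N - 1) * hardy_gain C N \<epsilon> t)
      \<le> a ^ (N - 1) / t ^ N * (?M ^ (N - 2) * ?Z ^ (N - 2) * (?M * (?Z - t * z' t) + ?Z * (- (t * m' t))) - a * ?Z ^ N * ?M ^ N)"
    using a t by (intro mult_left_mono) auto
  then show "a ^ (N - 1) * m t ^ (N - 1) / t ^ N * hardy_gain C N \<epsilon> t \<le> y t ^ (N - 2) * (- y' t) - y t ^ N"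
    unfolding e1 e2 by (simp add: right_diff_distrib)
qed

section \<open>Hardy's inequality with a gain\<close>

lemma hardy_gain_test:
  fixes \<phi> :: "'a::euclidean_space \<Rightarrow> real" and R C \<epsilon> :: real
  defines "N \<equiv> DIM('a)"
  assumes N2: "DIM('a) \<ge> 2" and \<phi>: "\<phi> \<in> test_functions \<Omega>" and \<Omega>: "\<Omega> \<subseteq> ball 0 R"
    and C: "0 \<le> C" "\<And>d. 0 \<le> d \<Longrightarrow> d \<le> 1 \<Longrightarrow>
      1 - C * d\<^sup>2 \<le> real N * (1 + d) ^ (N - 1) - (real N - 1) * (1 + d) ^ N"
    and \<epsilon>: "0 \<le> \<epsilon>" "\<epsilon> \<le> 1" "C * \<epsilon>\<^sup>2 \<le> 1"
  shows "(\<integral>\<^sup>+x. ennreal ((real N - 1) * hardy_ratio N ^ (N - 1) * hardy_gain C N \<epsilon> (ln (R / norm x))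
            * (hardy_weight R x * \<bar>\<phi> x\<bar> ^ N)) \<partial>lborel)
      \<le> (\<integral>\<^sup>+x. ennreal (norm (grad \<phi> x) ^ N) \<partial>lborel)"
proof -
  have N: "N \<ge> 2" using N2 by (simp add: N_def)
  define a where "a = hardy_ratio N"
  have a: "0 < a" using N by (simp add: a_def hardy_ratio_def)
  \<comment> \<open>Cutoffs with \<open>\<delta> = 1/(k+1)\<close>, to be removed by Fatou's lemma.\<close>
  define m where "m = (\<lambda>k t. (max 0 (1 - inverse (real (Suc k)) * t))\<^sup>2)"
  define Q where "Q = (\<lambda>k t. (real N - 1) * (a ^ (N - 1) * m k t ^ (N - 1) / t ^ N * hardy_gain C N \<epsilon> t))"
  have gain: "0 \<le> hardy_gain C N \<epsilon> t" if "0 < t" for t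
    using \<epsilon> that by (simp add: hardy_gain_def)
  have m0: "0 \<le> m k t" for k t by (simp add: m_def)
  have bound: "(\<integral>\<^sup>+x. ennreal (Q k (ln (R / norm x)) / norm x ^ N * \<bar>\<phi> x\<bar> ^ N) \<partial>lborel)
      \<le> (\<integral>\<^sup>+x. ennreal (norm (grad \<phi> x) ^ N) \<partial>lborel)" for k
  proof -
    define \<delta> where "\<delta> = inverse (real (Suc k))"
    have \<delta>: "0 < \<delta>" by (simp add: \<delta>_def)
    define y where "y = (\<lambda>t. a * (1 + \<epsilon> / (1 + t)) * (max 0 (1 - \<delta> * t))\<^sup>2 / t)"
    define y' where "y' = (\<lambda>t. a * ((- (\<epsilon> / (1 + t)\<^sup>2) * (max 0 (1 - \<delta> * t))\<^sup>2
        + (1 + \<epsilon> / (1 + t)) * - (2 * \<delta> * max 0 (1 - \<delta> * t))) / t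
        - (1 + \<epsilon> / (1 + t)) * (max 0 (1 - \<delta> * t))\<^sup>2 / t\<^sup>2))"
    have ric: "(y has_real_derivative y' t) (at t)" "0 \<le> y t"
      "a ^ (N - 1) * ((max 0 (1 - \<delta> * t))\<^sup>2) ^ (N - 1) / t ^ N * hardy_gain C N \<epsilon> t
        \<le> y t ^ (N - 2) * (- y' t) - y t ^ N" if "0 < t" for t
      unfolding y_def y'_def a_def hardy_ratio_def
      by (rule hardy_gain_riccati[OF N C \<epsilon>(1,2) \<delta> that]; assumption)+
    have Qle: "Q k t \<le> (real N - 1) * (y t ^ (N - 2) * (- y' t) - y t ^ N)" if "0 < t" for t
      unfolding Q_def m_def \<delta>_def[symmetric] using N by (intro mult_left_mono ric(3) that) auto
    have Q0: "0 \<le> Q k t" if "0 < t" for t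
      unfolding Q_def using N a gain[OF that] m0 that
      by (intro mult_nonneg_nonneg divide_nonneg_nonneg) auto
    show ?thesis
    proof (rule riccati_hardy_test[OF N2 \<phi> \<Omega>, where y = y and y' = y' and T = "real (Suc k)", folded N_def])
      show "(y has_real_derivative y' t) (at t)" "0 \<le> y t" if "0 < t" for t
        using ric(1,2)[OF that] .
      show "continuous_on {0<..} y'"
        unfolding y'_def by (intro continuous_intros) (auto simp: add_pos_pos)
      show "y t = 0" if "real (Suc k) \<le> t" for t
      proof -
        have "1 \<le> \<delta> * t" using that by (simp add: \<delta>_def field_simps)
        then show ?thesis by (simp add: y_def)
      qed
    qed (use Qle Q0 in auto)
  qed
  have [measurable]: "\<phi> \<in> borel_measurable borel"
    using borel_measurable_continuous_onI[OF test_functionsD(2)[OF \<phi>]] .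
  show ?thesis
  proof (rule nn_integral_le_limit[OF _ _ bound tendsto_const])
    show "(\<lambda>x. ennreal (Q k (ln (R / norm x)) / norm x ^ N * \<bar>\<phi> x\<bar> ^ N)) \<in> borel_measurable lborel" for k
      unfolding Q_def m_def hardy_gain_def by measurable
    show "AE x in lborel. (\<lambda>k. ennreal (Q k (ln (R / norm x)) / norm x ^ N * \<bar>\<phi> x\<bar> ^ N))
       \<longlonglongrightarrow> ennreal ((real N - 1) * hardy_ratio N ^ (N - 1) * hardy_gain C N \<epsilon> (ln (R / norm x))
            * (hardy_weight R x * \<bar>\<phi> x\<bar> ^ N))"
    proof (rule AE_I2, rule tendsto_ennrealI)
      fix x :: 'a
      define t where "t = ln (R / norm x)"
      have "(\<lambda>k. m k t) \<longlonglongrightarrow> (max 0 (1 - 0 * t))\<^sup>2"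
        unfolding m_def by (intro tendsto_intros LIMSEQ_inverse_real_of_nat)
      then have "(\<lambda>k. m k t) \<longlonglongrightarrow> 1" by simp
      then have "(\<lambda>k. (real N - 1) * (a ^ (N - 1) * m k t ^ (N - 1) * inverse (t ^ N) * hardy_gain C N \<epsilon> t) * inverse (norm x ^ N) * \<bar>\<phi> x\<bar> ^ N)
         \<longlonglongrightarrow> (real N - 1) * (a ^ (N - 1) * 1 ^ (N - 1) * inverse (t ^ N) * hardy_gain C N \<epsilon> t) * inverse (norm x ^ N) * \<bar>\<phi> x\<bar> ^ N"
        by (intro tendsto_intros)
      then show "(\<lambda>k. Q k (ln (R / norm x)) / norm x ^ N * \<bar>\<phi> x\<bar> ^ N)
        \<longlonglongrightarrow> (real N - 1) * hardy_ratio N ^ (N - 1) * hardy_gain C N \<epsilon> (ln (R / norm x))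
            * (hardy_weight R x * \<bar>\<phi> x\<bar> ^ N)"
        unfolding Q_def t_def[symmetric] hardy_weight_def N_def[symmetric] a_def[symmetric]
        by (simp add: divide_inverse mult_ac)
    qed
  qed
qed

lemma nn_integral_lebesgue_on_open:
  fixes f :: "'a::euclidean_space \<Rightarrow> ennreal"
  assumes "open \<Omega>" "\<And>x. x \<notin> \<Omega> \<Longrightarrow> f x = 0"
  shows "(\<integral>\<^sup>+x. f x \<partial>lebesgue_on \<Omega>) = (\<integral>\<^sup>+x. f x \<partial>lborel)"
proof -
  have "(\<integral>\<^sup>+x. f x \<partial>lebesgue_on \<Omega>) = (\<integral>\<^sup>+x. f x * indicator \<Omega> x \<partial>lebesgue)"
    using assms(1) by (intro nn_integral_restrict_space) simp
  also have "(\<lambda>x. f x * indicator \<Omega> x) = f"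
    using assms(2) by (auto simp: indicator_def)
  finally show ?thesis by (simp add: nn_integral_completion)
qed

lemma borel_measurable_lebesgue_on:
  "f \<in> borel_measurable borel \<Longrightarrow> f \<in> borel_measurable (lebesgue_on \<Omega>)"
  by (intro measurable_restrict_space1 measurable_completion) simp

lemma Lp_diff:
  assumes "f \<in> Lp p \<Omega>" "g \<in> Lp p \<Omega>"
  shows "(\<lambda>x. f x - g x) \<in> Lp p \<Omega>"
proof -
  have [measurable]: "f \<in> borel_measurable (lebesgue_on \<Omega>)" "g \<in> borel_measurable (lebesgue_on \<Omega>)"
    using assms by (auto simp: Lp_def)
  have "integrable (lebesgue_on \<Omega>) (\<lambda>x. norm (f x - g x) ^ p)"
  proof (rule Bochner_Integration.integrable_bound)
    show "integrable (lebesgue_on \<Omega>) (\<lambda>x. 2 ^ p * (norm (f x) ^ p + norm (g x) ^ p))"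
      using assms by (auto simp: Lp_def)
    show "(\<lambda>x. norm (f x - g x) ^ p) \<in> borel_measurable (lebesgue_on \<Omega>)" by measurable
    show "AE x in lebesgue_on \<Omega>. norm (norm (f x - g x) ^ p) \<le> norm (2 ^ p * (norm (f x) ^ p + norm (g x) ^ p))"
    proof (rule AE_I2)
      fix x
      have "norm (f x - g x) ^ p \<le> (2 * max (norm (f x)) (norm (g x))) ^ p"
        using norm_triangle_ineq4[of "f x" "g x"] by (intro power_mono) auto
      also have "\<dots> = 2 ^ p * max (norm (f x)) (norm (g x)) ^ p" by (simp add: power_mult_distrib)
      also have "\<dots> \<le> 2 ^ p * (norm (f x) ^ p + norm (g x) ^ p)"
        by (intro mult_left_mono) (auto simp: max_def)
      finally show "norm (norm (f x - g x) ^ p) \<le> norm (2 ^ p * (norm (f x) ^ p + norm (g x) ^ p))"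
        by simp
    qed
  qed
  then show ?thesis by (simp add: Lp_def)
qed

lemma Lp_test:
  assumes "\<phi> \<in> test_functions \<Omega>" "open \<Omega>" "p \<ge> 1"
  shows "\<phi> \<in> Lp p \<Omega>" "grad \<phi> \<in> Lp p \<Omega>"
proof -
  note \<phi>D = test_functionsD[OF assms(1)]
  obtain B where B: "\<And>x. B < norm x \<Longrightarrow> \<phi> x = 0" "\<And>x. B < norm x \<Longrightarrow> grad \<phi> x = 0"
    using test_functions_bounded_support[OF assms(1)] by blast
  have out: "\<phi> x = 0" "grad \<phi> x = 0" if "x \<notin> \<Omega>" for x
    using that \<phi>D(4) \<phi>D(5,6)[of x] by blast+
  have c: "continuous_on UNIV (\<lambda>x. norm (\<phi> x) ^ p)" "continuous_on UNIV (\<lambda>x. norm (grad \<phi> x) ^ p)"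
    by (intro continuous_intros \<phi>D)+
  have "integrable lborel (\<lambda>x. norm (\<phi> x) ^ p)"
    using B assms(3) by (intro integrable_compact_support[OF c(1), of B]) (simp add: power_0_left)
  then have "integrable (lebesgue_on \<Omega>) (\<lambda>x. norm (\<phi> x) ^ p)"
    using out assms(3)
    by (subst integrable_lebesgue_on_iff(1)[OF assms(2) borel_measurable_continuous_onI[OF c(1)]]) (auto simp: power_0_left)
  then show "\<phi> \<in> Lp p \<Omega>"
    using borel_measurable_lebesgue_on[OF borel_measurable_continuous_onI[OF \<phi>D(2)]] by (simp add: Lp_def)
  have "integrable lborel (\<lambda>x. norm (grad \<phi> x) ^ p)"
    using B assms(3) by (intro integrable_compact_support[OF c(2), of B]) (simp add: power_0_left)
  then have "integrable (lebesgue_on \<Omega>) (\<lambda>x. norm (grad \<phi> x) ^ p)"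
    using out assms(3)
    by (subst integrable_lebesgue_on_iff(1)[OF assms(2) borel_measurable_continuous_onI[OF c(2)]]) (auto simp: power_0_left)
  then show "grad \<phi> \<in> Lp p \<Omega>"
    using borel_measurable_lebesgue_on[OF borel_measurable_continuous_onI[OF \<phi>D(8)]] by (simp add: Lp_def)
qed

lemma weak_gradient_Lp:
  assumes "has_weak_gradient \<Omega> u g" "g \<in> Lp p \<Omega>" "open \<Omega>"
  shows "weak_gradient \<Omega> u \<in> Lp p \<Omega>"
    and "(LINT x|lebesgue_on \<Omega>. norm (weak_gradient \<Omega> u x) ^ p) = (LINT x|lebesgue_on \<Omega>. norm (g x) ^ p)"
    and "(\<integral>\<^sup>+x. ennreal (norm (weak_gradient \<Omega> u x) ^ p) \<partial>lebesgue_on \<Omega>)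
       = (\<integral>\<^sup>+x. ennreal (norm (g x) ^ p) \<partial>lebesgue_on \<Omega>)"
proof -
  have eq: "AE x in lebesgue_on \<Omega>. weak_gradient \<Omega> u x = g x"
    by (rule weak_gradient_AE[OF assms(1,3)])
  then have eq': "AE x in lebesgue_on \<Omega>. g x = weak_gradient \<Omega> u x"
    by eventually_elim simp
  have g: "g \<in> borel_measurable (lebesgue_on \<Omega>)" "integrable (lebesgue_on \<Omega>) (\<lambda>x. norm (g x) ^ p)"
    using assms(2) by (auto simp: Lp_def)
  have w[measurable]: "weak_gradient \<Omega> u \<in> borel_measurable (lebesgue_on \<Omega>)"
    by (rule borel_measurable_lebesgue_on_AE[OF g(1) eq' assms(3)])
  note g(1)[measurable]
  have "integrable (lebesgue_on \<Omega>) (\<lambda>x. norm (weak_gradient \<Omega> u x) ^ p)"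
    by (rule integrable_cong_AE_imp[OF g(2)]) (use eq' in auto)
  with w show "weak_gradient \<Omega> u \<in> Lp p \<Omega>" by (simp add: Lp_def)
  show "(LINT x|lebesgue_on \<Omega>. norm (weak_gradient \<Omega> u x) ^ p) = (LINT x|lebesgue_on \<Omega>. norm (g x) ^ p)"
    by (rule integral_cong_AE) (use eq in auto)
  show "(\<integral>\<^sup>+x. ennreal (norm (weak_gradient \<Omega> u x) ^ p) \<partial>lebesgue_on \<Omega>)
       = (\<integral>\<^sup>+x. ennreal (norm (g x) ^ p) \<partial>lebesgue_on \<Omega>)"
    by (rule nn_integral_cong_AE) (use eq in auto)
qed

text \<open>Unfolds convergence in the Sobolev norm into convergence of functions and of gradients, using that the
chosen weak gradient of \<open>u - \<phi> n\<close> is almost everywhere the difference of the gradients.\<close>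

lemma W1_0_approximation:
  assumes "open \<Omega>" "p \<ge> 1" "u \<in> W1_0 p \<Omega>"
  obtains \<phi> where "\<And>n. \<phi> n \<in> test_functions \<Omega>"
    and "(\<lambda>n. LINT x|lebesgue_on \<Omega>. \<bar>u x - \<phi> n x\<bar> ^ p) \<longlonglongrightarrow> 0"
    and "(\<lambda>n. LINT x|lebesgue_on \<Omega>. norm (weak_gradient \<Omega> u x - grad (\<phi> n) x) ^ p) \<longlonglongrightarrow> 0"
    and "u \<in> Lp p \<Omega>" "weak_gradient \<Omega> u \<in> Lp p \<Omega>"
proof -
  obtain g \<phi> where u: "u \<in> Lp p \<Omega>" and g: "has_weak_gradient \<Omega> u g" "g \<in> Lp p \<Omega>"
    and \<phi>: "\<And>n. \<phi> n \<in> test_functions \<Omega>" and lim: "(\<lambda>n. W1_norm p \<Omega> (\<lambda>x. u x - \<phi> n x)) \<longlonglongrightarrow> 0"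
    using assms(3) unfolding W1_0_def W1_def by blast
  note wg = weak_gradient_Lp[OF g assms(1)]
  have hw: "has_weak_gradient \<Omega> u (weak_gradient \<Omega> u)"
    unfolding weak_gradient_def by (rule someI[of "has_weak_gradient \<Omega> u", OF g(1)])
  define A where "A = (\<lambda>n. LINT x|lebesgue_on \<Omega>. \<bar>u x - \<phi> n x\<bar> ^ p)"
  define D where "D = (\<lambda>n. LINT x|lebesgue_on \<Omega>. norm (weak_gradient \<Omega> u x - grad (\<phi> n) x) ^ p)"
  have nonneg: "0 \<le> A n" "0 \<le> D n" for n by (auto simp: A_def D_def)
  have norm: "W1_norm p \<Omega> (\<lambda>x. u x - \<phi> n x) = root p (A n + D n)" for n
  proof -
    have d: "has_weak_gradient \<Omega> (\<lambda>x. u x - \<phi> n x) (\<lambda>x. weak_gradient \<Omega> u x - grad (\<phi> n) x)"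
      by (rule has_weak_gradient_diff[OF hw has_weak_gradient_C1[OF assms(1) test_functionsD(1)[OF \<phi>]] assms(1)])
    have "(\<lambda>x. weak_gradient \<Omega> u x - grad (\<phi> n) x) \<in> Lp p \<Omega>"
      by (rule Lp_diff[OF wg(1) Lp_test(2)[OF \<phi> assms(1,2)]])
    from weak_gradient_Lp(2)[OF d this assms(1)] show ?thesis
      by (simp add: W1_norm_def A_def D_def)
  qed
  have "(\<lambda>n. root p (A n + D n) ^ p) \<longlonglongrightarrow> 0 ^ p"
    using lim unfolding norm by (rule tendsto_power)
  moreover have "root p (A n + D n) ^ p = A n + D n" for n
    using assms(2) nonneg by (intro real_root_pow_pos2) auto
  ultimately have lim0: "(\<lambda>n. A n + D n) \<longlonglongrightarrow> 0"
    using assms(2) by (simp add: power_0_left)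
  have "A \<longlonglongrightarrow> 0" "D \<longlonglongrightarrow> 0"
    by (rule tendsto_sandwich[OF _ _ tendsto_const lim0]; simp add: nonneg)+
  then show ?thesis
    using that[of \<phi>] \<phi> u wg(1) unfolding A_def D_def by blast
qed

text \<open>Replaces Minkowski's inequality wherever a perturbation of a gradient has to be absorbed.\<close>

lemma power_add_le:
  assumes "0 < \<eta>"
  obtains C where "0 \<le> C" "\<And>x y::real. 0 \<le> x \<Longrightarrow> 0 \<le> y \<Longrightarrow> (x + y) ^ n \<le> (1 + \<eta>) * x ^ n + C * y ^ n"
proof -
  obtain K where K: "K \<ge> 0" "\<And>d. 0 \<le> d \<Longrightarrow> d \<le> 1 \<Longrightarrow> (1 + d) ^ n - 1 \<le> K * (d::real)"
    using power_one_plus_le_linear[of n] by blast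
  define \<theta> where "\<theta> = min 1 (\<eta> / (K + 1))"
  have \<theta>: "0 < \<theta>" "\<theta> \<le> 1" using assms K(1) by (auto simp: \<theta>_def)
  have "K * \<theta> \<le> K * (\<eta> / (K + 1))" using K(1) by (intro mult_left_mono) (auto simp: \<theta>_def)
  also have "\<dots> \<le> \<eta>" using K(1) assms by (simp add: field_simps)
  finally have pow: "(1 + \<theta>) ^ n \<le> 1 + \<eta>" using K(2)[of \<theta>] \<theta> by simp
  show ?thesis
  proof (rule that)
    show "0 \<le> (1 / \<theta> + 1) ^ n" using \<theta> by simp
    fix x y :: real assume xy: "0 \<le> x" "0 \<le> y"
    have nn: "0 \<le> (1 + \<eta>) * x ^ n" "0 \<le> (1 / \<theta> + 1) ^ n * y ^ n"
      using xy assms \<theta> by simp_all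
    show "(x + y) ^ n \<le> (1 + \<eta>) * x ^ n + (1 / \<theta> + 1) ^ n * y ^ n"
    proof (cases "y \<le> \<theta> * x")
      case True
      then have "(x + y) ^ n \<le> ((1 + \<theta>) * x) ^ n"
        using xy by (intro power_mono) (auto simp: algebra_simps)
      also have "\<dots> \<le> (1 + \<eta>) * x ^ n"
        using pow xy by (simp add: power_mult_distrib mult_right_mono)
      finally show ?thesis using nn by simp
    next
      case False
      then have "x \<le> y / \<theta>" using \<theta> by (simp add: field_simps)
      then have "(x + y) ^ n \<le> ((1 / \<theta> + 1) * y) ^ n"
        using xy by (intro power_mono) (auto simp: algebra_simps)
      then show ?thesis using nn by (simp add: power_mult_distrib)
    qed
  qed
qed


text \<open>Along a subsequence the approximating test functions converge almost everywhere, so Fatou's lemma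
controls the weighted side; the gradients converge in norm, which controls the other side up to a factor
\<open>1 + \<eta>\<close> for arbitrary \<open>\<eta> > 0\<close>.\<close>

lemma hardy_gain_W1_0:
  fixes u :: "'a::euclidean_space \<Rightarrow> real" and R C \<epsilon> :: real
  defines "N \<equiv> DIM('a)"
  assumes N2: "DIM('a) \<ge> 2" and \<Omega>: "open \<Omega>" "\<Omega> \<subseteq> ball 0 R" and u: "u \<in> W1_0 N \<Omega>"
    and C: "0 \<le> C" "\<And>d. 0 \<le> d \<Longrightarrow> d \<le> 1 \<Longrightarrow>
      1 - C * d\<^sup>2 \<le> real N * (1 + d) ^ (N - 1) - (real N - 1) * (1 + d) ^ N"
    and \<epsilon>: "0 \<le> \<epsilon>" "\<epsilon> \<le> 1" "C * \<epsilon>\<^sup>2 \<le> 1"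
  shows "(\<integral>\<^sup>+x. ennreal ((real N - 1) * hardy_ratio N ^ (N - 1) * hardy_gain C N \<epsilon> (ln (R / norm x))
            * (hardy_weight R x * \<bar>u x\<bar> ^ N)) \<partial>lebesgue_on \<Omega>)
      \<le> ennreal (LINT x|lebesgue_on \<Omega>. norm (weak_gradient \<Omega> u x) ^ N)"
proof -
  have N: "N \<ge> 2" "N \<ge> 1" using N2 by (auto simp: N_def)
  let ?M = "lebesgue_on \<Omega>"
  define c where "c = (\<lambda>x::'a. (real N - 1) * hardy_ratio N ^ (N - 1) * hardy_gain C N \<epsilon> (ln (R / norm x)) * hardy_weight R x)"
  have c_meas: "c \<in> borel_measurable borel"
    unfolding c_def hardy_gain_def hardy_weight_def by measurable
  note cM[measurable] = borel_measurable_lebesgue_on[OF c_meas, of \<Omega>]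
  obtain \<phi> where \<phi>: "\<And>n. \<phi> n \<in> test_functions \<Omega>"
    and lim_u: "(\<lambda>n. LINT x|?M. \<bar>u x - \<phi> n x\<bar> ^ N) \<longlonglongrightarrow> 0"
    and lim_g: "(\<lambda>n. LINT x|?M. norm (weak_gradient \<Omega> u x - grad (\<phi> n) x) ^ N) \<longlonglongrightarrow> 0"
    and Lp: "u \<in> Lp N \<Omega>" "weak_gradient \<Omega> u \<in> Lp N \<Omega>"
    by (rule W1_0_approximation[OF \<Omega>(1) N(2) u]) (use that in blast)
  have out: "\<phi> n x = 0" "grad (\<phi> n) x = 0" if "x \<notin> \<Omega>" for n x
    using that test_functionsD(4)[OF \<phi>[of n]] test_functionsD(5,6)[OF \<phi>[of n], of x] by blast+
  have diff_int: "integrable ?M (\<lambda>x. \<bar>u x - \<phi> n x\<bar> ^ N)" for n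
    using Lp_diff[OF Lp(1) Lp_test(1)[OF \<phi> \<Omega>(1) N(2)]] by (simp add: Lp_def)
  have grad_int: "integrable ?M (\<lambda>x. norm (weak_gradient \<Omega> u x - grad (\<phi> n) x) ^ N)" for n
    using Lp_diff[OF Lp(2) Lp_test(2)[OF \<phi> \<Omega>(1) N(2)]] by (simp add: Lp_def)
  have wg_int: "integrable ?M (\<lambda>x. norm (weak_gradient \<Omega> u x) ^ N)"
    using Lp(2) by (simp add: Lp_def)
  obtain r :: "nat \<Rightarrow> nat" where r: "strict_mono r"
    and AE: "AE x in ?M. (\<lambda>n. \<bar>u x - \<phi> (r n) x\<bar> ^ N) \<longlonglongrightarrow> 0"
  proof -
    have "(\<lambda>n. LINT x|?M. norm (\<bar>u x - \<phi> n x\<bar> ^ N)) \<longlonglongrightarrow> 0" using lim_u by simp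
    from tendsto_L1_AE_subseq[of ?M "\<lambda>n x. \<bar>u x - \<phi> n x\<bar> ^ N", OF diff_int this]
    show ?thesis using that by blast
  qed
  have conv: "AE x in ?M. (\<lambda>n. ennreal (c x * \<bar>\<phi> (r n) x\<bar> ^ N)) \<longlonglongrightarrow> ennreal (c x * \<bar>u x\<bar> ^ N)"
    using AE
  proof eventually_elim
    case (elim x)
    have "(\<lambda>n. root N (\<bar>u x - \<phi> (r n) x\<bar> ^ N)) \<longlonglongrightarrow> root N 0"
      by (intro tendsto_real_root elim)
    then have "(\<lambda>n. \<bar>u x - \<phi> (r n) x\<bar>) \<longlonglongrightarrow> 0"
      using N by (simp add: real_root_power_cancel)
    then have "(\<lambda>n. u x - \<phi> (r n) x) \<longlonglongrightarrow> 0"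
      by (rule tendsto_rabs_zero_cancel)
    from tendsto_diff[OF tendsto_const[of "u x"] this] have "(\<lambda>n. \<phi> (r n) x) \<longlonglongrightarrow> u x"
      by simp
    then show ?case
      by (intro tendsto_ennrealI tendsto_intros)
  qed
  define I where "I = (LINT x|?M. norm (weak_gradient \<Omega> u x) ^ N)"
  define J where "J = (\<lambda>n. LINT x|?M. norm (weak_gradient \<Omega> u x - grad (\<phi> n) x) ^ N)"
  have bound: "(\<integral>\<^sup>+x. ennreal (c x * \<bar>u x\<bar> ^ N) \<partial>?M) \<le> ennreal ((1 + \<eta>) * I)" if \<eta>: "0 < \<eta>" for \<eta>
  proof -
    obtain D where D: "0 \<le> D" "\<And>x y::real. 0 \<le> x \<Longrightarrow> 0 \<le> y \<Longrightarrow> (x + y) ^ N \<le> (1 + \<eta>) * x ^ N + D * y ^ N"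
      using power_add_le[OF \<eta>] by blast
    have "(\<integral>\<^sup>+x. ennreal (c x * \<bar>\<phi> n x\<bar> ^ N) \<partial>?M) \<le> ennreal ((1 + \<eta>) * I + D * J n)" for n
    proof -
      have "(\<integral>\<^sup>+x. ennreal (c x * \<bar>\<phi> n x\<bar> ^ N) \<partial>?M) = (\<integral>\<^sup>+x. ennreal (c x * \<bar>\<phi> n x\<bar> ^ N) \<partial>lborel)"
        by (rule nn_integral_lebesgue_on_open[OF \<Omega>(1)]) (use out N in \<open>simp add: power_0_left\<close>)
      also have "\<dots> \<le> (\<integral>\<^sup>+x. ennreal (norm (grad (\<phi> n) x) ^ N) \<partial>lborel)"
        using hardy_gain_test[OF N2 \<phi> \<Omega>(2) C[unfolded N_def] \<epsilon>, of n] unfolding c_def N_def by (simp add: mult_ac)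
      also have "\<dots> = (\<integral>\<^sup>+x. ennreal (norm (grad (\<phi> n) x) ^ N) \<partial>?M)"
        by (rule nn_integral_lebesgue_on_open[OF \<Omega>(1), symmetric]) (use out N in \<open>simp add: power_0_left\<close>)
      also have "\<dots> \<le> (\<integral>\<^sup>+x. ennreal ((1 + \<eta>) * norm (weak_gradient \<Omega> u x) ^ N
          + D * norm (weak_gradient \<Omega> u x - grad (\<phi> n) x) ^ N) \<partial>?M)"
      proof (intro nn_integral_mono ennreal_leI)
        fix x
        have "norm (grad (\<phi> n) x) \<le> norm (weak_gradient \<Omega> u x) + norm (weak_gradient \<Omega> u x - grad (\<phi> n) x)"
          using norm_triangle_sub[of "grad (\<phi> n) x" "weak_gradient \<Omega> u x"]
            norm_minus_commute[of "grad (\<phi> n) x" "weak_gradient \<Omega> u x"] by linarith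
        then have "norm (grad (\<phi> n) x) ^ N \<le> (norm (weak_gradient \<Omega> u x) + norm (weak_gradient \<Omega> u x - grad (\<phi> n) x)) ^ N"
          by (intro power_mono) auto
        also have "\<dots> \<le> (1 + \<eta>) * norm (weak_gradient \<Omega> u x) ^ N + D * norm (weak_gradient \<Omega> u x - grad (\<phi> n) x) ^ N"
          by (intro D(2)) auto
        finally show "norm (grad (\<phi> n) x) ^ N \<le> (1 + \<eta>) * norm (weak_gradient \<Omega> u x) ^ N
          + D * norm (weak_gradient \<Omega> u x - grad (\<phi> n) x) ^ N" .
      qed
      also have "\<dots> = ennreal (LINT x|?M. (1 + \<eta>) * norm (weak_gradient \<Omega> u x) ^ N
          + D * norm (weak_gradient \<Omega> u x - grad (\<phi> n) x) ^ N)"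
        using wg_int grad_int[of n] \<eta> D(1) by (intro nn_integral_eq_integral) auto
      also have "(LINT x|?M. (1 + \<eta>) * norm (weak_gradient \<Omega> u x) ^ N
          + D * norm (weak_gradient \<Omega> u x - grad (\<phi> n) x) ^ N) = (1 + \<eta>) * I + D * J n"
        using wg_int grad_int[of n] by (simp add: I_def J_def)
      finally show ?thesis .
    qed
    note le = this
    have "J \<longlonglongrightarrow> 0" using lim_g by (simp add: J_def)
    then have Jr: "(\<lambda>n. J (r n)) \<longlonglongrightarrow> 0"
      using LIMSEQ_subseq_LIMSEQ[OF _ r] by (auto simp: o_def)
    have "(\<lambda>n. (1 + \<eta>) * I + D * J (r n)) \<longlonglongrightarrow> (1 + \<eta>) * I + D * 0"
      by (intro tendsto_intros Jr)
    then have lim: "(\<lambda>n. ennreal ((1 + \<eta>) * I + D * J (r n))) \<longlonglongrightarrow> ennreal ((1 + \<eta>) * I)"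
      by (intro tendsto_ennrealI) simp
    show ?thesis
    proof (rule nn_integral_le_limit[OF _ conv le lim])
      show "(\<lambda>x. ennreal (c x * \<bar>\<phi> (r n) x\<bar> ^ N)) \<in> borel_measurable ?M" for n
      proof -
        have [measurable]: "\<phi> (r n) \<in> borel_measurable ?M"
          using borel_measurable_lebesgue_on[OF borel_measurable_continuous_onI[OF test_functionsD(2)[OF \<phi>]]] .
        show ?thesis by measurable
      qed
    qed
  qed
  have "(\<lambda>k. ennreal ((1 + inverse (real (Suc k))) * I)) \<longlonglongrightarrow> ennreal ((1 + 0) * I)"
    by (intro tendsto_ennrealI tendsto_intros LIMSEQ_inverse_real_of_nat)
  then have "(\<integral>\<^sup>+x. ennreal (c x * \<bar>u x\<bar> ^ N) \<partial>?M) \<le> ennreal ((1 + 0) * I)"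
    by (rule LIMSEQ_le_const) (use bound in auto)
  then show ?thesis by (simp add: c_def I_def mult.assoc)
qed

text \<open>In case of equality the gain inequality bounds \<open>B\<close>, the integral of \<open>t/(1+t)\<^sup>2 w |u|^N\<close>,
by a multiple of \<open>\<epsilon>\<close> for all small \<open>\<epsilon>\<close>. Hence \<open>B = 0\<close>, and since its weight is
positive off the origin, \<open>u\<close> vanishes almost everywhere.\<close>

lemma hardy_inequality_strict:
  fixes \<Omega> :: "'a::euclidean_space set" and u :: "'a \<Rightarrow> real" and R :: real
  defines "N \<equiv> DIM('a)"
  defines "num \<equiv> \<lambda>u. \<integral>\<^sup>+x. ennreal (norm (weak_gradient \<Omega> u x) ^ N) \<partial>lebesgue_on \<Omega>"
    and "den \<equiv> \<lambda>u. \<integral>\<^sup>+x. ennreal (hardy_weight R x * \<bar>u x\<bar> ^ N) \<partial>lebesgue_on \<Omega>"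
  assumes N2: "DIM('a) \<ge> 2" and \<Omega>: "open \<Omega>" "\<Omega> \<subseteq> ball 0 R" and u: "u \<in> W1_0_nonzero N \<Omega>"
  shows "ennreal (hardy_ratio N ^ N) * den u < num u" "num u < \<infinity>" "0 < den u"
proof -
  let ?M = "lebesgue_on \<Omega>"
  have N: "N \<ge> 2" "N \<ge> 1" using N2 by (auto simp: N_def)
  have u0: "u \<in> W1_0 N \<Omega>" and nz: "\<not> (AE x in ?M. u x = 0)"
    using u by (auto simp: W1_0_nonzero_def)
  have Lp: "u \<in> Lp N \<Omega>" "weak_gradient \<Omega> u \<in> Lp N \<Omega>"
    by (rule W1_0_approximation[OF \<Omega>(1) N(2) u0], assumption)+
  define I where "I = (LINT x|?M. norm (weak_gradient \<Omega> u x) ^ N)"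
  have num: "num u = ennreal I"
    unfolding num_def I_def using Lp(2) by (intro nn_integral_eq_integral) (auto simp: Lp_def)
  then show "num u < \<infinity>" by simp
  define a where "a = hardy_ratio N"
  have a: "0 < a" using N by (simp add: a_def hardy_ratio_def)
  define \<kappa> where "\<kappa> = (real N - 1) * a ^ (N - 1)"
  have \<kappa>: "0 < \<kappa>" "\<kappa> / N = a ^ N"
  proof -
    show "0 < \<kappa>" using N a by (simp add: \<kappa>_def)
    have "a ^ N = a * a ^ (N - 1)" using N by (simp add: power_eq_if)
    then show "\<kappa> / N = a ^ N" by (simp add: \<kappa>_def a_def hardy_ratio_def)
  qed
  obtain C where C: "0 \<le> C" "\<And>d. 0 \<le> d \<Longrightarrow> d \<le> 1 \<Longrightarrow>
      1 - C * d\<^sup>2 \<le> real N * (1 + d) ^ (N - 1) - (real N - 1) * (1 + d) ^ N"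
  proof -
    obtain n where n: "N = Suc n" using N by (cases N) auto
    show ?thesis using optimal_constant_quadratic_loss[of n] that unfolding n by auto
  qed
  define t where "t = (\<lambda>x::'a. ln (R / norm x))"
  define w where "w = (\<lambda>x. hardy_weight R x * \<bar>u x\<bar> ^ N)"
  define \<rho> where "\<rho> = (\<lambda>x. t x / (1 + t x)\<^sup>2)"
  have t_pos: "0 < t x" if "x \<in> \<Omega>" "x \<noteq> 0" for x
    unfolding t_def using that \<Omega>(2) by (intro ln_gt_zero) auto
  have hw_pos: "0 < hardy_weight R x" if "x \<in> \<Omega>" "x \<noteq> 0" for x
    unfolding hardy_weight_def using t_pos[OF that] that by (simp add: t_def)
  have hw_nonneg: "0 \<le> hardy_weight R x" if "x \<in> \<Omega>" for x
    using hw_pos[OF that] by (cases "x = 0") (auto simp: hardy_weight_def)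
  have w: "0 \<le> w x" if "x \<in> \<Omega>" for x
    using hw_nonneg[OF that] by (simp add: w_def)
  have \<rho>: "0 \<le> \<rho> x" if "x \<in> \<Omega>" for x
  proof (cases "x = 0")
    case False
    then show ?thesis using t_pos[OF that] by (simp add: \<rho>_def)
  qed (simp add: \<rho>_def t_def)
  have [measurable]: "u \<in> borel_measurable ?M" using Lp by (simp add: Lp_def)
  have [measurable]: "hardy_weight R \<in> borel_measurable ?M" "\<rho> \<in> borel_measurable ?M"
    by (rule borel_measurable_lebesgue_on, simp add: hardy_weight_def[abs_def] \<rho>_def[abs_def] t_def[abs_def])+
  have [measurable]: "w \<in> borel_measurable ?M" unfolding w_def by measurable
  define A where "A = (\<integral>\<^sup>+x. ennreal (w x) \<partial>?M)"
  define B where "B = (\<integral>\<^sup>+x. ennreal (\<rho> x * w x) \<partial>?M)"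
  have den: "den u = A" by (simp add: den_def A_def w_def)
  have main: "ennreal (\<kappa> * (1 - C * \<epsilon>\<^sup>2) / N) * A + ennreal (\<kappa> * \<epsilon>) * B \<le> ennreal I"
    if \<epsilon>: "0 \<le> \<epsilon>" "\<epsilon> \<le> 1" "C * \<epsilon>\<^sup>2 \<le> 1" for \<epsilon>
  proof -
    have c1: "0 \<le> \<kappa> * (1 - C * \<epsilon>\<^sup>2) / N" using \<epsilon> \<kappa> by simp
    have c2: "0 \<le> \<kappa> * \<epsilon>" using \<epsilon> \<kappa> by simp
    have "ennreal (\<kappa> * (1 - C * \<epsilon>\<^sup>2) / N) * A + ennreal (\<kappa> * \<epsilon>) * B
       = (\<integral>\<^sup>+x. ennreal (\<kappa> * (1 - C * \<epsilon>\<^sup>2) / N) * ennreal (w x) + ennreal (\<kappa> * \<epsilon>) * ennreal (\<rho> x * w x) \<partial>?M)"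
      unfolding A_def B_def by (simp add: nn_integral_add nn_integral_cmult)
    also have "\<dots> = (\<integral>\<^sup>+x. ennreal ((real N - 1) * hardy_ratio N ^ (N - 1) * hardy_gain C N \<epsilon> (ln (R / norm x))
            * (hardy_weight R x * \<bar>u x\<bar> ^ N)) \<partial>?M)"
    proof (rule nn_integral_cong)
      fix x assume "x \<in> space ?M"
      then have x: "x \<in> \<Omega>" by simp
      have "ennreal (\<kappa> * (1 - C * \<epsilon>\<^sup>2) / N) * ennreal (w x) + ennreal (\<kappa> * \<epsilon>) * ennreal (\<rho> x * w x)
          = ennreal (\<kappa> * (1 - C * \<epsilon>\<^sup>2) / N * w x + \<kappa> * \<epsilon> * (\<rho> x * w x))"
        using w[OF x] \<rho>[OF x] c1 c2 by (simp only: ennreal_mult[symmetric] ennreal_plus[symmetric] mult_nonneg_nonneg)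
      also have "\<kappa> * (1 - C * \<epsilon>\<^sup>2) / N * w x + \<kappa> * \<epsilon> * (\<rho> x * w x)
         = (real N - 1) * hardy_ratio N ^ (N - 1) * hardy_gain C N \<epsilon> (ln (R / norm x))
            * (hardy_weight R x * \<bar>u x\<bar> ^ N)"
      proof -
        have "\<kappa> * (1 - C * \<epsilon>\<^sup>2) / N * w x + \<kappa> * \<epsilon> * (\<rho> x * w x) = \<kappa> * hardy_gain C N \<epsilon> (t x) * w x"
          by (simp add: hardy_gain_def \<rho>_def distrib_left distrib_right mult_ac)
        then show ?thesis by (simp add: \<kappa>_def a_def t_def w_def)
      qed
      finally show "ennreal (\<kappa> * (1 - C * \<epsilon>\<^sup>2) / N) * ennreal (w x) + ennreal (\<kappa> * \<epsilon>) * ennreal (\<rho> x * w x)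
         = ennreal ((real N - 1) * hardy_ratio N ^ (N - 1) * hardy_gain C N \<epsilon> (ln (R / norm x))
            * (hardy_weight R x * \<bar>u x\<bar> ^ N))" .
    qed
    also have "\<dots> \<le> ennreal I"
      unfolding I_def N_def
      by (rule hardy_gain_W1_0[OF N2 \<Omega> u0[unfolded N_def] C[unfolded N_def] \<epsilon>])
    finally show ?thesis .
  qed
  have AE_nz: "AE x in ?M. x \<noteq> 0"
  proof -
    have "AE x in lebesgue. x \<noteq> (0::'a)"
      by (intro AE_completion AE_lborel_singleton)
    then have "AE x in lebesgue. x \<in> \<Omega> \<longrightarrow> x \<noteq> 0" by eventually_elim simp
    then show ?thesis using \<Omega>(1) by (simp add: AE_restrict_space_iff)
  qed
  have zero: "AE x in ?M. u x = 0" if "B = 0"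
  proof -
    have "AE x in ?M. ennreal (\<rho> x * w x) = 0"
      using that unfolding B_def by (subst (asm) nn_integral_0_iff_AE) auto
    moreover have "AE x in ?M. x \<in> \<Omega>" by (rule AE_I2) simp
    ultimately show ?thesis using AE_nz
    proof eventually_elim
      case (elim x)
      have p: "0 < \<rho> x" using t_pos[of x] elim by (simp add: \<rho>_def)
      have "\<rho> x * w x \<le> 0" using elim(1) by (simp add: ennreal_eq_0_iff)
      then have "w x \<le> 0" using p by (simp add: mult_le_0_iff)
      then have "\<bar>u x\<bar> ^ N \<le> 0" using hw_pos[of x] elim by (simp add: w_def mult_le_0_iff)
      moreover have "0 < \<bar>u x\<bar> ^ N" if "u x \<noteq> 0" using that by simp
      ultimately show ?case by linarith
    qed
  qed
  have zero_A: "AE x in ?M. u x = 0" if "A = 0"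
  proof (rule zero)
    have "AE x in ?M. ennreal (w x) = 0"
      using that unfolding A_def by (subst (asm) nn_integral_0_iff_AE) auto
    moreover have "AE x in ?M. x \<in> \<Omega>" by (rule AE_I2) simp
    ultimately have "AE x in ?M. ennreal (\<rho> x * w x) = 0"
    proof eventually_elim
      case (elim x)
      then have "w x = 0" using w[of x] by (simp add: ennreal_eq_0_iff)
      then show ?case by simp
    qed
    then show "B = 0" unfolding B_def by (subst nn_integral_0_iff_AE) auto
  qed
  show "0 < den u" using zero_A nz den by (metis not_gr_zero)
  have le0: "ennreal (a ^ N) * A \<le> ennreal I"
    using main[of 0] \<kappa>(2) by simp
  show "ennreal (hardy_ratio N ^ N) * den u < num u"
  proof (rule ccontr)
    assume "\<not> ennreal (hardy_ratio N ^ N) * den u < num u"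
    with le0 have eq: "ennreal (a ^ N) * A = ennreal I"
      unfolding num den a_def by simp
    have I0: "0 \<le> I" unfolding I_def by simp
    have "A \<noteq> \<infinity>"
    proof
      assume "A = \<infinity>"
      then have "ennreal (a ^ N) * A = \<infinity>" using a by (simp add: ennreal_mult_top)
      then show False using eq by simp
    qed
    then obtain \<alpha> where \<alpha>: "A = ennreal \<alpha>" "0 \<le> \<alpha>" by (cases A) auto
    have I: "I = a ^ N * \<alpha>"
      using eq a \<alpha> I0 by (simp add: ennreal_mult[symmetric])
    \<comment> \<open>For \<open>\<epsilon> \<le> \<epsilon>0\<close> the coefficient \<open>1 - C \<epsilon>\<^sup>2\<close> of the main term stays nonnegative.\<close>
    define \<epsilon>0 where "\<epsilon>0 = 1 / (1 + C)"
    have \<epsilon>0: "0 < \<epsilon>0" "\<epsilon>0 \<le> 1" "C * \<epsilon>0 \<le> 1" using C(1) by (auto simp: \<epsilon>0_def field_simps)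
    have adm: "0 \<le> \<epsilon>" "\<epsilon> \<le> 1" "C * \<epsilon>\<^sup>2 \<le> 1" if "0 < \<epsilon>" "\<epsilon> \<le> \<epsilon>0" for \<epsilon>
    proof -
      show "0 \<le> \<epsilon>" "\<epsilon> \<le> 1" using that \<epsilon>0 by auto
      have "C * \<epsilon>\<^sup>2 \<le> C * \<epsilon>0"
        using that \<epsilon>0 C(1) by (intro mult_left_mono) (auto simp: power2_eq_square intro: order_trans[OF mult_right_mono[of \<epsilon> 1]])
      then show "C * \<epsilon>\<^sup>2 \<le> 1" using \<epsilon>0 by simp
    qed
    have "B \<noteq> \<infinity>"
    proof
      assume "B = \<infinity>"
      then have "ennreal (\<kappa> * \<epsilon>0) * B = \<infinity>" using \<kappa> \<epsilon>0 by (simp add: ennreal_mult_top)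
      then show False using main[OF adm[OF \<epsilon>0(1) order_refl]] by (simp add: top_unique)
    qed
    then obtain \<beta> where \<beta>: "B = ennreal \<beta>" "0 \<le> \<beta>" by (cases B) auto
    have small: "\<beta> \<le> C * \<epsilon> / N * \<alpha>" if \<epsilon>: "0 < \<epsilon>" "\<epsilon> \<le> \<epsilon>0" for \<epsilon>
    proof -
      have nn: "0 \<le> \<kappa> * (1 - C * \<epsilon>\<^sup>2) / N" "0 \<le> \<kappa> * \<epsilon>"
        using adm[OF \<epsilon>] \<kappa>(1) by simp_all
      have "ennreal (\<kappa> * (1 - C * \<epsilon>\<^sup>2) / N * \<alpha> + \<kappa> * \<epsilon> * \<beta>) \<le> ennreal (a ^ N * \<alpha>)"
        using main[OF adm[OF \<epsilon>]] nn \<alpha> \<beta> I by (simp only: ennreal_mult ennreal_plus mult_nonneg_nonneg)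
      then have "\<kappa> * (1 - C * \<epsilon>\<^sup>2) / N * \<alpha> + \<kappa> * \<epsilon> * \<beta> \<le> a ^ N * \<alpha>"
        using a \<alpha>(2) by (subst (asm) ennreal_le_iff) auto
      then have "\<kappa> * \<epsilon> * \<beta> \<le> \<kappa> * \<epsilon> * (C * \<epsilon> / N * \<alpha>)"
        unfolding \<kappa>(2)[symmetric]
        by (simp add: algebra_simps diff_divide_distrib power2_eq_square)
      then show ?thesis
        by (rule mult_left_le_imp_le) (use \<kappa>(1) \<epsilon>(1) in simp)
    qed
    have "\<beta> \<le> 0"
    proof (rule tendsto_lowerbound)
      have "((\<lambda>\<epsilon>. C * \<epsilon> / N * \<alpha>) \<longlongrightarrow> C * 0 / N * \<alpha>) (at_right 0)"
        using N by (intro tendsto_intros) auto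
      then show "((\<lambda>\<epsilon>. C * \<epsilon> / N * \<alpha>) \<longlongrightarrow> 0) (at_right 0)" by simp
      show "\<forall>\<^sub>F \<epsilon> in at_right 0. \<beta> \<le> C * \<epsilon> / N * \<alpha>"
        using small by (intro eventually_at_rightI[OF _ \<epsilon>0(1)]) auto
    qed simp
    then have "B = 0" using \<beta> by simp
    then show False using zero nz by blast
  qed
qed

section \<open>Blow-up at a boundary point with an interior sphere\<close>

lemma nn_integral_lborel_affine:
  fixes f :: "'a::euclidean_space \<Rightarrow> ennreal"
  assumes [measurable]: "f \<in> borel_measurable borel" and "c \<noteq> 0"
  shows "(\<integral>\<^sup>+x. f x \<partial>lborel) = ennreal (\<bar>c\<bar> ^ DIM('a)) * (\<integral>\<^sup>+x. f (t + c *\<^sub>R x) \<partial>lborel)"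
proof -
  have "(\<integral>\<^sup>+x. f x \<partial>lborel)
      = (\<integral>\<^sup>+x. f x \<partial>density (distr lborel borel (\<lambda>x. t + c *\<^sub>R x)) (\<lambda>_. ennreal (\<bar>c\<bar> ^ DIM('a))))"
    using lborel_affine[OF assms(2), of t] by simp
  also have "\<dots> = (\<integral>\<^sup>+x. ennreal (\<bar>c\<bar> ^ DIM('a)) * f x \<partial>distr lborel borel (\<lambda>x. t + c *\<^sub>R x))"
    by (rule nn_integral_density) auto
  also have "\<dots> = (\<integral>\<^sup>+x. ennreal (\<bar>c\<bar> ^ DIM('a)) * f (t + c *\<^sub>R x) \<partial>lborel)"
    by (rule nn_integral_distr) auto
  also have "\<dots> = ennreal (\<bar>c\<bar> ^ DIM('a)) * (\<integral>\<^sup>+x. f (t + c *\<^sub>R x) \<partial>lborel)"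
    by (rule nn_integral_cmult) auto
  finally show ?thesis .
qed

text \<open>Inclusion and contact at \<open>x0\<close> force \<open>norm c = R - r\<close> and equality in the triangle
inequality, so \<open>c\<close> lies on the segment from the origin to \<open>x0\<close>.\<close>

lemma internally_tangent_ball_center:
  fixes c x0 :: "'a::euclidean_space"
  assumes "0 < r" "ball c r \<subseteq> ball 0 R" "norm x0 = R" "dist c x0 = r" "0 < R"
  shows "c = x0 - (r / R) *\<^sub>R x0"
proof -
  have "norm c + r \<le> R" using assms(1,2) by (simp add: ball_subset_ball_iff)
  moreover have "R \<le> norm c + r"
    using norm_triangle_sub[of x0 c] assms(3,4) by (simp add: dist_norm norm_minus_commute)
  ultimately have nc: "norm c = R - r" by simp
  have "r\<^sup>2 = (norm (c - x0))\<^sup>2" using assms(4) by (simp add: dist_norm)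
  also have "\<dots> = (norm c)\<^sup>2 - 2 * (c \<bullet> x0) + (norm x0)\<^sup>2"
    unfolding power2_norm_eq_inner
    by (simp add: inner_diff_left inner_diff_right inner_commute)
  also have "\<dots> = (R - r)\<^sup>2 - 2 * (c \<bullet> x0) + R\<^sup>2"
    unfolding nc assms(3) ..
  finally have cx: "c \<bullet> x0 = R * (R - r)" by (simp add: power2_eq_square algebra_simps)
  define k where "k = 1 - r / R"
  have "(norm (c - k *\<^sub>R x0))\<^sup>2 = (norm c)\<^sup>2 - 2 * k * (c \<bullet> x0) + k\<^sup>2 * (norm x0)\<^sup>2"
    unfolding power2_norm_eq_inner
    by (simp add: inner_diff_left inner_diff_right inner_commute power2_eq_square algebra_simps)
  also have "\<dots> = (R - r)\<^sup>2 - 2 * k * (R * (R - r)) + (k * R)\<^sup>2"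
    unfolding nc cx assms(3) by (simp add: power_mult_distrib)
  also have "k * R = R - r" using assms(5) by (simp add: k_def field_simps)
  also have "2 * k * (R * (R - r)) = 2 * (k * R) * (R - r)" by simp
  also have "k * R = R - r" using assms(5) by (simp add: k_def field_simps)
  also have "(R - r)\<^sup>2 - 2 * (R - r) * (R - r) + (R - r)\<^sup>2 = 0"
    by (simp add: power2_eq_square algebra_simps)
  finally have "c = k *\<^sub>R x0" by simp
  then show ?thesis by (simp add: k_def algebra_simps)
qed

lemma grad_affine:
  fixes v :: "'a::euclidean_space \<Rightarrow> real"
  assumes "C_k (Suc 0) v"
  shows "grad (\<lambda>x. v (c *\<^sub>R x + p)) x = c *\<^sub>R grad v (c *\<^sub>R x + p)"
proof -
  have "((\<lambda>x. c *\<^sub>R x + p) has_derivative (\<lambda>d. c *\<^sub>R d)) (at x)"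
    by (auto intro!: derivative_eq_intros)
  from has_derivative_compose[OF this C_k_grad(1)[OF assms]]
  have D: "((\<lambda>x. v (c *\<^sub>R x + p)) has_derivative (\<lambda>d. grad v (c *\<^sub>R x + p) \<bullet> (c *\<^sub>R d))) (at x)" .
  show ?thesis
    by (rule vector_eq_rdot[THEN iffD1], rule allI)
       (use has_derivative_grad(1)[OF D] in simp)
qed

text \<open>The function \<open>v\<close> is transplanted to \<open>\<Omega>\<close> by \<open>X l y = (R - l\<^sup>2/r) e - l y\<close>: scaling by
\<open>l\<close> and a shift by \<open>l\<^sup>2/r\<close> along the inner normal. A ball deviates from its tangent plane only to
second order, so the shift moves the part \<open>norm y \<le> 1\<close> of the half-space into the interior ball. It is of smaller order than \<open>l\<close>,
so the rescaled weight still tends to \<open>(y \<bullet> e)^-N\<close>, and Fatou's lemma applies.\<close>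

lemma half_space_hardy_transfer:
  fixes \<Omega> :: "'a::euclidean_space set" and x0 c :: 'a and R r C :: real and v :: "'a \<Rightarrow> real"
  defines "N \<equiv> DIM('a)" and "e \<equiv> x0 /\<^sub>R R"
  assumes R: "0 < R" and r: "0 < r" and sub: "ball c r \<subseteq> \<Omega>" "\<Omega> \<subseteq> ball 0 R"
    and x0: "norm x0 = R" "dist c x0 = r" and C: "0 \<le> C"
    and hardy: "\<And>\<phi>. \<phi> \<in> test_functions \<Omega> \<Longrightarrow>
        ennreal C * (\<integral>\<^sup>+x. ennreal (hardy_weight R x * \<bar>\<phi> x\<bar> ^ N) \<partial>lborel)
          \<le> (\<integral>\<^sup>+x. ennreal (norm (grad \<phi> x) ^ N) \<partial>lborel)"
    and v: "\<And>k. C_k k v" "\<And>y. v y \<noteq> 0 \<Longrightarrow> norm y \<le> 1 \<and> 0 < y \<bullet> e"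
  shows "ennreal C * (\<integral>\<^sup>+y. ennreal (\<bar>v y\<bar> ^ N / (y \<bullet> e) ^ N) \<partial>lborel)
      \<le> (\<integral>\<^sup>+y. ennreal (norm (grad v y) ^ N) \<partial>lborel)"
proof -
  have e: "norm e = 1" using x0 R by (simp add: e_def)
  have ee: "e \<bullet> e = 1" using e by (simp add: norm_eq_1)
  have N0: "N > 0" by (simp add: N_def)
  have c: "c = (R - r) *\<^sub>R e"
    using internally_tangent_ball_center[OF r _ x0 R] sub R by (simp add: e_def algebra_simps divide_inverse)
  have v_meas[measurable]: "v \<in> borel_measurable borel"
    using borel_measurable_continuous_onI v(1)[of 0] by simp
  have hw_meas[measurable]: "hardy_weight R \<in> borel_measurable (borel :: 'a measure)"
    unfolding hardy_weight_def[abs_def] by measurable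
  define X where "X = (\<lambda>l y. (R - l\<^sup>2 / r) *\<^sub>R e + (- l) *\<^sub>R y)"
  have scaled: "ennreal C * (\<integral>\<^sup>+y. ennreal (l ^ N * hardy_weight R (X l y) * \<bar>v y\<bar> ^ N) \<partial>lborel)
      \<le> (\<integral>\<^sup>+y. ennreal (norm (grad v y) ^ N) \<partial>lborel)" if l: "0 < l" "l < r" for l
  proof -
    define t where "t = (R - l\<^sup>2 / r) *\<^sub>R e"
    define g where "g = (\<lambda>x. (- inverse l) *\<^sub>R x + inverse l *\<^sub>R t)"
    define \<phi> where "\<phi> = (\<lambda>x. v (g x))"
    have gX: "g (X l y) = y" for y
      using l by (simp add: g_def X_def t_def algebra_simps)
    have Xg: "X l (g x) = x" for x
      using l by (simp add: g_def X_def t_def algebra_simps)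
    have inside: "X l y \<in> ball c r" if y: "norm y \<le> 1" "0 \<le> y \<bullet> e" for y
    proof -
      define q where "q = r - l\<^sup>2 / r"
      have "l\<^sup>2 < r\<^sup>2" using l by (intro power_strict_mono) auto
      then have "l\<^sup>2 / r < r" using r by (simp add: field_simps power2_eq_square)
      then have q: "0 < q" by (simp add: q_def)
      have eq: "X l y - c = q *\<^sub>R e - l *\<^sub>R y"
        by (simp add: X_def c q_def algebra_simps)
      have "(norm (X l y - c))\<^sup>2 = q\<^sup>2 - 2 * q * l * (y \<bullet> e) + l\<^sup>2 * (norm y)\<^sup>2"
        unfolding power2_norm_eq_inner eq
        by (simp add: inner_diff_left inner_diff_right inner_commute ee power2_eq_square algebra_simps)
      also have "\<dots> \<le> q\<^sup>2 - 0 + l\<^sup>2 * 1"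
      proof -
        have "0 \<le> 2 * q * l * (y \<bullet> e)" using q l y by simp
        moreover have "l\<^sup>2 * (norm y)\<^sup>2 \<le> l\<^sup>2 * 1"
          using y by (intro mult_left_mono) (auto simp: power_le_one)
        ultimately show ?thesis by linarith
      qed
      also have "\<dots> < r\<^sup>2"
      proof -
        \<comment> \<open>The shift \<open>l\<^sup>2/r\<close> gains \<open>2 l\<^sup>2\<close> in the squared distance to the centre, against the loss \<open>l\<^sup>2\<close>.\<close>
        have "q\<^sup>2 + l\<^sup>2 = r\<^sup>2 - l\<^sup>2 * (1 - (l / r)\<^sup>2)"
          using r by (simp add: q_def power2_eq_square field_simps)
        moreover have "(l / r)\<^sup>2 < 1" using l by (simp add: power_less_one_iff abs_square_less_1)
        ultimately show ?thesis using l by simp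
      qed
      finally have "norm (X l y - c) < r" using r by (simp add: power_less_imp_less_base)
      then show ?thesis by (simp add: dist_norm norm_minus_commute)
    qed
    have supp: "closure {x. \<phi> x \<noteq> 0} \<subseteq> ball c r"
    proof -
      let ?F = "{x. norm (g x) \<le> 1 \<and> 0 \<le> g x \<bullet> e}"
      have cg: "continuous_on UNIV g" unfolding g_def by (intro continuous_intros)
      have "closed ?F"
        by (intro closed_Collect_conj closed_Collect_le continuous_intros cg)
      moreover have "{x. \<phi> x \<noteq> 0} \<subseteq> ?F" using v(2) by (auto simp: \<phi>_def less_imp_le)
      ultimately have "closure {x. \<phi> x \<noteq> 0} \<subseteq> ?F" by (rule closure_minimal[rotated])
      moreover have "?F \<subseteq> ball c r" using inside[of "g _"] Xg by auto
      ultimately show ?thesis by blast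
    qed
    have Ck: "C_k k \<phi>" for k
      unfolding \<phi>_def g_def by (rule C_k_affine[OF v(1)])
    have test: "\<phi> \<in> test_functions \<Omega>"
    proof -
      have "bounded (closure {x. \<phi> x \<noteq> 0})" using supp bounded_ball bounded_subset by blast
      then show ?thesis
        using Ck supp sub by (auto simp: test_functions_def smooth_def compact_eq_bounded_closed)
    qed
    have gr: "grad \<phi> x = (- inverse l) *\<^sub>R grad v (g x)" for x
      unfolding \<phi>_def g_def by (rule grad_affine[OF v(1)])
    have \<phi>X: "\<phi> (X l y) = v y" for y by (simp add: \<phi>_def gX)
    have [measurable]: "\<phi> \<in> borel_measurable borel"
      using borel_measurable_continuous_onI Ck[of 0] by simp
    have [measurable]: "grad \<phi> \<in> borel_measurable borel"
      using borel_measurable_continuous_onI[OF continuous_grad[OF Ck]] .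
    have lN: "0 \<le> l ^ N" using l by simp
    have "ennreal C * (\<integral>\<^sup>+y. ennreal (l ^ N * hardy_weight R (X l y) * \<bar>v y\<bar> ^ N) \<partial>lborel)
        = ennreal C * (ennreal (l ^ N) * (\<integral>\<^sup>+y. ennreal (hardy_weight R (X l y) * \<bar>\<phi> (X l y)\<bar> ^ N) \<partial>lborel))"
    proof -
      have [measurable]: "X l \<in> borel_measurable borel" unfolding X_def by measurable
      have "(\<integral>\<^sup>+y. ennreal (l ^ N * hardy_weight R (X l y) * \<bar>v y\<bar> ^ N) \<partial>lborel)
         = (\<integral>\<^sup>+y. ennreal (l ^ N) * ennreal (hardy_weight R (X l y) * \<bar>v y\<bar> ^ N) \<partial>lborel)"
        using lN by (intro nn_integral_cong) (simp add: ennreal_mult' mult.assoc)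
      then show ?thesis by (simp add: \<phi>X nn_integral_cmult)
    qed
    also have "ennreal (l ^ N) * (\<integral>\<^sup>+y. ennreal (hardy_weight R (X l y) * \<bar>\<phi> (X l y)\<bar> ^ N) \<partial>lborel)
        = (\<integral>\<^sup>+x. ennreal (hardy_weight R x * \<bar>\<phi> x\<bar> ^ N) \<partial>lborel)"
      using nn_integral_lborel_affine[of "\<lambda>x. ennreal (hardy_weight R x * \<bar>\<phi> x\<bar> ^ N)" "- l" t] l
      by (simp add: X_def t_def N_def)
    also have "ennreal C * (\<integral>\<^sup>+x. ennreal (hardy_weight R x * \<bar>\<phi> x\<bar> ^ N) \<partial>lborel)
        \<le> (\<integral>\<^sup>+x. ennreal (norm (grad \<phi> x) ^ N) \<partial>lborel)"
      by (rule hardy[OF test])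
    also have "\<dots> = ennreal (l ^ N) * (\<integral>\<^sup>+y. ennreal (norm (grad \<phi> (X l y)) ^ N) \<partial>lborel)"
      using nn_integral_lborel_affine[of "\<lambda>x. ennreal (norm (grad \<phi> x) ^ N)" "- l" t] l
      by (simp add: X_def t_def N_def)
    also have "\<dots> = (\<integral>\<^sup>+y. ennreal (l ^ N) * ennreal (norm (grad \<phi> (X l y)) ^ N) \<partial>lborel)"
    proof -
      have [measurable]: "X l \<in> borel_measurable borel" unfolding X_def by measurable
      show ?thesis by (rule nn_integral_cmult[symmetric]) measurable
    qed
    also have "\<dots> = (\<integral>\<^sup>+y. ennreal (norm (grad v y) ^ N) \<partial>lborel)"
    proof (rule nn_integral_cong)
      fix y
      have "l ^ N * norm (grad \<phi> (X l y)) ^ N = norm (grad v y) ^ N"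
        using l by (simp add: gr gX power_mult_distrib field_simps)
      then show "ennreal (l ^ N) * ennreal (norm (grad \<phi> (X l y)) ^ N) = ennreal (norm (grad v y) ^ N)"
        using lN by (simp add: ennreal_mult'[symmetric])
    qed
    finally show ?thesis .
  qed
  define L where "L = (\<lambda>k. r / real (Suc (Suc k)))"
  have L: "0 < L k" "L k < r" for k using r by (auto simp: L_def field_simps intro!: add_pos_nonneg)
  have L_lim: "L \<longlonglongrightarrow> 0"
    unfolding L_def using LIMSEQ_ignore_initial_segment[OF LIMSEQ_Suc[OF lim_const_over_n[of r]], of 1]
    by simp
  have weight_lim: "(\<lambda>k. L k ^ N * hardy_weight R (X (L k) y)) \<longlonglongrightarrow> 1 / (y \<bullet> e) ^ N" if s: "0 < y \<bullet> e" for y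
  proof -
    define s where "s = y \<bullet> e"
    have s: "0 < s" using s by (simp add: s_def)
    define p where "p = (\<lambda>l. (R - l\<^sup>2 / r)\<^sup>2 - 2 * (R - l\<^sup>2 / r) * l * s + l\<^sup>2 * (norm y)\<^sup>2)"
    have nX: "(norm (X l y))\<^sup>2 = p l" for l
      unfolding power2_norm_eq_inner X_def p_def s_def
      by (simp add: inner_add_left inner_add_right inner_commute ee power2_eq_square algebra_simps)
    have p0: "p 0 = R\<^sup>2" by (simp add: p_def)
    have pD: "(p has_real_derivative - 2 * R * s) (at 0)"
      unfolding p_def using r by (auto intro!: derivative_eq_intros)
    \<comment> \<open>\<open>f l\<close> is \<open>ln (R / norm (X l y))\<close>, written through the polynomial \<open>p\<close> so that it is
      differentiable at \<open>l = 0\<close>.\<close>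
    define f where "f = (\<lambda>l. ln R - ln (p l) / 2)"
    have fD: "(f has_real_derivative s / R) (at 0)"
    proof -
      have "(f has_real_derivative 0 - (- 2 * R * s) / p 0 / 2) (at 0)"
        unfolding f_def using R by (auto intro!: derivative_eq_intros pD simp: p0)
      then show ?thesis using R by (simp add: p0 power2_eq_square)
    qed
    have f0: "f 0 = 0" using R by (simp add: f_def p0 ln_realpow)
    have "((\<lambda>l. f l / l) \<longlongrightarrow> s / R) (at 0)"
      using fD f0 by (simp add: DERIV_def)
    moreover have "filterlim L (at 0) sequentially"
      using L by (intro filterlim_atI L_lim) (auto simp: less_imp_neq[symmetric])
    ultimately have lim1: "(\<lambda>k. f (L k) / L k) \<longlonglongrightarrow> s / R"
      by (rule filterlim_compose)
    have "continuous (at 0) p" using pD by (rule DERIV_isCont)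
    then have pL: "(\<lambda>k. p (L k)) \<longlonglongrightarrow> R\<^sup>2"
      using isCont_tendsto_compose[OF _ L_lim] p0 by force
    have lim2: "(\<lambda>k. norm (X (L k) y)) \<longlonglongrightarrow> R"
    proof -
      have "(\<lambda>k. sqrt (p (L k))) \<longlonglongrightarrow> sqrt (R\<^sup>2)" by (intro tendsto_real_sqrt pL)
      moreover have "sqrt (p (L k)) = norm (X (L k) y)" for k
        using nX by (metis norm_ge_zero real_sqrt_unique)
      ultimately show ?thesis using R by simp
    qed
    have "(\<lambda>k. 1 / (norm (X (L k) y) * (f (L k) / L k)) ^ N) \<longlonglongrightarrow> 1 / (R * (s / R)) ^ N"
      using R s by (intro tendsto_intros lim1 lim2) auto
    moreover have "\<forall>\<^sub>F k in sequentially. 1 / (norm (X (L k) y) * (f (L k) / L k)) ^ N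
        = L k ^ N * hardy_weight R (X (L k) y)"
    proof -
      have "\<forall>\<^sub>F k in sequentially. 0 < norm (X (L k) y)"
        using order_tendstoD(1)[OF lim2 R] .
      then show ?thesis
      proof eventually_elim
        case (elim k)
        have "ln (R / norm (X (L k) y)) = f (L k)"
          using elim R by (simp add: f_def nX[symmetric] ln_div ln_realpow)
        then show ?case
          using L[of k] by (simp add: hardy_weight_def N_def[symmetric] power_mult_distrib power_divide)
      qed
    qed
    ultimately have "(\<lambda>k. L k ^ N * hardy_weight R (X (L k) y)) \<longlonglongrightarrow> 1 / (R * (s / R)) ^ N"
      by (rule Lim_transform_eventually)
    then show ?thesis using R by (simp add: s_def)
  qed
  have "(\<integral>\<^sup>+y. ennreal (C * (\<bar>v y\<bar> ^ N / (y \<bullet> e) ^ N)) \<partial>lborel) \<le> (\<integral>\<^sup>+y. ennreal (norm (grad v y) ^ N) \<partial>lborel)"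
  proof (rule nn_integral_le_limit[OF _ _ _ tendsto_const])
    show "(\<lambda>y. ennreal (C * (L k ^ N * hardy_weight R (X (L k) y) * \<bar>v y\<bar> ^ N))) \<in> borel_measurable lborel" for k
      unfolding X_def by measurable
    show "AE y in lborel. (\<lambda>k. ennreal (C * (L k ^ N * hardy_weight R (X (L k) y) * \<bar>v y\<bar> ^ N)))
        \<longlonglongrightarrow> ennreal (C * (\<bar>v y\<bar> ^ N / (y \<bullet> e) ^ N))"
    proof (rule AE_I2)
      fix y
      show "(\<lambda>k. ennreal (C * (L k ^ N * hardy_weight R (X (L k) y) * \<bar>v y\<bar> ^ N)))
        \<longlonglongrightarrow> ennreal (C * (\<bar>v y\<bar> ^ N / (y \<bullet> e) ^ N))"
      proof (cases "v y = 0")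
        case True
        then show ?thesis using N0 by (simp add: power_0_left)
      next
        case False
        then have "(\<lambda>k. C * (L k ^ N * hardy_weight R (X (L k) y) * \<bar>v y\<bar> ^ N)) \<longlonglongrightarrow> C * (1 / (y \<bullet> e) ^ N * \<bar>v y\<bar> ^ N)"
          using v(2) by (intro tendsto_intros weight_lim) blast
        then show ?thesis by (intro tendsto_ennrealI) simp
      qed
    qed
    show "(\<integral>\<^sup>+y. ennreal (C * (L k ^ N * hardy_weight R (X (L k) y) * \<bar>v y\<bar> ^ N)) \<partial>lborel)
        \<le> (\<integral>\<^sup>+y. ennreal (norm (grad v y) ^ N) \<partial>lborel)" for k
    proof -
      have [measurable]: "X (L k) \<in> borel_measurable borel" unfolding X_def by measurable
      have "(\<integral>\<^sup>+y. ennreal (C * (L k ^ N * hardy_weight R (X (L k) y) * \<bar>v y\<bar> ^ N)) \<partial>lborel)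
         = (\<integral>\<^sup>+y. ennreal C * ennreal (L k ^ N * hardy_weight R (X (L k) y) * \<bar>v y\<bar> ^ N) \<partial>lborel)"
        by (intro nn_integral_cong ennreal_mult' C)
      also have "\<dots> = ennreal C * (\<integral>\<^sup>+y. ennreal (L k ^ N * hardy_weight R (X (L k) y) * \<bar>v y\<bar> ^ N) \<partial>lborel)"
        by (rule nn_integral_cmult) measurable
      finally show ?thesis using scaled[OF L] by simp
    qed
  qed
  moreover have "(\<integral>\<^sup>+y. ennreal (C * (\<bar>v y\<bar> ^ N / (y \<bullet> e) ^ N)) \<partial>lborel)
      = ennreal C * (\<integral>\<^sup>+y. ennreal (\<bar>v y\<bar> ^ N / (y \<bullet> e) ^ N) \<partial>lborel)"
  proof -
    have "(\<integral>\<^sup>+y. ennreal (C * (\<bar>v y\<bar> ^ N / (y \<bullet> e) ^ N)) \<partial>lborel)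
       = (\<integral>\<^sup>+y. ennreal C * ennreal (\<bar>v y\<bar> ^ N / (y \<bullet> e) ^ N) \<partial>lborel)"
      by (intro nn_integral_cong ennreal_mult' C)
    also have "\<dots> = ennreal C * (\<integral>\<^sup>+y. ennreal (\<bar>v y\<bar> ^ N / (y \<bullet> e) ^ N) \<partial>lborel)"
      by (rule nn_integral_cmult) measurable
    finally show ?thesis .
  qed
  ultimately show ?thesis by simp
qed


section \<open>The Hardy constant of a half-space\<close>

lemma flat_power_ratio:
  assumes "N \<ge> 2"
  shows "flat (hardy_ratio N) \<beta> s ^ N / s ^ N = flat (- 1) (real N * \<beta>) s"
proof (cases "0 < s")
  case True
  have "(s powr hardy_ratio N) ^ N = s powr (real N - 1)"
    using True assms by (simp add: powr_power hardy_ratio_def)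
  also have "\<dots> = s ^ N * s powr (- 1)"
    using True by (simp add: powr_diff powr_realpow powr_minus divide_inverse)
  finally show ?thesis
    using True by (simp add: flat_def power_mult_distrib exp_of_nat_mult[symmetric])
next
  case False
  then show ?thesis using assms by (simp add: flat_nonpos power_0_left)
qed

text \<open>The left-hand side is the \<open>N\<close>-th power of the derivative of \<open>flat a \<beta>\<close>. With \<open>x = \<beta>/s\<close> the
claim is \<open>(a+x)^N exp(-N x) \<le> a^N exp(-N x) + N x exp(-x)\<close>, which follows from
\<open>(a+x)^N - a^N \<le> N x (a+x)^(N-1)\<close> and \<open>a + x \<le> exp x\<close>. The excess is, up to
the factor \<open>N\<close>, the derivative of \<open>flat 0 \<beta>\<close>.\<close>

lemma flat_derivative_power_le:
  assumes N: "N \<ge> 2" and \<beta>: "0 < \<beta>"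
  defines "a \<equiv> hardy_ratio N"
  shows "(a * flat (a - 1) \<beta> s + \<beta> * flat (a - 2) \<beta> s) ^ N
      \<le> a ^ N * flat (- 1) (real N * \<beta>) s + real N * (\<beta> * flat (- 2) \<beta> s)"
proof (cases "0 < s")
  case s: True
  have a: "0 < a" "a < 1" using N by (auto simp: a_def hardy_ratio_def)
  define x where "x = \<beta> / s"
  have x: "0 < x" using s \<beta> by (simp add: x_def)
  have lhs: "a * flat (a - 1) \<beta> s + \<beta> * flat (a - 2) \<beta> s = s powr (a - 1) * ((a + x) * exp (- x))"
  proof -
    have "s powr (a - 2) = s powr (a - 1) / s"
      using s by (metis (no_types) add_diff_eq diff_diff_eq one_add_one powr_diff powr_one less_imp_le)
    then show ?thesis using s by (simp add: flat_def x_def algebra_simps)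
  qed
  have p1: "(s powr (a - 1)) ^ N = 1 / s"
  proof -
    have "(a - 1) * real N = - 1" using N by (simp add: a_def hardy_ratio_def field_simps)
    then have "(s powr (a - 1)) ^ N = s powr (- 1)" using s N by (simp add: powr_power mult.commute)
    then show ?thesis using s by (simp add: powr_minus divide_inverse)
  qed
  have "(a + x) ^ N - a ^ N \<le> real N * (a + x) ^ (N - 1) * x"
  proof -
    have "real N * (a + x) ^ (N - 1) * a \<le> (real N - 1) * (a + x) ^ N + a ^ N"
      using a x by (intro power_young N) auto
    moreover have "(a + x) ^ N = (a + x) ^ (N - 1) * (a + x)" using N by (simp add: power_eq_if)
    ultimately show ?thesis by (simp add: algebra_simps)
  qed
  also have "\<dots> \<le> real N * exp (real (N - 1) * x) * x"
  proof -
    have "a + x \<le> exp x" using a exp_ge_add_one_self[of x] by linarith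
    then have "(a + x) ^ (N - 1) \<le> exp x ^ (N - 1)" using a x by (intro power_mono) auto
    then show ?thesis
      unfolding exp_of_nat_mult using x by (intro mult_right_mono mult_left_mono) auto
  qed
  finally have "((a + x) ^ N - a ^ N) * exp (- (real N * x)) \<le> real N * exp (real (N - 1) * x) * x * exp (- (real N * x))"
    by (intro mult_right_mono) auto
  also have "\<dots> = real N * x * (exp (real (N - 1) * x) * exp (- (real N * x)))" by simp
  also have "exp (real (N - 1) * x) * exp (- (real N * x)) = exp (- x)"
    using N by (simp add: exp_add[symmetric] of_nat_diff algebra_simps)
  finally have main: "(a + x) ^ N * exp (- (real N * x)) \<le> a ^ N * exp (- (real N * x)) + real N * x * exp (- x)"
    by (simp add: algebra_simps)
  have "(a * flat (a - 1) \<beta> s + \<beta> * flat (a - 2) \<beta> s) ^ N = 1 / s * ((a + x) ^ N * exp (- (real N * x)))"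
    unfolding lhs by (simp add: power_mult_distrib p1 exp_of_nat_mult[symmetric])
  also have "\<dots> \<le> 1 / s * (a ^ N * exp (- (real N * x)) + real N * x * exp (- x))"
    using main s by (intro mult_left_mono) auto
  also have "\<dots> = a ^ N * flat (- 1) (real N * \<beta>) s + real N * (\<beta> * flat (- 2) \<beta> s)"
    using s by (simp add: flat_def x_def powr_minus powr_numeral field_simps power2_eq_square)
  finally show ?thesis .
next
  case False
  then show ?thesis using N by (simp add: flat_nonpos power_0_left)
qed

lemma has_derivative_flat_radial:
  assumes "0 < \<beta>"
  shows "((\<lambda>y::'a::euclidean_space. flat \<alpha> \<beta> (1 - (norm y)\<^sup>2)) has_derivative
     (\<lambda>d. (\<alpha> * flat (\<alpha> - 1) \<beta> (1 - (norm y)\<^sup>2) + \<beta> * flat (\<alpha> - 2) \<beta> (1 - (norm y)\<^sup>2)) * (- 2 * (y \<bullet> d)))) (at y)"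
proof -
  have "((\<lambda>y::'a. 1 - (norm y)\<^sup>2) has_derivative (\<lambda>d. - 2 * (y \<bullet> d))) (at y)"
    unfolding power2_norm_eq_inner
    by (auto intro!: derivative_eq_intros simp: inner_commute)
  from has_derivative_compose[OF this has_derivative_flat[OF assms, unfolded has_field_derivative_def]]
  show ?thesis .
qed

lemma C_k_flat_radial: "0 < \<beta> \<Longrightarrow> C_k k (\<lambda>y::'a::euclidean_space. flat \<alpha> \<beta> (1 - (norm y)\<^sup>2))"
proof -
  assume \<beta>: "0 < \<beta>"
  have "C_k k (\<lambda>y::'a. 1 + (- 1) * (norm y)\<^sup>2)"
    by (intro C_k_add C_k_mult C_k_const C_k_norm_square)
  then show ?thesis using C_k_compose[OF C_k_flat[OF \<beta>], of k] by simp
qed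

text \<open>Write \<open>s = y \<bullet> e\<close>. For \<open>v = \<psi> flat a \<beta> s\<close> the weighted integral is that of \<open>M \<beta>\<close>,
and the energy exceeds \<open>a^N\<close> times it by the integrals of \<open>E \<beta>\<close> and \<open>G\<close>, up to factors close
to \<open>1\<close>. As \<open>E \<beta>\<close> is \<open>\<Psi>\<close> times a normal derivative of \<open>flat 0 \<beta> s\<close>, its integral is bounded
uniformly in \<open>\<beta>\<close> after integrating by parts. A constant \<open>C > a^N\<close> would therefore bound the
integrals of \<open>M \<beta>\<close>, and in the limit \<open>\<beta> \<rightarrow> 0\<close> make \<open>P = \<Psi>/s\<close> integrable over the half-space.

Divergence of that integral is seen without computing it: if \<open>P\<close> were integrable, then the integral of
\<open>E \<beta> = P (\<beta>/s) exp (-\<beta>/s)\<close> would tend to \<open>0\<close> by dominated convergence, whereas its integrated-by-parts form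
tends to the integral of \<open>- grad \<Psi> \<bullet> e\<close> over the half-space, which is positive because \<open>\<Psi>\<close> is
radially decreasing.\<close>

lemma half_space_hardy_constant:
  fixes e :: "'a::euclidean_space" and C :: real
  defines "N \<equiv> DIM('a)"
  assumes N2: "DIM('a) \<ge> 2" and e: "norm e = 1"
    and hardy: "\<And>v. (\<And>k. C_k k v) \<Longrightarrow> (\<And>y. v y \<noteq> 0 \<Longrightarrow> norm y \<le> 1 \<and> 0 < y \<bullet> e) \<Longrightarrow>
        ennreal C * (\<integral>\<^sup>+y. ennreal (\<bar>v y\<bar> ^ N / (y \<bullet> e) ^ N) \<partial>lborel)
      \<le> (\<integral>\<^sup>+y. ennreal (norm (grad v y) ^ N) \<partial>lborel)"
  shows "C \<le> hardy_ratio N ^ N"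
proof (rule ccontr)
  assume "\<not> C \<le> hardy_ratio N ^ N"
  have N: "N \<ge> 2" "N > 0" using N2 by (auto simp: N_def)
  define a where "a = hardy_ratio N"
  have a: "0 < a" "a < 1" using N by (auto simp: a_def hardy_ratio_def)
  have aC: "a ^ N < C" using \<open>\<not> C \<le> hardy_ratio N ^ N\<close> by (simp add: a_def)
  have C0: "0 \<le> C" using aC a by (smt (verit) zero_less_power)
  have ee: "e \<bullet> e = 1" using e by (simp add: norm_eq_1)
  define q where "q = (\<lambda>y::'a. 1 - (norm y)\<^sup>2)"
  define \<psi> where "\<psi> = (\<lambda>y::'a. flat 0 1 (q y))"
  define \<Psi> where "\<Psi> = (\<lambda>y::'a. flat 0 (real N) (q y))"
  have rN: "0 < real N" using N by simp
  have q_neg: "q y \<le> 0" if "1 < norm y" for y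
  proof -
    have "1 \<le> (norm y)\<^sup>2" using that by (simp add: one_le_power)
    then show ?thesis by (simp add: q_def)
  qed
  have C\<psi>: "C_k k \<psi>" for k unfolding \<psi>_def q_def by (rule C_k_flat_radial) simp
  have C\<Psi>: "C_k k \<Psi>" for k unfolding \<Psi>_def q_def by (rule C_k_flat_radial[OF rN])
  have \<Psi>\<psi>: "\<Psi> y = \<psi> y ^ N" for y
    using N by (simp add: \<Psi>_def \<psi>_def flat_def power_0_left exp_of_nat_mult[symmetric])
  have \<psi>0: "0 \<le> \<psi> y" and \<Psi>0: "0 \<le> \<Psi> y" for y by (simp_all add: \<psi>_def \<Psi>_def flat_nonneg)
  have grad\<psi>: "grad \<psi> y \<bullet> d = flat (- 2) 1 (q y) * (- 2 * (y \<bullet> d))" for y d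
    using has_derivative_grad(1)[OF has_derivative_flat_radial[of 1 0 y], of d]
    unfolding \<psi>_def q_def by simp
  have grad\<Psi>: "grad \<Psi> y \<bullet> d = real N * flat (- 2) (real N) (q y) * (- 2 * (y \<bullet> d))" for y d
    using has_derivative_grad(1)[OF has_derivative_flat_radial[OF rN, of 0 y], of d]
    unfolding \<Psi>_def q_def by simp
  have out: "\<psi> y = 0" "\<Psi> y = 0" "grad \<psi> y = 0" "grad \<Psi> y = 0" if "1 < norm y" for y
  proof -
    show "\<psi> y = 0" "\<Psi> y = 0" using q_neg[OF that] by (simp_all add: \<psi>_def \<Psi>_def flat_nonpos)
    have "grad \<psi> y \<bullet> grad \<psi> y = 0" "grad \<Psi> y \<bullet> grad \<Psi> y = 0"
      unfolding grad\<psi> grad\<Psi> using q_neg[OF that] by (simp_all add: flat_nonpos)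
    then show "grad \<psi> y = 0" "grad \<Psi> y = 0" by simp_all
  qed
  have cont: "continuous_on UNIV \<psi>" "continuous_on UNIV \<Psi>" using C\<psi>[of 0] C\<Psi>[of 0] by simp_all
  have flat_cont: "continuous_on UNIV (\<lambda>y. flat \<alpha> \<beta> (y \<bullet> e))" if "0 < \<beta>" for \<alpha> \<beta>
    using C_k_compose[OF C_k_flat[OF that] C_k_inner, of 0 \<alpha> e] by simp
  define M where "M = (\<lambda>\<beta> y. \<Psi> y * flat (- 1) (real N * \<beta>) (y \<bullet> e))"
  define E where "E = (\<lambda>\<beta> y. \<Psi> y * (\<beta> * flat (- 2) \<beta> (y \<bullet> e)))"
  define G where "G = (\<lambda>y. norm (grad \<psi> y) ^ N)"
  define T where "T = (\<lambda>\<beta> y. (grad \<Psi> y \<bullet> e) * flat 0 \<beta> (y \<bullet> e))"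
  have int_M: "integrable lborel (M \<beta>)" if "0 < \<beta>" for \<beta>
    unfolding M_def using that rN
    by (intro integrable_compact_support[where B = 1] continuous_intros cont flat_cont) (simp_all add: out)
  have int_E: "integrable lborel (E \<beta>)" if "0 < \<beta>" for \<beta>
    unfolding E_def using that
    by (intro integrable_compact_support[where B = 1] continuous_intros cont flat_cont) (simp_all add: out)
  have int_T: "integrable lborel (T \<beta>)" if "0 < \<beta>" for \<beta>
    unfolding T_def using that
    by (intro integrable_compact_support[where B = 1] continuous_intros continuous_grad[OF C\<Psi>] flat_cont) (simp_all add: out)
  have int_G: "integrable lborel G"
    unfolding G_def using N
    by (intro integrable_compact_support[where B = 1] continuous_intros continuous_grad[OF C\<psi>]) (simp_all add: out power_0_left)
  have int_K1: "integrable lborel (\<lambda>y. \<bar>grad \<Psi> y \<bullet> e\<bar>)"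
    by (intro integrable_compact_support[where B = 1] continuous_intros continuous_grad[OF C\<Psi>]) (simp_all add: out)
  have M0: "0 \<le> M \<beta> y" and E0: "0 < \<beta> \<Longrightarrow> 0 \<le> E \<beta> y" and G0: "0 \<le> G y" for \<beta> y
    by (simp_all add: M_def E_def G_def flat_nonneg \<Psi>0)
  have ET: "(\<integral>y. E \<beta> y \<partial>lborel) = - (\<integral>y. T \<beta> y \<partial>lborel)" if \<beta>: "0 < \<beta>" for \<beta>
  proof -
    have "((\<lambda>y. y \<bullet> e) has_derivative (\<lambda>d. d \<bullet> e)) (at y)" for y by (auto intro!: derivative_eq_intros)
    from has_derivative_compose[OF this has_derivative_flat[OF \<beta>, of 0, unfolded has_field_derivative_def]]
    have "((\<lambda>y. flat 0 \<beta> (y \<bullet> e)) has_derivative (\<lambda>d. \<beta> * flat (- 2) \<beta> (y \<bullet> e) * (d \<bullet> e))) (at y)" for y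
      by simp
    from has_derivative_mult[OF C_k_grad(1)[OF C\<Psi>] this]
    have D: "((\<lambda>y. \<Psi> y * flat 0 \<beta> (y \<bullet> e)) has_derivative
      (\<lambda>d. \<Psi> y * (\<beta> * flat (- 2) \<beta> (y \<bullet> e) * (d \<bullet> e)) + (grad \<Psi> y \<bullet> d) * flat 0 \<beta> (y \<bullet> e))) (at y)" for y .
    have "(\<integral>y. \<Psi> y * (\<beta> * flat (- 2) \<beta> (y \<bullet> e) * (e \<bullet> e)) + (grad \<Psi> y \<bullet> e) * flat 0 \<beta> (y \<bullet> e) \<partial>lborel) = 0"
      by (rule integral_derivative_compact_support(2)[OF D, of e 1])
         (auto intro!: continuous_intros cont continuous_grad[OF C\<Psi>] flat_cont \<beta> simp: out)
    then have "(\<integral>y. E \<beta> y + T \<beta> y \<partial>lborel) = 0" by (simp add: E_def T_def ee)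
    then show ?thesis using int_E[OF \<beta>] int_T[OF \<beta>] by simp
  qed
  define K1 where "K1 = (\<integral>y. \<bar>grad \<Psi> y \<bullet> e\<bar> \<partial>lborel)"
  have flat01: "\<bar>(grad \<Psi> y \<bullet> e) * flat 0 \<beta> s\<bar> \<le> \<bar>grad \<Psi> y \<bullet> e\<bar>" if "0 < \<beta>" for \<beta> s y
    using flat_nonneg[of 0 \<beta> s] flat_0_le_1[of \<beta> s] that by (simp add: abs_mult mult_left_le)
  have E_le: "(\<integral>y. E \<beta> y \<partial>lborel) \<le> K1" if \<beta>: "0 < \<beta>" for \<beta>
  proof -
    have "- (\<integral>y. T \<beta> y \<partial>lborel) \<le> (\<integral>y. \<bar>T \<beta> y\<bar> \<partial>lborel)"
      using integral_abs_bound[of lborel "T \<beta>"] by linarith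
    also have "\<dots> \<le> K1"
      unfolding K1_def using int_T[OF \<beta>] int_K1 flat01[OF \<beta>] by (intro integral_mono) (auto simp: T_def)
    finally show ?thesis using ET[OF \<beta>] by simp
  qed
  \<comment> \<open>This choice makes \<open>(1 + \<eta>) a^N\<close> the midpoint of \<open>a^N\<close> and \<open>C\<close>.\<close>
  define \<eta> where "\<eta> = (C - a ^ N) / (2 * a ^ N)"
  have aN: "0 < a ^ N" using a by simp
  have \<eta>a: "\<eta> * a ^ N = (C - a ^ N) / 2" using a by (simp add: \<eta>_def)
  have \<eta>: "0 < \<eta>" "(1 + \<eta>) * a ^ N = (C + a ^ N) / 2"
  proof -
    show "0 < \<eta>" using a aC by (simp add: \<eta>_def)
    have "(1 + \<eta>) * a ^ N = a ^ N + \<eta> * a ^ N" by (simp add: distrib_right)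
    then show "(1 + \<eta>) * a ^ N = (C + a ^ N) / 2" unfolding \<eta>a by (simp add: field_simps)
  qed
  obtain D where D: "0 \<le> D" "\<And>x y::real. 0 \<le> x \<Longrightarrow> 0 \<le> y \<Longrightarrow> (x + y) ^ N \<le> (1 + \<eta>) * x ^ N + D * y ^ N"
    using power_add_le[OF \<eta>(1)] by blast
  define K where "K = (1 + \<eta>) * (real N * K1) + D * (\<integral>y. G y \<partial>lborel)"
  have M_le: "(\<integral>y. M \<beta> y \<partial>lborel) \<le> 2 * K / (C - a ^ N)" if \<beta>: "0 < \<beta>" for \<beta>
  proof -
    define v where "v = (\<lambda>y. \<psi> y * flat a \<beta> (y \<bullet> e))"
    have Cv: "C_k k v" for k
      unfolding v_def by (intro C_k_mult C\<psi> C_k_compose[OF C_k_flat[OF \<beta>]] C_k_inner)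
    have supp: "norm y \<le> 1 \<and> 0 < y \<bullet> e" if "v y \<noteq> 0" for y
    proof
      show "norm y \<le> 1" by (rule ccontr) (use that out(1)[of y] in \<open>simp add: v_def\<close>)
      show "0 < y \<bullet> e" by (rule ccontr) (use that in \<open>simp add: v_def flat_nonpos\<close>)
    qed
    have gv: "norm (grad v y) ^ N \<le> (1 + \<eta>) * (a ^ N * M \<beta> y + real N * E \<beta> y) + D * G y" for y
    proof -
      let ?s = "y \<bullet> e"
      define f where "f = flat a \<beta> ?s"
      define f' where "f' = a * flat (a - 1) \<beta> ?s + \<beta> * flat (a - 2) \<beta> ?s"
      have f': "0 \<le> f'" using a \<beta> by (simp add: f'_def flat_nonneg)
      have f: "0 \<le> f" by (simp add: f_def flat_nonneg)
      have "((\<lambda>y. y \<bullet> e) has_derivative (\<lambda>d. d \<bullet> e)) (at y)" by (auto intro!: derivative_eq_intros)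
      from has_derivative_compose[OF this has_derivative_flat[OF \<beta>, unfolded has_field_derivative_def]]
      have "((\<lambda>y. flat a \<beta> (y \<bullet> e)) has_derivative (\<lambda>d. f' * (d \<bullet> e))) (at y)"
        unfolding f'_def .
      from has_derivative_mult[OF C_k_grad(1)[OF C\<psi>] this]
      have Dv: "(v has_derivative (\<lambda>d. \<psi> y * (f' * (d \<bullet> e)) + (grad \<psi> y \<bullet> d) * f)) (at y)"
        unfolding v_def f_def .
      have "grad v y = (\<psi> y * f') *\<^sub>R e + f *\<^sub>R grad \<psi> y"
        by (rule vector_eq_rdot[THEN iffD1], rule allI, unfold has_derivative_grad(1)[OF Dv, symmetric])
           (simp add: inner_add_left inner_commute[of e] mult_ac)
      then have "norm (grad v y) \<le> \<psi> y * f' + f * norm (grad \<psi> y)"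
        using norm_triangle_ineq[of "(\<psi> y * f') *\<^sub>R e" "f *\<^sub>R grad \<psi> y"] f f' \<psi>0[of y] e by simp
      then have "norm (grad v y) ^ N \<le> (\<psi> y * f' + f * norm (grad \<psi> y)) ^ N"
        by (intro power_mono) auto
      also have "\<dots> \<le> (1 + \<eta>) * (\<psi> y * f') ^ N + D * (f * norm (grad \<psi> y)) ^ N"
        using \<psi>0 f f' by (intro D(2)) auto
      also have "\<dots> \<le> (1 + \<eta>) * (a ^ N * M \<beta> y + real N * E \<beta> y) + D * G y"
      proof (intro add_mono mult_left_mono)
        have "(\<psi> y * f') ^ N = \<Psi> y * f' ^ N" by (simp add: power_mult_distrib \<Psi>\<psi>)
        also have "\<dots> \<le> \<Psi> y * (a ^ N * flat (- 1) (real N * \<beta>) ?s + real N * (\<beta> * flat (- 2) \<beta> ?s))"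
          unfolding f'_def a_def by (intro mult_left_mono flat_derivative_power_le N \<beta> \<Psi>0)
        finally show "(\<psi> y * f') ^ N \<le> a ^ N * M \<beta> y + real N * E \<beta> y"
          by (simp add: M_def E_def algebra_simps)
        show "(f * norm (grad \<psi> y)) ^ N \<le> G y"
        proof (cases "1 < norm y")
          case True
          then show ?thesis using N by (simp add: out G_def)
        next
          case False
          then have "?s \<le> 1" using norm_cauchy_schwarz[of y e] e by simp
          have "f \<le> 1"
          proof (cases "0 < ?s")
            case True
            have "?s powr a \<le> 1" using a True \<open>?s \<le> 1\<close> by (intro powr_le1) auto
            moreover have "exp (- (\<beta> / ?s)) \<le> 1" using True \<beta> by simp
            ultimately show ?thesis using True by (simp add: f_def flat_def mult_le_one)
          qed (simp add: f_def flat_nonpos)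
          then show ?thesis
            unfolding G_def using f by (intro power_mono) (auto intro: mult_left_le_one_le)
        qed
      qed (use \<eta> D in auto)
      finally show ?thesis .
    qed
    have vM: "\<bar>v y\<bar> ^ N / (y \<bullet> e) ^ N = M \<beta> y" for y
    proof -
      have "\<bar>v y\<bar> ^ N / (y \<bullet> e) ^ N = \<psi> y ^ N * (flat a \<beta> (y \<bullet> e) ^ N / (y \<bullet> e) ^ N)"
        using \<psi>0[of y] by (simp add: v_def abs_mult power_mult_distrib flat_nonneg)
      then show ?thesis
        unfolding a_def flat_power_ratio[OF N(1)] by (simp add: M_def \<Psi>\<psi>)
    qed
    have "ennreal (C * (\<integral>y. M \<beta> y \<partial>lborel)) = ennreal C * (\<integral>\<^sup>+y. ennreal (M \<beta> y) \<partial>lborel)"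
      using nn_integral_eq_integral[OF int_M[OF \<beta>]] M0 C0 by (simp add: ennreal_mult')
    also have "\<dots> \<le> (\<integral>\<^sup>+y. ennreal (norm (grad v y) ^ N) \<partial>lborel)"
    proof -
      have "ennreal C * (\<integral>\<^sup>+y. ennreal (\<bar>v y\<bar> ^ N / (y \<bullet> e) ^ N) \<partial>lborel)
          \<le> (\<integral>\<^sup>+y. ennreal (norm (grad v y) ^ N) \<partial>lborel)"
        by (rule hardy[OF Cv supp])
      then show ?thesis by (simp only: vM)
    qed
    also have "\<dots> \<le> (\<integral>\<^sup>+y. ennreal ((1 + \<eta>) * (a ^ N * M \<beta> y + real N * E \<beta> y) + D * G y) \<partial>lborel)"
      by (intro nn_integral_mono ennreal_leI gv)
    also have "\<dots> = ennreal (\<integral>y. (1 + \<eta>) * (a ^ N * M \<beta> y + real N * E \<beta> y) + D * G y \<partial>lborel)"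
    proof (rule nn_integral_eq_integral)
      show "AE y in lborel. 0 \<le> (1 + \<eta>) * (a ^ N * M \<beta> y + real N * E \<beta> y) + D * G y"
        using \<eta>(1) D(1) aN M0 E0[OF \<beta>] G0 by (intro AE_I2) simp
    qed (use int_M[OF \<beta>] int_E[OF \<beta>] int_G in simp)
    finally have "C * (\<integral>y. M \<beta> y \<partial>lborel) \<le> (\<integral>y. (1 + \<eta>) * (a ^ N * M \<beta> y + real N * E \<beta> y) + D * G y \<partial>lborel)"
      using \<eta>(1) D(1) aN M0 E0[OF \<beta>] G0 by (subst (asm) ennreal_le_iff) (auto intro!: integral_nonneg_AE)
    also have "\<dots> = (1 + \<eta>) * a ^ N * (\<integral>y. M \<beta> y \<partial>lborel) + (1 + \<eta>) * (real N * (\<integral>y. E \<beta> y \<partial>lborel)) + D * (\<integral>y. G y \<partial>lborel)"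
      using int_M[OF \<beta>] int_E[OF \<beta>] int_G by (simp add: algebra_simps)
    also have "\<dots> \<le> (1 + \<eta>) * a ^ N * (\<integral>y. M \<beta> y \<partial>lborel) + K"
    proof -
      have "(1 + \<eta>) * (real N * (\<integral>y. E \<beta> y \<partial>lborel)) \<le> (1 + \<eta>) * (real N * K1)"
        using E_le[OF \<beta>] \<eta>(1) by (intro mult_left_mono) auto
      then show ?thesis by (simp add: K_def)
    qed
    finally have "(C - a ^ N) * (\<integral>y. M \<beta> y \<partial>lborel) \<le> 2 * K"
      unfolding \<eta>(2) by (simp add: algebra_simps add_divide_distrib)
    then show ?thesis using aC by (simp add: field_simps)
  qed
  define b where "b = (\<lambda>k. inverse (real (Suc k)))"
  have b: "0 < b k" for k by (simp add: b_def)
  have b_lim: "b \<longlonglongrightarrow> 0" unfolding b_def by (rule LIMSEQ_inverse_real_of_nat)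
  define P where "P = (\<lambda>y. \<Psi> y * (if 0 < y \<bullet> e then 1 / (y \<bullet> e) else 0))"
  have [measurable]: "\<Psi> \<in> borel_measurable borel"
    using borel_measurable_continuous_onI[OF cont(2)] .
  have [measurable]: "(\<lambda>y. grad \<Psi> y) \<in> borel_measurable borel"
    using borel_measurable_continuous_onI[OF continuous_grad[OF C\<Psi>]] .
  have P_meas[measurable]: "P \<in> borel_measurable lborel" unfolding P_def by measurable
  have "(\<integral>\<^sup>+y. ennreal (P y) \<partial>lborel) \<le> ennreal (2 * K / (C - a ^ N))"
  proof (rule nn_integral_le_limit[OF _ _ _ tendsto_const])
    show "(\<lambda>y. ennreal (M (b k) y)) \<in> borel_measurable lborel" for k
      using borel_measurable_integrable[OF int_M[OF b]] by simp
    show "(\<integral>\<^sup>+y. ennreal (M (b k) y) \<partial>lborel) \<le> ennreal (2 * K / (C - a ^ N))" for k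
      using nn_integral_eq_integral[OF int_M[OF b]] M0 M_le[OF b] by (simp add: ennreal_leI)
    show "AE y in lborel. (\<lambda>k. ennreal (M (b k) y)) \<longlonglongrightarrow> ennreal (P y)"
    proof (rule AE_I2, rule tendsto_ennrealI)
      fix y
      show "(\<lambda>k. M (b k) y) \<longlonglongrightarrow> P y"
      proof (cases "0 < y \<bullet> e")
        case True
        have "(\<lambda>k. \<Psi> y * ((y \<bullet> e) powr - 1 * exp (- (real N * b k / (y \<bullet> e)))))
          \<longlonglongrightarrow> \<Psi> y * ((y \<bullet> e) powr - 1 * exp (- (real N * 0 / (y \<bullet> e))))"
          using True by (intro tendsto_intros b_lim) auto
        then show ?thesis using True by (simp add: M_def P_def flat_def powr_minus divide_inverse)
      qed (simp add: M_def P_def flat_nonpos)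
    qed
  qed
  then have int_P: "integrable lborel P"
  proof (intro integrableI_nonneg)
    show "AE y in lborel. 0 \<le> P y" by (intro AE_I2) (simp add: P_def \<Psi>0)
  qed (auto simp: le_less_trans)
  have E_lim: "(\<lambda>k. \<integral>y. E (b k) y \<partial>lborel) \<longlonglongrightarrow> (\<integral>y. 0 \<partial>(lborel :: 'a measure))"
  proof (rule integral_dominated_convergence[OF _ _ int_P])
    show "E (b k) \<in> borel_measurable lborel" for k
      using borel_measurable_integrable[OF int_E[OF b]] .
    have E_eq: "E \<beta> y = P y * (\<beta> / (y \<bullet> e) * exp (- (\<beta> / (y \<bullet> e))))" for \<beta> y
      by (auto simp: E_def P_def flat_def powr_minus powr_numeral divide_inverse power2_eq_square)
    show "AE y in lborel. (\<lambda>k. E (b k) y) \<longlonglongrightarrow> 0"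
    proof (rule AE_I2)
      fix y
      show "(\<lambda>k. E (b k) y) \<longlonglongrightarrow> 0"
      proof (cases "0 < y \<bullet> e")
        case True
        have "(\<lambda>k. E (b k) y) \<longlonglongrightarrow> P y * (0 / (y \<bullet> e) * exp (- (0 / (y \<bullet> e))))"
          unfolding E_eq using True by (intro tendsto_intros b_lim) auto
        then show ?thesis by simp
      qed (simp add: E_def flat_nonpos)
    qed
    show "AE y in lborel. norm (E (b k) y) \<le> P y" for k
    proof (rule AE_I2)
      fix y
      have PP: "0 \<le> P y" by (simp add: P_def \<Psi>0)
      show "norm (E (b k) y) \<le> P y"
      proof (cases "0 < y \<bullet> e")
        case True
        define x where "x = b k / (y \<bullet> e)"
        have x: "0 \<le> x" using True b[of k] by (simp add: x_def)
        have "x \<le> exp x" using exp_ge_add_one_self[of x] by linarith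
        then have "x * exp (- x) \<le> exp x * exp (- x)" by (intro mult_right_mono) auto
        then have "x * exp (- x) \<le> 1" by (simp add: exp_minus)
        then show ?thesis
          unfolding E_eq x_def[symmetric] using PP x by (simp add: abs_mult mult_left_le)
      qed (simp add: E_def flat_nonpos PP)
    qed
  qed auto
  define T0 where "T0 = (\<lambda>y. (grad \<Psi> y \<bullet> e) * (if 0 < y \<bullet> e then 1 else 0))"
  have T0_meas[measurable]: "T0 \<in> borel_measurable lborel" unfolding T0_def by measurable
  have T_lim: "(\<lambda>k. \<integral>y. T (b k) y \<partial>lborel) \<longlonglongrightarrow> (\<integral>y. T0 y \<partial>lborel)"
  proof (rule integral_dominated_convergence[OF _ _ int_K1])
    show "T (b k) \<in> borel_measurable lborel" for k
      using borel_measurable_integrable[OF int_T[OF b]] .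
    show "AE y in lborel. norm (T (b k) y) \<le> \<bar>grad \<Psi> y \<bullet> e\<bar>" for k
      using flat01[OF b] by (intro AE_I2) (simp add: T_def)
    show "AE y in lborel. (\<lambda>k. T (b k) y) \<longlonglongrightarrow> T0 y"
    proof (rule AE_I2)
      fix y
      show "(\<lambda>k. T (b k) y) \<longlonglongrightarrow> T0 y"
      proof (cases "0 < y \<bullet> e")
        case True
        have "(\<lambda>k. (grad \<Psi> y \<bullet> e) * exp (- (b k / (y \<bullet> e)))) \<longlonglongrightarrow> (grad \<Psi> y \<bullet> e) * exp (- (0 / (y \<bullet> e)))"
          using True by (intro tendsto_intros b_lim) auto
        then show ?thesis using True by (simp add: T_def T0_def flat_def)
      qed (simp add: T_def T0_def flat_nonpos)
    qed
  qed auto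
  have "(\<lambda>k. - (\<integral>y. T (b k) y \<partial>lborel)) \<longlonglongrightarrow> - (\<integral>y. T0 y \<partial>lborel)"
    by (intro tendsto_minus T_lim)
  then have "(\<lambda>k. \<integral>y. E (b k) y \<partial>lborel) \<longlonglongrightarrow> - (\<integral>y. T0 y \<partial>lborel)"
    using ET[OF b] by simp
  with E_lim have "(\<integral>y. T0 y \<partial>lborel) = 0"
    using LIMSEQ_unique by fastforce
  then have Z: "(\<integral>y. - T0 y \<partial>lborel) = 0" by simp
  have T0_nonneg: "0 \<le> - T0 y" for y
    unfolding T0_def grad\<Psi> by (simp add: flat_nonneg mult_nonneg_nonneg)
  have int_T0: "integrable lborel (\<lambda>y. - T0 y)"
  proof (rule Bochner_Integration.integrable_bound[OF int_K1])
    show "AE y in lborel. norm (- T0 y) \<le> norm \<bar>grad \<Psi> y \<bullet> e\<bar>"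
      by (intro AE_I2) (simp add: T0_def)
  qed simp
  have "AE y in lborel. - T0 y = 0"
    using integral_nonneg_eq_0_iff_AE[OF int_T0] T0_nonneg Z by simp
  then have AE_U: "AE y in lborel. y \<notin> {y. norm y < 1 \<and> 0 < y \<bullet> e}"
  proof eventually_elim
    case (elim y)
    show ?case
    proof
      assume y: "y \<in> {y. norm y < 1 \<and> 0 < y \<bullet> e}"
      then have "0 < q y" by (simp add: q_def abs_square_less_1)
      then have "0 < flat (- 2) (real N) (q y)" by (simp add: flat_def)
      then have "0 < - T0 y" unfolding T0_def grad\<Psi> using y rN by simp
      with elim show False by simp
    qed
  qed
  let ?U = "{y. norm y < 1 \<and> 0 < y \<bullet> e}"
  have "open ?U" by (intro open_Collect_conj open_Collect_less continuous_intros)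
  moreover have "(1 / 2) *\<^sub>R e \<in> ?U" using e ee by simp
  moreover have "negligible ?U"
  proof -
    have "?U \<in> sets lborel" using \<open>open ?U\<close> by simp
    then have "?U \<in> null_sets lborel" using AE_U by (simp add: AE_iff_null_sets)
    then show ?thesis by (simp add: negligible_iff_null_sets null_sets_completionI)
  qed
  ultimately show False using open_not_negligible by blast
qed


section \<open>The constant and its non-attainment\<close>

lemma test_functions_subset_W1_0:
  assumes \<phi>: "\<phi> \<in> test_functions \<Omega>" and \<Omega>: "open \<Omega>" and p: "p \<ge> 1"
  shows "\<phi> \<in> W1_0 p \<Omega>"
proof -
  have g: "has_weak_gradient \<Omega> \<phi> (grad \<phi>)"
    by (rule has_weak_gradient_C1[OF \<Omega> test_functionsD(1)[OF \<phi>]])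
  have d: "has_weak_gradient \<Omega> (\<lambda>x. \<phi> x - \<phi> x) (\<lambda>x. grad \<phi> x - grad \<phi> x)"
    by (rule has_weak_gradient_diff[OF g g \<Omega>])
  have "(\<lambda>x. grad \<phi> x - grad \<phi> x) \<in> Lp p \<Omega>"
    by (rule Lp_diff[OF Lp_test(2)[OF \<phi> \<Omega> p] Lp_test(2)[OF \<phi> \<Omega> p]])
  from weak_gradient_Lp(2)[OF d this \<Omega>] have "W1_norm p \<Omega> (\<lambda>x. \<phi> x - \<phi> x) = 0"
    using p by (simp add: W1_norm_def power_0_left)
  then have "(\<lambda>n::nat. W1_norm p \<Omega> (\<lambda>x. \<phi> x - \<phi> x)) \<longlonglongrightarrow> 0" by simp
  moreover have "\<phi> \<in> W1 p \<Omega>"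
    unfolding W1_def using Lp_test[OF \<phi> \<Omega> p] g by blast
  ultimately show ?thesis
    unfolding W1_0_def using \<phi> by (intro CollectI conjI exI[of _ "\<lambda>n. \<phi>"]) auto
qed

lemma domain_subset_ball_outer_radius:
  assumes "open \<Omega>" "bounded \<Omega>" "\<Omega> \<noteq> ({} :: 'a::euclidean_space set)"
  shows "\<Omega> \<subseteq> ball 0 (outer_radius \<Omega>)" "0 < outer_radius \<Omega>"
proof -
  have "bdd_above (norm ` \<Omega>)" using assms(2) by (auto simp: bounded_iff bdd_above_def)
  then have "\<Omega> \<subseteq> cball 0 (outer_radius \<Omega>)"
    unfolding outer_radius_def by (auto intro: cSUP_upper)
  then have "\<Omega> \<subseteq> interior (cball 0 (outer_radius \<Omega>))"
    using assms(1) by (rule interior_maximal)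
  then show sub: "\<Omega> \<subseteq> ball 0 (outer_radius \<Omega>)" by simp
  obtain x where "x \<in> \<Omega>" using assms(3) by blast
  with sub have "norm x < outer_radius \<Omega>" by auto
  then show "0 < outer_radius \<Omega>" using norm_ge_zero[of x] by linarith
qed

lemma hardy_quotient_greater:
  fixes \<Omega> :: "'a::euclidean_space set"
  assumes N2: "DIM('a) \<ge> 2" and \<Omega>: "open \<Omega>" "\<Omega> \<subseteq> ball 0 (outer_radius \<Omega>)"
    and u: "u \<in> W1_0_nonzero DIM('a) \<Omega>"
  shows "ennreal (hardy_ratio DIM('a) ^ DIM('a)) < hardy_quotient \<Omega> u"
proof -
  let ?N = "DIM('a)" and ?M = "lebesgue_on \<Omega>"
  define n where "n = (\<integral>\<^sup>+x. ennreal (norm (weak_gradient \<Omega> u x) ^ ?N) \<partial>?M)"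
  define d where "d = (\<integral>\<^sup>+x. ennreal (hardy_weight (outer_radius \<Omega>) x * \<bar>u x\<bar> ^ ?N) \<partial>?M)"
  note strict = hardy_inequality_strict[OF N2 \<Omega> u, folded n_def d_def]
  have q: "hardy_quotient \<Omega> u = n / d"
    unfolding hardy_quotient_def n_def d_def by (simp add: hardy_weight_def)
  have a: "0 < hardy_ratio ?N ^ ?N" using N2 by (simp add: hardy_ratio_def)
  have "d \<noteq> \<infinity>"
  proof
    assume "d = \<infinity>"
    moreover have "hardy_ratio ?N \<noteq> 0" using N2 by (simp add: hardy_ratio_def)
    ultimately have "ennreal (hardy_ratio ?N ^ ?N) * d = \<infinity>" using a by (simp add: ennreal_mult_top)
    then show False using strict(1,2) by simp
  qed
  then obtain d' where d': "d = ennreal d'" "0 < d'"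
    using strict(3) by (cases d) auto
  obtain n' where n': "n = ennreal n'" "0 \<le> n'"
    using strict(2) by (cases n) auto
  have "hardy_ratio ?N ^ ?N * d' < n'"
    using strict(1) a d' n' by (simp add: ennreal_mult[symmetric] ennreal_less_iff)
  then have "hardy_ratio ?N ^ ?N < n' / d'" using d' by (simp add: field_simps)
  then show ?thesis
    unfolding q using d' n' a by (simp add: divide_ennreal ennreal_less_iff)
qed

lemma test_function_hardy_inequality:
  fixes \<Omega> :: "'a::euclidean_space set"
  assumes N2: "DIM('a) \<ge> 2" and \<Omega>: "open \<Omega>" and \<phi>: "\<phi> \<in> test_functions \<Omega>"
    and C: "0 < C" "ennreal C \<le> hardy_const \<Omega>"
  shows "ennreal C * (\<integral>\<^sup>+x. ennreal (hardy_weight (outer_radius \<Omega>) x * \<bar>\<phi> x\<bar> ^ DIM('a)) \<partial>lborel)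
      \<le> (\<integral>\<^sup>+x. ennreal (norm (grad \<phi> x) ^ DIM('a)) \<partial>lborel)"
proof -
  let ?N = "DIM('a)" and ?M = "lebesgue_on \<Omega>"
  have N1: "?N \<ge> 1" using N2 by simp
  have out: "\<phi> x = 0" "grad \<phi> x = 0" if "x \<notin> \<Omega>" for x
    using that test_functionsD(4)[OF \<phi>] test_functionsD(5,6)[OF \<phi>, of x] by blast+
  define n where "n = (\<integral>\<^sup>+x. ennreal (norm (weak_gradient \<Omega> \<phi> x) ^ ?N) \<partial>?M)"
  define d where "d = (\<integral>\<^sup>+x. ennreal (hardy_weight (outer_radius \<Omega>) x * \<bar>\<phi> x\<bar> ^ ?N) \<partial>?M)"
  have n: "n = (\<integral>\<^sup>+x. ennreal (norm (grad \<phi> x) ^ ?N) \<partial>lborel)"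
  proof -
    have "n = (\<integral>\<^sup>+x. ennreal (norm (grad \<phi> x) ^ ?N) \<partial>?M)"
      unfolding n_def
      by (rule weak_gradient_Lp(3)[OF has_weak_gradient_C1[OF \<Omega> test_functionsD(1)[OF \<phi>]] Lp_test(2)[OF \<phi> \<Omega> N1] \<Omega>])
    also have "\<dots> = (\<integral>\<^sup>+x. ennreal (norm (grad \<phi> x) ^ ?N) \<partial>lborel)"
      by (rule nn_integral_lebesgue_on_open[OF \<Omega>]) (use out N1 in \<open>simp add: power_0_left\<close>)
    finally show ?thesis .
  qed
  have d: "d = (\<integral>\<^sup>+x. ennreal (hardy_weight (outer_radius \<Omega>) x * \<bar>\<phi> x\<bar> ^ ?N) \<partial>lborel)"
    unfolding d_def by (rule nn_integral_lebesgue_on_open[OF \<Omega>]) (use out N1 in \<open>simp add: power_0_left\<close>)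
  have "ennreal C * d \<le> n"
  proof (cases "AE x in ?M. \<phi> x = 0")
    case True
    then have "d = (\<integral>\<^sup>+x. 0 \<partial>?M)"
      unfolding d_def by (intro nn_integral_cong_AE) (auto elim!: eventually_mono simp: power_0_left)
    then show ?thesis by simp
  next
    case False
    then have "\<phi> \<in> W1_0_nonzero ?N \<Omega>"
      using test_functions_subset_W1_0[OF \<phi> \<Omega> N1] by (simp add: W1_0_nonzero_def)
    then have "hardy_const \<Omega> \<le> hardy_quotient \<Omega> \<phi>"
      unfolding hardy_const_def by (rule INF_lower)
    also have "\<dots> = n / d"
      unfolding hardy_quotient_def n_def d_def by (simp add: hardy_weight_def)
    finally have le: "ennreal C \<le> n / d" using C(2) by simp
    show ?thesis
    proof (cases n)
      case top
      then show ?thesis by simp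
    next
      case (real n')
      note n' = real
      show ?thesis
      proof (cases d)
        case (real d')
        show ?thesis
        proof (cases "d' = 0")
          case False
          with real have "C \<le> n' / d'"
            using le n' C(1) by (simp add: divide_ennreal)
          then have "C * d' \<le> n'" using False real by (simp add: field_simps)
          then show ?thesis using real n' C(1) by (simp add: ennreal_mult[symmetric] ennreal_leI)
        qed (use real in simp)
      next
        case top
        then show ?thesis using le n' C(1) by simp
      qed
    qed
  qed
  then show ?thesis by (simp only: n d)
qed

theorem theorem2:
  fixes \<Omega> :: "(real ^ 'n) set" and R :: real
  assumes "CARD('n) \<ge> 2"
    and "open \<Omega>" and "connected \<Omega>" and "\<Omega> \<noteq> {}" and "bounded \<Omega>"
    and "R = outer_radius \<Omega>"
    and "\<exists>x0 \<in> frontier \<Omega> \<inter> frontier (ball 0 R). interior_sphere_condition \<Omega> x0"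
  shows "hardy_const \<Omega> = ennreal (((real CARD('n) - 1) / real CARD('n)) ^ CARD('n)) \<and>
         \<not> hardy_attained \<Omega>"
proof -
  let ?N = "CARD('n)"
  have dim: "DIM(real ^ 'n) = ?N" by simp
  have N2: "DIM(real ^ 'n) \<ge> 2" using assms(1) by simp
  note \<Omega> = domain_subset_ball_outer_radius[OF assms(2,5,4)]
  have R: "0 < R" "\<Omega> \<subseteq> ball 0 R" using \<Omega> assms(6) by auto
  have greater: "ennreal (hardy_ratio ?N ^ ?N) < hardy_quotient \<Omega> u" if "u \<in> W1_0_nonzero ?N \<Omega>" for u
    using hardy_quotient_greater[OF N2 assms(2) \<Omega>(1)] that by simp
  have lower: "ennreal (hardy_ratio ?N ^ ?N) \<le> hardy_const \<Omega>"
    unfolding hardy_const_def dim by (intro INF_greatest less_imp_le greater)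
  obtain x0 c r where x0: "x0 \<in> frontier (ball 0 R)" and r: "0 < r" "ball c r \<subseteq> \<Omega>" "x0 \<in> frontier (ball c r)"
    using assms(7) unfolding interior_sphere_condition_def by blast
  have nx0: "norm x0 = R" "dist c x0 = r"
    using x0 r R by (simp_all add: frontier_ball)
  have upper: "hardy_const \<Omega> \<le> ennreal (hardy_ratio ?N ^ ?N)"
  proof (rule ccontr)
    assume "\<not> hardy_const \<Omega> \<le> ennreal (hardy_ratio ?N ^ ?N)"
    then obtain c' where c': "ennreal (hardy_ratio ?N ^ ?N) < c'" "c' < hardy_const \<Omega>"
      using dense[of "ennreal (hardy_ratio ?N ^ ?N)" "hardy_const \<Omega>"] by (auto simp: not_le)
    have "c' < top" using c'(2) by (rule less_le_trans) simp
    then obtain C where C: "c' = ennreal C" "0 \<le> C" by (cases c') auto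
    have a: "0 < hardy_ratio ?N ^ ?N" using assms(1) by (simp add: hardy_ratio_def)
    have aC: "hardy_ratio ?N ^ ?N < C" using c'(1) C a by (simp add: ennreal_less_iff)
    then have C0: "0 < C" using a by linarith
    have le: "ennreal C \<le> hardy_const \<Omega>" using c'(2) C by simp
    have "norm (x0 /\<^sub>R R) = 1" using nx0 R by simp
    from half_space_hardy_constant[OF N2 this]
      half_space_hardy_transfer[OF R(1) r(1,2) R(2) nx0 C(2)
        test_function_hardy_inequality[OF N2 assms(2) _ C0 le, folded assms(6)]]
    have "C \<le> hardy_ratio ?N ^ ?N" unfolding dim by blast
    then show False using aC by simp
  qed
  have const: "hardy_const \<Omega> = ennreal (hardy_ratio ?N ^ ?N)"
    using lower upper by (rule antisym[rotated])
  moreover have "\<not> hardy_attained \<Omega>"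
  proof
    assume "hardy_attained \<Omega>"
    then obtain u where "u \<in> W1_0_nonzero ?N \<Omega>" "hardy_quotient \<Omega> u = hardy_const \<Omega>"
      unfolding hardy_attained_def dim by blast
    with greater[of u] const show False by simp
  qed
  ultimately show ?thesis by (simp add: hardy_ratio_def)
qed

end
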